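(* For each $N$ let $X_N(\sigma)=\sum_{1\le i,j\le N} g_{ij}\sigma_i\sigma_j$, $\sigma\in\{-1,1\}^N$, where $(g_{ij})_{1\le i,j\le N}$ are i.i.d. standard Gaussian random variables, and let $M_N:=\max_{\sigma\in\{-1,1\}^N}X_N(\sigma)$. There is an absolute constant $C$ such that, with $r_N=(\log N)^{1/8}$, $\delta_N=(\log N)^{-1/8}$, $\epsilon_N=e^{-(\log N)^{1/8}}$ and $\gamma_N=C(\log N)^{-1/12}$, the following holds. Fix any $\alpha\in(0,1]$. Then for all sufficiently large $N$, with probability at least $1-2\gamma_N$ there exists a set $A\subseteq\{-1,1\}^N$ such that (a) $|A|\ge r_N$; (b) $R_{\sigma^1,\sigma^2}^2\le\epsilon_N$ for all $\sigma^1,\sigma^2\in A$ with $\sigma^1\neq\sigma^2$; and (c) $|X_N(\sigma)-\alpha M_N|\le\delta_N|M_N|$ for all $\sigma\in A$.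
   Context: For $\sigma^1,\sigma^2\in\{-1,1\}^N$ the overlap is $R_{\sigma^1,\sigma^2}:=\frac1N\sum_{i=1}^N\sigma^1_i\sigma^2_i$. *)

theory Defs
  imports "HOL-Probability.Probability"
begin

text \<open>The hypercube \<open>{-1,1}\<^sup>N\<close> consists of extensional functions on \<open>{1..N}\<close>, so that distinct
  functions are distinct sign vectors and the hypercube is finite.\<close>

definition hypercube :: "nat \<Rightarrow> (nat \<Rightarrow> real) set" where
  "hypercube N = {1..N} \<rightarrow>\<^sub>E {-1, 1}"

definition overlap :: "nat \<Rightarrow> (nat \<Rightarrow> real) \<Rightarrow> (nat \<Rightarrow> real) \<Rightarrow> real" where
  "overlap N \<sigma> \<tau> = (1 / real N) * (\<Sum>i=1..N. \<sigma> i * \<tau> i)"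

definition iid_std_gaussian ::
  "'a measure \<Rightarrow> nat \<Rightarrow> (nat \<Rightarrow> nat \<Rightarrow> 'a \<Rightarrow> real) \<Rightarrow> bool" where
  "iid_std_gaussian M N g \<longleftrightarrow>
     prob_space.indep_vars M (\<lambda>_. borel) (\<lambda>(i, j). g i j) ({1..N} \<times> {1..N}) \<and>
     (\<forall>i\<in>{1..N}. \<forall>j\<in>{1..N}. distributed M lborel (g i j) std_normal_density)"

definition energy :: "nat \<Rightarrow> (nat \<Rightarrow> nat \<Rightarrow> 'a \<Rightarrow> real) \<Rightarrow> 'a \<Rightarrow> (nat \<Rightarrow> real) \<Rightarrow> real" where
  "energy N g \<omega> \<sigma> = (\<Sum>i=1..N. \<Sum>j=1..N. g i j \<omega> * \<sigma> i * \<sigma> j)"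

definition max_energy :: "nat \<Rightarrow> (nat \<Rightarrow> nat \<Rightarrow> 'a \<Rightarrow> real) \<Rightarrow> 'a \<Rightarrow> real" where
  "max_energy N g \<omega> = Max (energy N g \<omega> ` hypercube N)"

definition r_seq :: "nat \<Rightarrow> real" where
  "r_seq N = ln (real N) powr (1/8)"

definition \<delta>_seq :: "nat \<Rightarrow> real" where
  "\<delta>_seq N = ln (real N) powr (-1/8)"

definition \<epsilon>_seq :: "nat \<Rightarrow> real" where
  "\<epsilon>_seq N = exp (- (ln (real N) powr (1/8)))"

definition \<gamma>_seq :: "real \<Rightarrow> nat \<Rightarrow> real" where
  "\<gamma>_seq C N = C * ln (real N) powr (-1/12)"

end

theory Submission imports Defs "HOL-Real_Asymp.Real_Asymp" begin

text \<open>Near-maximizers are produced by sampling from Gibbs measures at inverse temperature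
  \<open>\<beta> = (ln N) powr (3/8)\<close> (relative to the scale \<open>sqrt N\<close>) after resampling each coupling independently
  with a small probability \<open>1 - r\<close>. The energy is barely affected. The overlap of two such samples,
  as a function of the correlation \<open>s\<close> between the two resampled disorders, is
  \<open>\<phi> s\<close>, the noise stability of the local magnetizations, so \<open>\<phi>\<close> is log-convex: \<open>(\<phi> s)\<^sup>2 \<le> \<phi> (s\<^sup>2)\<close>
  after normalization. Hence smallness of \<open>\<phi>\<close> at \<open>s = 1 / (8 * \<beta>\<^sup>2)\<close> propagates to \<open>s\<close> close to \<open>1\<close>.
  At \<open>s = 1 / (8 * \<beta>\<^sup>2)\<close> a Guerra-type interpolation works: along \<open>l = l0 - b\<^sup>2 * s\<close> the coupled free energy
  with an extra term \<open>l * V\<close> in the overlap is nonincreasing up to a third-order error, because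
  sharing one more coupling costs a covariance whose negative part has a sign, and at \<open>s = 0\<close> gauge
  invariance reduces it to an exponential moment of the overlap of two uniform configurations.

  The level \<open>\<alpha> M\<close> is reached by running this on the subsystem of the first \<open>n\<close> spins, whose expected
  maximum is \<open>\<alpha>\<close> times that of the full system, the other spins being uniform.\<close>

subsection \<open>Averages over random subsets\<close>

text \<open>Resampling whole couplings, instead of rotating the Gaussians, makes the correlation a
  polynomial in \<open>s\<close>, differentiated by Russo's formula without integration by parts.
  The price is a remainder of order \<open>b ^ 3\<close> per coupling, affordable since
  \<open>b\<close> is the inverse temperature over \<open>sqrt n\<close>.

  The exponents balance two losses. Write \<open>L = ln N\<close>. Finite temperature and resampling
  cost a fraction of order \<open>L powr (-3/8)\<close> of the maximum, up to a factor sqrt(ln L);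
  divided by \<open>\<delta>_seq N\<close> this is still below \<open>L powr (-1/12)\<close>. The
  interpolation bounds the normalized stability by a power of \<open>L\<close> over sqrt(N). Each
  squaring step brings the correlation closer to 1 but takes a square root of this bound. With 2^k
  of order \<open>L powr (3/4)\<close>, what remains is about exp(-L^(1/4) / 4), far below
  \<open>\<epsilon>_seq N\<close> even after multiplication by the size of the set.

  Given the disorder, the law of a sample is a deterministic measure on the cube. A set can be
  picked greedily from it without extra randomness, so only expectations of overlaps and energy
  errors have to be controlled.\<close>

definition bern :: "real \<Rightarrow> 'i set \<Rightarrow> ('i set \<Rightarrow> real) \<Rightarrow> real" where
  "bern s I F = (\<Sum>S\<in>Pow I. s ^ card S * (1 - s) ^ card (I - S) * F S)"

lemma bern_empty [simp]: "bern s {} F = F {}"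
  by (simp add: bern_def)

lemma bern_insert:
  assumes "finite I" "a \<notin> I"
  shows "bern s (insert a I) F = s * bern s I (\<lambda>S. F (insert a S)) + (1 - s) * bern s I F"
proof -
  have disj: "Pow I \<inter> insert a ` Pow I = {}" using assms by auto
  have inj: "inj_on (insert a) (Pow I)"
    using assms by (auto simp: inj_on_def)
  have "bern s (insert a I) F
      = (\<Sum>S\<in>Pow I. s ^ card S * (1 - s) ^ card (insert a I - S) * F S)
      + (\<Sum>S\<in>insert a ` Pow I. s ^ card S * (1 - s) ^ card (insert a I - S) * F S)"
    unfolding bern_def Pow_insert using assms disj by (subst sum.union_disjoint) auto
  also have "(\<Sum>S\<in>insert a ` Pow I. s ^ card S * (1 - s) ^ card (insert a I - S) * F S)
      = (\<Sum>S\<in>Pow I. s ^ card (insert a S) * (1 - s) ^ card (insert a I - insert a S) * F (insert a S))"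
    using inj by (subst sum.reindex) auto
  also have "\<dots> = s * bern s I (\<lambda>S. F (insert a S))"
    unfolding bern_def sum_distrib_left
  proof (intro sum.cong refl)
    fix S assume "S \<in> Pow I"
    then have S: "a \<notin> S" "finite S" "insert a I - insert a S = I - S"
      using assms finite_subset by auto
    show "s ^ card (insert a S) * (1 - s) ^ card (insert a I - insert a S) * F (insert a S)
       = s * (s ^ card S * (1 - s) ^ card (I - S) * F (insert a S))"
      using S by (simp add: mult_ac)
  qed
  also have "(\<Sum>S\<in>Pow I. s ^ card S * (1 - s) ^ card (insert a I - S) * F S) = (1 - s) * bern s I F"
    unfolding bern_def sum_distrib_left
  proof (intro sum.cong refl)
    fix S assume S: "S \<in> Pow I"
    then have "insert a I - S = insert a (I - S)" "a \<notin> I - S" "finite (I - S)"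
      using assms by auto
    then show "s ^ card S * (1 - s) ^ card (insert a I - S) * F S
       = (1 - s) * (s ^ card S * (1 - s) ^ card (I - S) * F S)"
      by (simp add: mult_ac)
  qed
  finally show ?thesis by simp
qed

lemma bern_add: "bern s I (\<lambda>S. F S + H S) = bern s I F + bern s I H"
  and bern_diff: "bern s I (\<lambda>S. F S - H S) = bern s I F - bern s I H"
  and bern_cmult: "bern s I (\<lambda>S. c * F S) = c * bern s I F"
  by (simp_all add: bern_def algebra_simps sum.distrib sum_subtractf sum_distrib_left)

lemma bern_sum: "bern s I (\<lambda>S. \<Sum>c\<in>C. F c S) = (\<Sum>c\<in>C. bern s I (F c))"
  unfolding bern_def by (subst sum.swap) (simp add: sum_distrib_left)

lemma bern_const [simp]: "finite I \<Longrightarrow> bern s I (\<lambda>_. c) = c"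
  by (induction I rule: finite_induct) (simp_all add: bern_insert algebra_simps)

lemma bern_zero: "finite I \<Longrightarrow> bern 0 I F = F {}"
  by (induction I arbitrary: F rule: finite_induct) (simp_all add: bern_insert)

lemma bern_mono:
  assumes "0 \<le> s" "s \<le> 1" "\<And>S. S \<subseteq> I \<Longrightarrow> F S \<le> H S"
  shows "bern s I F \<le> bern s I H"
  unfolding bern_def using assms by (intro sum_mono mult_left_mono) auto

lemma bern_cong: "(\<And>S. S \<subseteq> I \<Longrightarrow> F S = H S) \<Longrightarrow> bern s I F = bern s I H"
  unfolding bern_def by (intro sum.cong) auto

lemma bern_card_compl:
  "finite I \<Longrightarrow> bern s I (\<lambda>S. real (card (I - S))) = (1 - s) * card I"
proof (induction I rule: finite_induct)
  case (insert a I)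
  have 1: "bern s I (\<lambda>S. real (card (insert a I - insert a S))) = bern s I (\<lambda>S. real (card (I - S)))"
    using insert by (intro bern_cong arg_cong[of _ _ real] arg_cong[of _ _ card]) auto
  have 2: "bern s I (\<lambda>S. real (card (insert a I - S))) = bern s I (\<lambda>S. 1 + real (card (I - S)))"
  proof (intro bern_cong)
    fix S assume "S \<subseteq> I"
    then have "insert a I - S = insert a (I - S)" "a \<notin> I - S" "finite (I - S)"
      using insert by auto
    then show "real (card (insert a I - S)) = 1 + real (card (I - S))" by simp
  qed
  show ?case
    unfolding bern_insert[OF insert.hyps] 1 2 bern_add
    using insert.hyps by (simp add: insert.IH) (simp add: algebra_simps)
qed simp

text \<open>A coordinate lies in both of two independent random sets with probability
  \<open>s * t\<close>, independently over coordinates. Hence two resamplings of one field with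
  parameter \<open>r\<close> have mutual correlation \<open>r\<^sup>2\<close>.\<close>

lemma bern_Int:
  "finite I \<Longrightarrow> bern s I (\<lambda>S. bern t I (\<lambda>T. F (S \<inter> T))) = bern (s * t) I F"
proof (induction I arbitrary: F rule: finite_induct)
  case (insert a I)
  have 1: "bern s I (\<lambda>S. bern t I (\<lambda>T. F (insert a S \<inter> insert a T))) = bern (s * t) I (\<lambda>S. F (insert a S))"
    by (subst insert.IH[symmetric]) (intro bern_cong arg_cong[of _ _ F], auto)
  have 2: "bern s I (\<lambda>S. bern t I (\<lambda>T. F (S \<inter> insert a T))) = bern (s * t) I F"
    using insert.IH[of F] insert.hyps
    by (subst insert.IH[of F, symmetric]) (intro bern_cong, auto intro!: bern_cong arg_cong[of _ _ F])
  have 3: "bern s I (\<lambda>S. bern t I (\<lambda>T. F (insert a S \<inter> T))) = bern (s * t) I F"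
    using insert.IH[of F] insert.hyps
    by (subst insert.IH[of F, symmetric]) (intro bern_cong, auto intro!: bern_cong arg_cong[of _ _ F])
  show ?case
    using insert.hyps insert.IH[of F]
    by (simp add: bern_insert bern_add bern_cmult 1 2 3 insert.IH[of "\<lambda>S. F (insert a S)"])
       (simp add: algebra_simps)
qed simp

text \<open>Russo's formula.\<close>

lemma DERIV_bern:
  assumes "finite I" "\<And>S. S \<subseteq> I \<Longrightarrow> ((\<lambda>t. F t S) has_real_derivative D S) (at s)"
  shows "((\<lambda>t. bern t I (F t)) has_real_derivative
     bern s I D + (\<Sum>a\<in>I. bern s (I - {a}) (\<lambda>S. F s (insert a S) - F s S))) (at s)"
  using assms
proof (induction I arbitrary: F D rule: finite_induct)
  case (insert b I)
  have ih1: "((\<lambda>t. bern t I (\<lambda>S. F t (insert b S))) has_real_derivative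
     bern s I (\<lambda>S. D (insert b S)) + (\<Sum>a\<in>I. bern s (I - {a}) (\<lambda>S. F s (insert b (insert a S)) - F s (insert b S)))) (at s)"
    by (rule insert.IH) (rule insert.prems, auto)
  have ih2: "((\<lambda>t. bern t I (F t)) has_real_derivative
     bern s I D + (\<Sum>a\<in>I. bern s (I - {a}) (\<lambda>S. F s (insert a S) - F s S))) (at s)"
    by (rule insert.IH) (rule insert.prems, auto)
  let ?A1 = "\<Sum>a\<in>I. bern s (I - {a}) (\<lambda>S. F s (insert b (insert a S)) - F s (insert b S))"
  let ?A2 = "\<Sum>a\<in>I. bern s (I - {a}) (\<lambda>S. F s (insert a S) - F s S)"
  have split: "(\<Sum>a\<in>I. bern s (insert b I - {a}) (\<lambda>S. F s (insert a S) - F s S)) = s * ?A1 + (1 - s) * ?A2"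
    unfolding sum_distrib_left sum.distrib[symmetric]
  proof (intro sum.cong refl)
    fix a assume a: "a \<in> I"
    then have "insert b I - {a} = insert b (I - {a})" "b \<notin> I - {a}" using insert.hyps by auto
    then show "bern s (insert b I - {a}) (\<lambda>S. F s (insert a S) - F s S)
      = s * bern s (I - {a}) (\<lambda>S. F s (insert b (insert a S)) - F s (insert b S))
       + (1 - s) * bern s (I - {a}) (\<lambda>S. F s (insert a S) - F s S)"
      using insert.hyps by (simp add: bern_insert insert_commute)
  qed
  have "insert b I - {b} = I" using insert.hyps by auto
  then have *: "bern s (insert b I) D + (\<Sum>a\<in>insert b I. bern s (insert b I - {a}) (\<lambda>S. F s (insert a S) - F s S))
     = (bern s I (\<lambda>S. F s (insert b S)) + s * (bern s I (\<lambda>S. D (insert b S)) + ?A1))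
       + (- bern s I (F s) + (1 - s) * (bern s I D + ?A2))"
    using insert.hyps
    by (simp only: sum.insert split not_False_eq_True)
       (simp only: bern_insert[OF insert.hyps] bern_diff, simp add: algebra_simps)
  show ?case
    unfolding * unfolding bern_insert[OF insert.hyps]
    by (rule derivative_eq_intros ih1 ih2 refl)+ (simp add: algebra_simps)
qed simp

subsection \<open>Finite Gibbs averages\<close>

text \<open>The free energy (log partition function); the inverse temperature is absorbed into
  \<open>h\<close>.\<close>

definition lse :: "'c set \<Rightarrow> ('c \<Rightarrow> real) \<Rightarrow> real" where
  "lse C h = ln (\<Sum>c\<in>C. exp (h c))"

definition gibbs :: "'c set \<Rightarrow> ('c \<Rightarrow> real) \<Rightarrow> 'c \<Rightarrow> real" where
  "gibbs C h c = exp (h c) / (\<Sum>c\<in>C. exp (h c))"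

definition gavg :: "'c set \<Rightarrow> ('c \<Rightarrow> real) \<Rightarrow> ('c \<Rightarrow> real) \<Rightarrow> real" where
  "gavg C h f = (\<Sum>c\<in>C. gibbs C h c * f c)"

locale finite_gibbs =
  fixes C :: "'c set"
  assumes finC: "finite C" and neC: "C \<noteq> {}"
begin

lemma Z_pos: "(\<Sum>c\<in>C. exp (h c :: real)) > 0"
  using finC neC by (intro sum_pos) auto

lemma gibbs_pos: "gibbs C h c > 0"
  unfolding gibbs_def using Z_pos[of h] by simp

lemma gibbs_sum: "(\<Sum>c\<in>C. gibbs C h c) = 1"
  unfolding gibbs_def sum_divide_distrib[symmetric] using Z_pos[of h] by simp

lemma gavg_alt: "gavg C h f = (\<Sum>c\<in>C. f c * exp (h c)) / (\<Sum>c\<in>C. exp (h c))"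
  by (simp add: gavg_def gibbs_def sum_divide_distrib mult.commute)

lemma gavg_const [simp]: "gavg C h (\<lambda>_. k) = k"
  using gibbs_sum[of h] by (simp add: gavg_def sum_distrib_right[symmetric])

lemma gavg_add: "gavg C h (\<lambda>c. f c + g c) = gavg C h f + gavg C h g"
  and gavg_diff: "gavg C h (\<lambda>c. f c - g c) = gavg C h f - gavg C h g"
  and gavg_cmult: "gavg C h (\<lambda>c. k * f c) = k * gavg C h f"
  by (simp_all add: gavg_def algebra_simps sum.distrib sum_subtractf sum_distrib_left)

lemma gavg_mono: "(\<And>c. c \<in> C \<Longrightarrow> f c \<le> g c) \<Longrightarrow> gavg C h f \<le> gavg C h g"
  unfolding gavg_def using gibbs_pos[THEN less_imp_le] by (intro sum_mono mult_left_mono) auto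

lemma gavg_abs_le:
  assumes "\<And>c. c \<in> C \<Longrightarrow> \<bar>f c\<bar> \<le> B" shows "\<bar>gavg C h f\<bar> \<le> B"
proof -
  have "gavg C h f \<le> gavg C h (\<lambda>_. B)" using assms by (intro gavg_mono) (auto simp: abs_le_iff)
  moreover have "gavg C h (\<lambda>_. - B) \<le> gavg C h f"
    using assms by (intro gavg_mono) (auto simp: abs_le_iff minus_le_iff)
  ultimately show ?thesis by (simp add: abs_le_iff)
qed

lemma gavg_nonneg: "(\<And>c. c \<in> C \<Longrightarrow> 0 \<le> f c) \<Longrightarrow> 0 \<le> gavg C h f"
  unfolding gavg_def using gibbs_pos[THEN less_imp_le] by (intro sum_nonneg mult_nonneg_nonneg) auto

lemma DERIV_lse:
  "((\<lambda>t. lse C (\<lambda>c. h c + t * Y c)) has_real_derivative gavg C (\<lambda>c. h c + t * Y c) Y) (at t)"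
  unfolding lse_def gavg_alt using Z_pos[of "\<lambda>c. h c + t * Y c"]
  by (auto intro!: derivative_eq_intros simp: mult.commute)

lemma DERIV_gavg:
  "((\<lambda>t. gavg C (\<lambda>c. h c + t * Y c) f) has_real_derivative
     gavg C (\<lambda>c. h c + t * Y c) (\<lambda>c. f c * Y c)
     - gavg C (\<lambda>c. h c + t * Y c) f * gavg C (\<lambda>c. h c + t * Y c) Y) (at t)"
proof -
  let ?e = "\<lambda>c. exp (h c + t * Y c)"
  have Z: "sum ?e C \<noteq> 0" using Z_pos[of "\<lambda>c. h c + t * Y c"] by simp
  have "((\<lambda>t. (\<Sum>c\<in>C. f c * exp (h c + t * Y c)) / (\<Sum>c\<in>C. exp (h c + t * Y c))) has_real_derivative
     ((\<Sum>c\<in>C. f c * (?e c * Y c)) * sum ?e C - (\<Sum>c\<in>C. f c * ?e c) * (\<Sum>c\<in>C. ?e c * Y c))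
       / (sum ?e C * sum ?e C)) (at t)"
    using Z by (auto intro!: derivative_eq_intros simp: mult_ac)
  moreover have "((\<Sum>c\<in>C. f c * (?e c * Y c)) * sum ?e C - (\<Sum>c\<in>C. f c * ?e c) * (\<Sum>c\<in>C. ?e c * Y c))
       / (sum ?e C * sum ?e C)
     = gavg C (\<lambda>c. h c + t * Y c) (\<lambda>c. f c * Y c)
     - gavg C (\<lambda>c. h c + t * Y c) f * gavg C (\<lambda>c. h c + t * Y c) Y"
    unfolding gavg_alt using Z by (simp add: field_simps)
  ultimately show ?thesis unfolding gavg_alt by simp
qed

text \<open>The derivative of the average of \<open>f\<close> along \<open>h + t * Y\<close> is the
  Gibbs covariance of \<open>f\<close> and \<open>Y\<close>, at most \<open>2 * A * B\<close> in
  modulus; the mean value theorem does the rest.\<close>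

lemma gavg_tilt:
  assumes f: "\<And>c. c \<in> C \<Longrightarrow> \<bar>f c\<bar> \<le> A" and Y: "\<And>c. c \<in> C \<Longrightarrow> \<bar>Y c\<bar> \<le> B"
  shows "\<bar>gavg C (\<lambda>c. h c + Y c) f - gavg C h f\<bar> \<le> 2 * A * B"
proof -
  obtain c0 where "c0 \<in> C" using neC by auto
  then have A: "0 \<le> A" and B: "0 \<le> B" using f[of c0] Y[of c0] by auto
  have "\<exists>z. 0 < z \<and> z < 1 \<and> gavg C (\<lambda>c. h c + 1 * Y c) f - gavg C (\<lambda>c. h c + 0 * Y c) f
     = (1 - 0) * (gavg C (\<lambda>c. h c + z * Y c) (\<lambda>c. f c * Y c)
     - gavg C (\<lambda>c. h c + z * Y c) f * gavg C (\<lambda>c. h c + z * Y c) Y)"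
    by (rule MVT2) (auto intro: DERIV_gavg)
  then obtain z where z: "gavg C (\<lambda>c. h c + Y c) f - gavg C h f
     = gavg C (\<lambda>c. h c + z * Y c) (\<lambda>c. f c * Y c)
     - gavg C (\<lambda>c. h c + z * Y c) f * gavg C (\<lambda>c. h c + z * Y c) Y" by auto
  have "\<bar>gavg C (\<lambda>c. h c + z * Y c) (\<lambda>c. f c * Y c)\<bar> \<le> A * B"
    using f Y A by (intro gavg_abs_le) (auto simp: abs_mult intro!: mult_mono)
  moreover have "\<bar>gavg C (\<lambda>c. h c + z * Y c) f * gavg C (\<lambda>c. h c + z * Y c) Y\<bar> \<le> A * B"
    unfolding abs_mult using f Y A by (intro mult_mono gavg_abs_le) auto
  ultimately show ?thesis unfolding z by linarith
qed

text \<open>Jensen's inequality for \<open>exp\<close> under the Gibbs measure, proved from the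
  tangent line of \<open>exp\<close> at the average of \<open>Y\<close>.\<close>

lemma lse_convex: "gavg C h Y \<le> lse C (\<lambda>c. h c + Y c) - lse C h"
proof -
  have "exp (gavg C h Y) \<le> (\<Sum>c\<in>C. exp (h c + Y c)) / (\<Sum>c\<in>C. exp (h c))"
  proof -
    have "exp (gavg C h Y) = gavg C h (\<lambda>c. exp (gavg C h Y) * (1 + (Y c - gavg C h Y)))"
      by (simp only: gavg_cmult gavg_add gavg_diff gavg_const)  simp
    also have "\<dots> \<le> gavg C h (\<lambda>c. exp (gavg C h Y) * exp (Y c - gavg C h Y))"
      by (intro gavg_mono mult_left_mono exp_ge_add_one_self) auto
    also have "\<dots> = (\<Sum>c\<in>C. exp (h c + Y c)) / (\<Sum>c\<in>C. exp (h c))"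
      by (simp add: gavg_alt exp_add exp_diff mult.commute)
    finally show ?thesis .
  qed
  then have "gavg C h Y \<le> ln ((\<Sum>c\<in>C. exp (h c + Y c)) / (\<Sum>c\<in>C. exp (h c)))"
    using Z_pos by (subst ln_ge_iff) auto
  then show ?thesis using Z_pos[of h] Z_pos[of "\<lambda>c. h c + Y c"]
    by (simp add: lse_def ln_div)
qed

text \<open>An explicit quadratic remainder survives integration over the disorder, so expected free
  energies can later be differentiated without exchanging limit and integral.\<close>

lemma lse_first_order:
  assumes Y: "\<And>c. c \<in> C \<Longrightarrow> \<bar>Y c\<bar> \<le> B"
  shows "\<bar>lse C (\<lambda>c. h c + Y c) - lse C h - gavg C h Y\<bar> \<le> 2 * B\<^sup>2"
proof -
  have "\<exists>z. 0 < z \<and> z < 1 \<and> lse C (\<lambda>c. h c + 1 * Y c) - lse C (\<lambda>c. h c + 0 * Y c)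
     = (1 - 0) * gavg C (\<lambda>c. h c + z * Y c) Y"
    by (rule MVT2) (auto intro: DERIV_lse)
  then obtain z where z: "0 < z" "z < 1" "lse C (\<lambda>c. h c + Y c) - lse C h
     = gavg C (\<lambda>c. h c + z * Y c) Y" by auto
  have "\<bar>gavg C (\<lambda>c. h c + z * Y c) Y - gavg C h Y\<bar> \<le> 2 * B * B"
  proof (rule gavg_tilt[OF Y])
    fix c assume "c \<in> C"
    have "\<bar>z * Y c\<bar> \<le> 1 * \<bar>Y c\<bar>" unfolding abs_mult using z by (intro mult_right_mono) auto
    then show "\<bar>z * Y c\<bar> \<le> B" using Y[OF \<open>c \<in> C\<close>] by simp
  qed
  then show ?thesis using z by (simp add: power2_eq_square)
qed

definition gcov :: "('c \<Rightarrow> real) \<Rightarrow> ('c \<Rightarrow> real) \<Rightarrow> ('c \<Rightarrow> real) \<Rightarrow> real" where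
  "gcov h f g = gavg C h (\<lambda>c. f c * g c) - gavg C h f * gavg C h g"

lemma gcov_tilt:
  assumes f: "\<And>c. c \<in> C \<Longrightarrow> \<bar>f c\<bar> \<le> A" and g: "\<And>c. c \<in> C \<Longrightarrow> \<bar>g c\<bar> \<le> A'"
    and Y: "\<And>c. c \<in> C \<Longrightarrow> \<bar>Y c\<bar> \<le> B"
  shows "\<bar>gcov (\<lambda>c. h c + Y c) f g - gcov h f g\<bar> \<le> 6 * A * A' * B"
proof -
  obtain c0 where "c0 \<in> C" using neC by auto
  then have A: "0 \<le> A" "0 \<le> A'" and B: "0 \<le> B" using f[of c0] g[of c0] Y[of c0] by auto
  let ?h = "\<lambda>c. h c + Y c"
  have 1: "\<bar>gavg C ?h (\<lambda>c. f c * g c) - gavg C h (\<lambda>c. f c * g c)\<bar> \<le> 2 * (A * A') * B"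
    using f g A by (intro gavg_tilt Y) (auto simp: abs_mult intro!: mult_mono)
  have 2: "\<bar>(gavg C ?h f - gavg C h f) * gavg C ?h g\<bar> \<le> (2 * A * B) * A'"
    unfolding abs_mult using A B f g Y by (intro mult_mono gavg_tilt gavg_abs_le) auto
  have 3: "\<bar>gavg C h f * (gavg C ?h g - gavg C h g)\<bar> \<le> A * (2 * A' * B)"
    unfolding abs_mult using A B f g Y by (intro mult_mono gavg_tilt gavg_abs_le) auto
  have "gcov ?h f g - gcov h f g = (gavg C ?h (\<lambda>c. f c * g c) - gavg C h (\<lambda>c. f c * g c))
     - (gavg C ?h f - gavg C h f) * gavg C ?h g - gavg C h f * (gavg C ?h g - gavg C h g)"
    by (simp add: gcov_def algebra_simps)
  then show ?thesis using 1 2 3 by (simp add: mult_ac)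
qed

text \<open>The derivatives of the free energy along \<open>t * Y\<close> are the average and then
  the covariance; replacing the covariance at an intermediate point by the one at 0 costs
  \<open>6 * B ^ 3\<close>, halved by the Taylor coefficient.\<close>

lemma lse_second_order:
  assumes Y: "\<And>c. c \<in> C \<Longrightarrow> \<bar>Y c\<bar> \<le> B"
  shows "\<bar>lse C (\<lambda>c. h c + Y c) - lse C h - gavg C h Y - gcov h Y Y / 2\<bar> \<le> 3 * B ^ 3"
proof -
  let ?L = "\<lambda>t. lse C (\<lambda>c. h c + t * Y c)"
  let ?L1 = "\<lambda>t. gavg C (\<lambda>c. h c + t * Y c) Y"
  let ?L2 = "\<lambda>t. gcov (\<lambda>c. h c + t * Y c) Y Y"
  \<comment> \<open>The Taylor formula wants one sequence of derivatives; only the entries up to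
    order 2 matter.\<close>
  define df where "df = (\<lambda>m::nat. if m = 0 then ?L else if m = 1 then ?L1 else ?L2)"
  have "\<exists>t>0. t < 1 \<and> ?L 1 = (\<Sum>m<2. df m 0 / fact m * 1 ^ m) + df 2 t / fact 2 * 1 ^ 2"
  proof (rule Maclaurin)
    show "\<forall>m t. m < 2 \<and> 0 \<le> t \<and> t \<le> 1 \<longrightarrow> DERIV (df m) t :> df (Suc m) t"
    proof (intro allI impI)
      fix m :: nat and t :: real assume m: "m < 2 \<and> 0 \<le> t \<and> t \<le> 1"
      then consider "m = 0" | "m = 1" by linarith
      then show "DERIV (df m) t :> df (Suc m) t"
      proof cases
        case 1 then show ?thesis using DERIV_lse[of h Y t] by (simp add: df_def)
      next
        case 2 then show ?thesis using DERIV_gavg[of h Y Y t] by (simp add: df_def gcov_def)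
      qed
    qed
  qed (auto simp: df_def)
  then obtain t where t: "0 < t" "t < 1" "lse C (\<lambda>c. h c + Y c) = lse C h + gavg C h Y + ?L2 t / 2"
    by (auto simp: df_def numeral_2_eq_2)
  have "\<bar>?L2 t - gcov h Y Y\<bar> \<le> 6 * B * B * B"
  proof (rule gcov_tilt[OF Y Y])
    fix c assume "c \<in> C"
    have "\<bar>t * Y c\<bar> \<le> 1 * \<bar>Y c\<bar>" unfolding abs_mult using t by (intro mult_right_mono) auto
    then show "\<bar>t * Y c\<bar> \<le> B" using Y[OF \<open>c \<in> C\<close>] by simp
  qed
  then show ?thesis using t(3) by (simp add: power3_eq_cube)
qed

text \<open>The entropy of a distribution on \<open>C\<close> is at most \<open>ln (card C)\<close>.\<close>

lemma gavg_ge_Max: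
  assumes b: "b > 0" and c0: "c0 \<in> C"
  shows "gavg C (\<lambda>c. b * X c) X \<ge> X c0 - ln (card C) / b"
proof -
  let ?p = "gibbs C (\<lambda>c. b * X c)" and ?Z = "\<Sum>c\<in>C. exp (b * X c)"
  have n: "real (card C) > 0" using finC neC by (simp add: card_gt_0_iff)
  have "b * X c0 \<le> ln ?Z"
    using Z_pos[of "\<lambda>c. b * X c"] finC c0
    by (subst ln_ge_iff) (auto intro!: member_le_sum[of c0 C "\<lambda>c. exp (b * X c)"])
  \<comment> \<open>Summed over \<open>c\<close>, this is nonnegativity of the relative entropy with
    respect to the uniform measure, obtained from \<open>ln u \<le> u - 1\<close>.\<close>
  moreover have "?p c * (ln ?Z - b * X c - ln (card C)) \<le> 1 / card C - ?p c" for c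
  proof -
    have "?p c > 0" by (rule gibbs_pos)
    have "ln (1 / (?p c * card C)) \<le> 1 / (?p c * card C) - 1"
      using n \<open>?p c > 0\<close> by (intro ln_le_minus_one) simp
    moreover have "ln (1 / (?p c * card C)) = ln ?Z - b * X c - ln (card C)"
      using n Z_pos[of "\<lambda>c. b * X c"] by (simp add: gibbs_def ln_div ln_mult)
    ultimately have "?p c * (ln ?Z - b * X c - ln (card C)) \<le> ?p c * (1 / (?p c * card C) - 1)"
      using \<open>?p c > 0\<close> by (intro mult_left_mono) auto
    also have "\<dots> = 1 / card C - ?p c" using \<open>?p c > 0\<close> n by (simp add: field_simps)
    finally show ?thesis .
  qed
  then have "gavg C (\<lambda>c. b * X c) (\<lambda>c. ln ?Z - b * X c - ln (card C)) \<le> (\<Sum>c\<in>C. 1 / card C - ?p c)"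
    unfolding gavg_def by (intro sum_mono) auto
  moreover have "(\<Sum>c\<in>C. 1 / card C - ?p c) = 0"
    using n by (simp add: sum_subtractf gibbs_sum)
  ultimately have "b * X c0 - ln (card C) \<le> b * gavg C (\<lambda>c. b * X c) X"
    by (simp add: gavg_diff gavg_cmult)
  then show ?thesis using b by (simp add: field_simps)
qed

end

subsection \<open>The standard Gaussian product measure\<close>

definition stdn :: "real measure" where
  "stdn = density lborel (\<lambda>x. ennreal (std_normal_density x))"

definition gauss :: "'i set \<Rightarrow> ('i \<Rightarrow> real) measure" where
  "gauss I = PiM I (\<lambda>_. stdn)"

definition gauss2 :: "'i set \<Rightarrow> (('i \<Rightarrow> real) \<times> ('i \<Rightarrow> real)) measure" where
  "gauss2 I = gauss I \<Otimes>\<^sub>M gauss I"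

text \<open>The field \<open>x\<close> with its couplings outside \<open>S\<close> replaced by fresh
  ones from \<open>y\<close>.\<close>

definition mix :: "'i set \<Rightarrow> ('i \<Rightarrow> real) \<Rightarrow> ('i \<Rightarrow> real) \<Rightarrow> 'i \<Rightarrow> real" where
  "mix S x y = (\<lambda>i. if i \<in> S then x i else y i)"

lemma sets_stdn [simp]: "sets stdn = sets borel"
  by (simp add: stdn_def)

lemma space_stdn [simp]: "space stdn = UNIV"
  by (simp add: stdn_def)

lemma prob_space_stdn: "prob_space stdn"
  unfolding stdn_def by (rule prob_space_normal_density) simp

interpretation stdn: prob_space stdn by (rule prob_space_stdn)

lemma integrable_stdn_iff:
  fixes f :: "real \<Rightarrow> real"
  assumes "f \<in> borel_measurable borel"
  shows "integrable stdn f \<longleftrightarrow> integrable lborel (\<lambda>x. std_normal_density x * f x)"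
  unfolding stdn_def using assms by (subst integrable_density) auto

lemma integral_stdn:
  fixes f :: "real \<Rightarrow> real"
  assumes "f \<in> borel_measurable borel"
  shows "integral\<^sup>L stdn f = integral\<^sup>L lborel (\<lambda>x. std_normal_density x * f x)"
  unfolding stdn_def using assms by (subst integral_density) auto

lemma integrable_stdn_power: "integrable stdn (\<lambda>x. x ^ k)"
  by (subst integrable_stdn_iff) (auto intro: integrable_std_normal_moment)

lemma integrable_stdn_abs_power: "integrable stdn (\<lambda>x. \<bar>x\<bar> ^ k)"
  by (subst integrable_stdn_iff) (auto intro: integrable_std_normal_moment_abs)

lemma integrable_stdn_id: "integrable stdn (\<lambda>x. x)"
  using integrable_stdn_power[of 1] by simp

lemma integrable_stdn_abs: "integrable stdn (\<lambda>x. \<bar>x\<bar>)"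
  using integrable_stdn_abs_power[of 1] by simp

lemma integral_stdn_id: "(\<integral>x. x \<partial>stdn) = 0"
  using integral_std_normal_moment_odd[of 0] by (simp add: integral_stdn)

lemma integral_stdn_sq: "(\<integral>x. x\<^sup>2 \<partial>stdn) = 1"
  using integral_std_normal_moment_even[of 1] by (simp add: integral_stdn fact_numeral)

lemma sqrt_two_over_pi_le_1: "sqrt (2 / pi) \<le> 1"
  using pi_gt3 by (intro real_le_lsqrt) (auto simp: field_simps)

lemma integral_stdn_abs: "(\<integral>x. \<bar>x\<bar> \<partial>stdn) \<le> 1"
  using integral_std_normal_moment_abs_odd[of 0] sqrt_two_over_pi_le_1
  by (simp add: integral_stdn)

lemma integral_stdn_abs3: "(\<integral>x. \<bar>x\<bar> ^ 3 \<partial>stdn) \<le> 2"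
  using integral_std_normal_moment_abs_odd[of 1] sqrt_two_over_pi_le_1
  by (simp add: integral_stdn numeral_3_eq_3)

lemma std_normal_density_exp:
  "std_normal_density x * exp (t * x) = exp (t\<^sup>2 / 2) * normal_density t 1 x"
proof -
  have "- (x\<^sup>2) / 2 + t * x = t\<^sup>2 / 2 + - ((x - t)\<^sup>2) / 2"
    by (simp add: power2_eq_square field_simps)
  then show ?thesis
    by (simp add: normal_density_def mult_exp_exp)
qed

lemma integrable_stdn_exp: "integrable stdn (\<lambda>x. exp (t * x))"
  by (subst integrable_stdn_iff) (auto simp: std_normal_density_exp)

lemma integral_stdn_exp: "(\<integral>x. exp (t * x) \<partial>stdn) = exp (t\<^sup>2 / 2)"
  by (subst integral_stdn) (auto simp: std_normal_density_exp integral_normal_density)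

text \<open>The factor turns variance 1 into variance 2. The rate 1/4 is the one that occurs when
  the square of an overlap is linearized at the largest admissible coupling.\<close>

lemma std_normal_density_exp_sq:
  "std_normal_density x * exp (x\<^sup>2 / 4) = sqrt 2 * normal_density 0 (sqrt 2) x"
proof -
  have "- (x\<^sup>2) / 2 + x\<^sup>2 / 4 = - (x\<^sup>2) / 4" by simp
  then show ?thesis
    by (simp add: normal_density_def mult_exp_exp real_sqrt_mult) (simp add: divide_simps)
qed

lemma integrable_stdn_exp_sq: "integrable stdn (\<lambda>x. exp (x\<^sup>2 / 4))"
  by (subst integrable_stdn_iff) (auto simp: std_normal_density_exp_sq)

lemma integral_stdn_exp_sq: "(\<integral>x. exp (x\<^sup>2 / 4) \<partial>stdn) = sqrt 2"
  by (subst integral_stdn) (auto simp: std_normal_density_exp_sq integral_normal_density)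

lemma distr_stdn_uminus: "distr stdn stdn uminus = stdn"
proof -
  have "distr stdn stdn uminus = distr (density lborel (\<lambda>x. ennreal (std_normal_density (- x)))) lborel uminus"
    unfolding stdn_def by (intro distr_cong) (auto simp: normal_density_def)
  also have "\<dots> = density (distr lborel lborel uminus) (\<lambda>x. ennreal (std_normal_density x))"
    using density_distr[of "\<lambda>x. ennreal (std_normal_density x)" lborel uminus lborel]
    by (simp add: comp_def)
  also have "distr lborel lborel (uminus :: real \<Rightarrow> real) = lborel"
    using lborel_distr_uminus by (simp add: distr_cong[OF refl, of lborel borel])
  finally show ?thesis by (simp add: stdn_def)
qed

lemma prob_space_gauss: "prob_space (gauss I)"
  unfolding gauss_def by (intro prob_space_PiM prob_space_stdn)

lemma prob_space_gauss2: "prob_space (gauss2 I)"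
proof -
  interpret g: prob_space "gauss I" by (rule prob_space_gauss)
  interpret pair_prob_space "gauss I" "gauss I" ..
  show ?thesis unfolding gauss2_def by (rule prob_space_axioms)
qed

lemma product_sigma_finite_stdn: "product_sigma_finite (\<lambda>_. stdn)"
  by unfold_locales

lemma space_gauss: "space (gauss I) = (I \<rightarrow>\<^sub>E UNIV)"
  by (simp add: gauss_def space_PiM)

lemma measurable_gauss_component: "i \<in> I \<Longrightarrow> (\<lambda>x. x i) \<in> borel_measurable (gauss I)"
  unfolding gauss_def
  using measurable_component_singleton[of i I "\<lambda>_. stdn"] by (simp cong: measurable_cong_sets)

lemma measurable_gaussI:
  assumes "\<And>i. i \<in> I \<Longrightarrow> (\<lambda>w. f w i) \<in> borel_measurable M" "\<And>w i. w \<in> space M \<Longrightarrow> i \<notin> I \<Longrightarrow> f w i = undefined"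
  shows "f \<in> measurable M (gauss I)"
  unfolding gauss_def using assms
  by (intro measurable_PiM_single') (auto simp: PiE_def extensional_def cong: measurable_cong_sets)

lemma measurable_mix: "(\<lambda>z. mix S (fst z) (snd z)) \<in> measurable (gauss2 I) (gauss I)"
proof (rule measurable_gaussI)
  fix i assume "i \<in> I"
  then have m: "(\<lambda>x. x i) \<in> borel_measurable (gauss I)" by (rule measurable_gauss_component)
  show "(\<lambda>z. mix S (fst z) (snd z) i) \<in> borel_measurable (gauss2 I)"
  proof (cases "i \<in> S")
    case True
    then have "(\<lambda>z. mix S (fst z) (snd z) i) = (\<lambda>z. fst z i)" by (simp add: mix_def)
    then show ?thesis
      unfolding gauss2_def by (simp only:) (rule measurable_compose[OF measurable_fst m])
  next
    case False
    then have "(\<lambda>z. mix S (fst z) (snd z) i) = (\<lambda>z. snd z i)" by (simp add: mix_def)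
    then show ?thesis
      unfolding gauss2_def by (simp only:) (rule measurable_compose[OF measurable_snd m])
  qed
qed (auto simp: mix_def gauss2_def space_pair_measure space_gauss PiE_def extensional_def)

lemma measurable_fst_gauss2: "fst \<in> measurable (gauss2 I) (gauss I)"
  and measurable_snd_gauss2: "snd \<in> measurable (gauss2 I) (gauss I)"
  by (simp_all add: gauss2_def)

lemma distr_gauss_component: "i \<in> I \<Longrightarrow> distr (gauss I) stdn (\<lambda>x. x i) = stdn"
  unfolding gauss_def by (rule distr_PiM_component) (auto simp: prob_space_stdn)

lemma borel_measurable_stdn: "borel_measurable stdn = borel_measurable borel"
  by (rule measurable_cong_sets) simp_all

lemma measurable_gauss_stdn: "i \<in> I \<Longrightarrow> (\<lambda>x. x i) \<in> measurable (gauss I) stdn"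
  unfolding gauss_def by (rule measurable_component_singleton)

lemma integrable_gauss_component:
  fixes p :: "real \<Rightarrow> real"
  assumes "i \<in> I" "integrable stdn p"
  shows "integrable (gauss I) (\<lambda>x. p (x i))"
  using assms(2) by (intro integrable_distr[OF measurable_gauss_stdn[OF assms(1)]])
    (simp only: distr_gauss_component[OF assms(1)])

lemma integral_gauss_component:
  fixes p :: "real \<Rightarrow> real"
  assumes "i \<in> I" "p \<in> borel_measurable borel"
  shows "(\<integral>x. p (x i) \<partial>gauss I) = (\<integral>u. p u \<partial>stdn)"
  using assms integral_distr[OF measurable_gauss_stdn[OF assms(1)], of p]
  by (simp only: distr_gauss_component borel_measurable_stdn)

text \<open>Fubini with coordinate \<open>a\<close> split off. Independence of \<open>h\<close> from
  that coordinate is expressed by invariance under updates, which can be checked syntactically. Used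
  to kill terms that are odd in one coupling.\<close>

lemma gauss_isolate:
  fixes p :: "real \<Rightarrow> real" and h :: "('i \<Rightarrow> real) \<Rightarrow> real"
  assumes I: "finite I" "a \<in> I" and p: "integrable stdn p" and h: "integrable (gauss I) h"
    and inv: "\<And>x t. x \<in> space (gauss I) \<Longrightarrow> h (x(a := t)) = h x"
  shows "integrable (gauss I) (\<lambda>x. p (x a) * h x)"
    and "(\<integral>x. p (x a) * h x \<partial>gauss I) = (\<integral>u. p u \<partial>stdn) * (\<integral>x. h x \<partial>gauss I)"
proof -
  interpret P: product_sigma_finite "\<lambda>_::'i. stdn" by (rule product_sigma_finite_stdn)
  have UNIV1: "measure stdn UNIV = 1" and UNIV1': "emeasure stdn UNIV = 1"
    using stdn.prob_space stdn.emeasure_space_1 by simp_all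
  let ?J = "I - {a}"
  have IJ: "insert a ?J = I" and J: "finite ?J" "a \<notin> ?J" using I by auto
  have pm: "p \<in> borel_measurable borel"
    using borel_measurable_integrable[OF p] by (simp only: borel_measurable_stdn)
  have pm': "p \<in> borel_measurable stdn" using p by (rule borel_measurable_integrable)
  have hm [measurable]: "h \<in> borel_measurable (gauss I)" using h by (rule borel_measurable_integrable)
  have pam [measurable]: "(\<lambda>x. p (x a)) \<in> borel_measurable (gauss I)"
    by (rule measurable_compose[OF measurable_gauss_component[OF I(2)] pm])
  \<comment> \<open>Freezing the coordinate at 0 turns \<open>h\<close> into a function on the field
    without \<open>a\<close>.\<close>
  define h0 where "h0 = (\<lambda>x. h (x(a := 0)))"
  have upd: "h (x(a := t)) = h0 x" if "x \<in> space (gauss ?J)" for x t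
  proof -
    have "x(a := 0) \<in> space (gauss I)"
      using that I by (auto simp: space_gauss PiE_def extensional_def)
    from inv[OF this, of t] show ?thesis by (simp add: h0_def)
  qed
  have h0m: "h0 \<in> borel_measurable (gauss ?J)"
    unfolding h0_def
  proof (rule measurable_compose[OF _ hm])
    show "(\<lambda>x. x(a := 0)) \<in> measurable (gauss ?J) (gauss I)"
    proof (rule measurable_gaussI)
      fix i assume "i \<in> I"
      then show "(\<lambda>w. (w(a := 0)) i) \<in> borel_measurable (gauss ?J)"
        by (cases "i = a") (auto intro: measurable_gauss_component)
    qed (use I in \<open>auto simp: space_gauss PiE_def extensional_def\<close>)
  qed
  have nn_ins: "(\<integral>\<^sup>+x. f x \<partial>gauss I) = (\<integral>\<^sup>+x. (\<integral>\<^sup>+t. f (x(a := t)) \<partial>stdn) \<partial>gauss ?J)"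
    if "f \<in> borel_measurable (gauss I)" for f
    using P.product_nn_integral_insert[OF J, unfolded IJ, OF that[unfolded gauss_def]]
    unfolding gauss_def .
  have int_ins: "(\<integral>x. f x \<partial>gauss I) = (\<integral>x. (\<integral>t. f (x(a := t)) \<partial>stdn) \<partial>gauss ?J)"
    if "integrable (gauss I) f" for f :: "('i \<Rightarrow> real) \<Rightarrow> real"
    using P.product_integral_insert[OF J, unfolded IJ, OF that[unfolded gauss_def]]
    unfolding gauss_def .
  have "(\<integral>\<^sup>+x. ennreal (norm (p (x a) * h x)) \<partial>gauss I)
     = (\<integral>\<^sup>+x. (\<integral>\<^sup>+t. ennreal (norm (p ((x(a := t)) a) * h (x(a := t)))) \<partial>stdn) \<partial>gauss ?J)"
    by (intro nn_ins[of "\<lambda>x. ennreal (norm (p (x a) * h x))"]) measurable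
  also have "\<dots> = (\<integral>\<^sup>+x. ennreal (norm (h0 x)) * (\<integral>\<^sup>+t. ennreal (norm (p t)) \<partial>stdn) \<partial>gauss ?J)"
    using pm' by (intro nn_integral_cong)
       (simp add: upd abs_mult ennreal_mult mult.commute nn_integral_cmult)
  also have "\<dots> = (\<integral>\<^sup>+x. ennreal (norm (h0 x)) \<partial>gauss ?J) * (\<integral>\<^sup>+t. ennreal (norm (p t)) \<partial>stdn)"
    using h0m by (intro nn_integral_multc) measurable
  also have "(\<integral>\<^sup>+x. ennreal (norm (h0 x)) \<partial>gauss ?J)
     = (\<integral>\<^sup>+x. (\<integral>\<^sup>+t. ennreal (norm (h (x(a := t)))) \<partial>stdn) \<partial>gauss ?J)"
    by (intro nn_integral_cong) (simp add: upd UNIV1')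
  also have "\<dots> = (\<integral>\<^sup>+x. ennreal (norm (h x)) \<partial>gauss I)"
    by (intro nn_ins[of "\<lambda>x. ennreal (norm (h x))", symmetric]) measurable
  also have "\<dots> * (\<integral>\<^sup>+t. ennreal (norm (p t)) \<partial>stdn) < \<infinity>"
    using h p by (simp add: integrable_iff_bounded ennreal_mult_less_top)
  finally show int: "integrable (gauss I) (\<lambda>x. p (x a) * h x)"
    unfolding integrable_iff_bounded by (intro conjI) measurable
  have "(\<integral>x. p (x a) * h x \<partial>gauss I) = (\<integral>x. (\<integral>t. p ((x(a := t)) a) * h (x(a := t)) \<partial>stdn) \<partial>gauss ?J)"
    by (rule int_ins[OF int])
  also have "\<dots> = (\<integral>x. (\<integral>u. p u \<partial>stdn) * h0 x \<partial>gauss ?J)"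
    by (intro Bochner_Integration.integral_cong refl) (simp add: upd)
  also have "\<dots> = (\<integral>u. p u \<partial>stdn) * (\<integral>x. (\<integral>t. h (x(a := t)) \<partial>stdn) \<partial>gauss ?J)"
    unfolding integral_mult_right_zero
    by (intro arg_cong2[of _ _ _ _ "(*)"] Bochner_Integration.integral_cong refl) (simp add: upd UNIV1)
  also have "(\<integral>x. (\<integral>t. h (x(a := t)) \<partial>stdn) \<partial>gauss ?J) = (\<integral>x. h x \<partial>gauss I)"
    by (rule int_ins[of h, OF h, symmetric])
  finally show "(\<integral>x. p (x a) * h x \<partial>gauss I) = (\<integral>u. p u \<partial>stdn) * (\<integral>x. h x \<partial>gauss I)" .
qed

lemma integrable_bounded_prob:
  fixes f :: "'w \<Rightarrow> real"
  assumes "prob_space M" "f \<in> borel_measurable M" "\<And>x. x \<in> space M \<Longrightarrow> \<bar>f x\<bar> \<le> B"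
  shows "integrable M f"
proof -
  interpret prob_space M by fact
  have "AE x in M. norm (f x) \<le> B" using assms(3) by (intro AE_I2) simp
  then show ?thesis using assms(2) by (rule integrable_const_bound)
qed

text \<open>The pair is one field indexed by \<open>I \<times> bool\<close>, on which the swap is a reindexing.\<close>

lemma distr_gauss2_mix_swap:
  fixes I :: "'i set"
  assumes I: "finite I"
  shows "distr (gauss2 I) (gauss2 I) (\<lambda>z. (mix S (fst z) (snd z), mix S (snd z) (fst z))) = gauss2 I"
proof -
  interpret P: product_sigma_finite "\<lambda>_::'i. stdn" by (rule product_sigma_finite_stdn)
  interpret g: prob_space "gauss I" by (rule prob_space_gauss)
  let ?K = "I \<times> (UNIV :: bool set)"
  let ?Q = "gauss ?K"
  let ?u = "\<lambda>z. \<lambda>k\<in>?K. if snd k then fst z (fst k) else snd z (fst k)"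
  let ?m = "\<lambda>w. (\<lambda>i\<in>I. w (i, True), \<lambda>i\<in>I. w (i, False))"
  let ?f = "\<lambda>k. if fst k \<in> S then k else (fst k, \<not> snd k)"
  let ?re = "\<lambda>w. \<lambda>k\<in>?K. w (?f k)"
  have u_meas: "?u \<in> measurable (gauss2 I) ?Q"
  proof (rule measurable_gaussI)
    fix k assume k: "k \<in> ?K"
    then have "fst k \<in> I" by (rule SigmaE) simp
    then have m: "(\<lambda>x. x (fst k)) \<in> borel_measurable (gauss I)" by (rule measurable_gauss_component)
    show "(\<lambda>z. ?u z k) \<in> borel_measurable (gauss2 I)"
    proof (cases "snd k")
      case True
      then have eq: "(\<lambda>z. ?u z k) = (\<lambda>z. fst z (fst k))" using k by (simp add: fun_eq_iff)
      show ?thesis unfolding eq by (rule measurable_compose[OF measurable_fst_gauss2 m])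
    next
      case False
      then have eq: "(\<lambda>z. ?u z k) = (\<lambda>z. snd z (fst k))" using k by (simp add: fun_eq_iff)
      show ?thesis unfolding eq by (rule measurable_compose[OF measurable_snd_gauss2 m])
    qed
  qed (simp add: restrict_def)
  have m_meas: "?m \<in> measurable ?Q (gauss2 I)"
  proof -
    have "(\<lambda>w. \<lambda>i\<in>I. w (i, b)) \<in> measurable ?Q (gauss I)" for b
    proof (rule measurable_gaussI)
      fix i assume "i \<in> I"
      then show "(\<lambda>w. (\<lambda>i\<in>I. w (i, b)) i) \<in> borel_measurable ?Q"
        using measurable_gauss_component[of "(i, b)" ?K] by simp
    qed simp
    then show ?thesis unfolding gauss2_def by (intro measurable_Pair)
  qed
  have re_meas: "?re \<in> measurable ?Q ?Q"
  proof (rule measurable_gaussI)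
    fix k assume k: "k \<in> ?K"
    then have "?f k \<in> ?K" by (auto split: if_splits)
    from measurable_gauss_component[OF this] k show "(\<lambda>w. ?re w k) \<in> borel_measurable ?Q"
      by (simp only: restrict_apply if_True)
  qed (simp add: restrict_def)
  have Qu: "distr (gauss2 I) ?Q ?u = ?Q"
    unfolding gauss_def[of ?K]
  proof (rule product_sigma_finite.PiM_eqI[OF product_sigma_finite_stdn])
    show "finite ?K" using I by simp
    show "sets (distr (gauss2 I) (PiM ?K (\<lambda>_. stdn)) ?u) = sets (PiM ?K (\<lambda>_. stdn))" by simp
  next
    fix A assume A: "\<And>k. k \<in> ?K \<Longrightarrow> A k \<in> sets stdn"
    have box: "?u -` (Pi\<^sub>E ?K A) \<inter> space (gauss2 I)
        = (\<Pi>\<^sub>E i\<in>I. A (i, True)) \<times> (\<Pi>\<^sub>E i\<in>I. A (i, False))"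
      by (auto simp: gauss2_def space_pair_measure space_gauss PiE_def Pi_def extensional_def all_bool_eq)
    have mA: "(\<Pi>\<^sub>E i\<in>I. A (i, b)) \<in> sets (gauss I)" for b
      unfolding gauss_def using A I by (intro sets_PiM_I_finite) auto
    have eA: "emeasure (gauss I) (\<Pi>\<^sub>E i\<in>I. A (i, b)) = (\<Prod>i\<in>I. emeasure stdn (A (i, b)))" for b
      unfolding gauss_def using A I by (intro P.emeasure_PiM) auto
    have "emeasure (distr (gauss2 I) ?Q ?u) (Pi\<^sub>E ?K A)
       = emeasure (gauss2 I) ((\<Pi>\<^sub>E i\<in>I. A (i, True)) \<times> (\<Pi>\<^sub>E i\<in>I. A (i, False)))"
      unfolding box[symmetric] using A I
      by (intro emeasure_distr u_meas) (auto simp: gauss_def intro!: sets_PiM_I_finite)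
    also have "\<dots> = (\<Prod>i\<in>I. emeasure stdn (A (i, True))) * (\<Prod>i\<in>I. emeasure stdn (A (i, False)))"
      unfolding gauss2_def using mA by (subst g.emeasure_pair_measure_Times) (auto simp: eA)
    also have "\<dots> = (\<Prod>k\<in>?K. emeasure stdn (A k))"
    proof -
      have "(\<Prod>k\<in>?K. emeasure stdn (A k)) = (\<Prod>i\<in>I. \<Prod>b\<in>UNIV. emeasure stdn (A (i, b)))"
        by (simp add: prod.cartesian_product)
      also have "\<dots> = (\<Prod>i\<in>I. emeasure stdn (A (i, True)) * emeasure stdn (A (i, False)))"
        by (simp add: UNIV_bool mult.commute)
      finally show ?thesis by (simp add: prod.distrib)
    qed
    finally show "emeasure (distr (gauss2 I) (PiM ?K (\<lambda>_. stdn)) ?u) (Pi\<^sub>E ?K A) = (\<Prod>k\<in>?K. emeasure stdn (A k))"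
      by (simp add: gauss_def)
  qed
  have Qre: "distr ?Q ?Q ?re = ?Q"
    unfolding gauss_def
    by (rule distr_PiM_reindex[of ?K "\<lambda>_. stdn" ?f ?K])
       (auto simp: prob_space_stdn inj_on_def split: if_splits)
  have Qm: "distr ?Q (gauss2 I) ?m = gauss2 I"
  proof -
    have "distr ?Q (gauss2 I) ?m = distr (gauss2 I) (gauss2 I) (?m \<circ> ?u)"
      by (subst Qu[symmetric], subst distr_distr[OF m_meas u_meas]) (simp add: comp_def)
    also have "\<dots> = distr (gauss2 I) (gauss2 I) (\<lambda>z. z)"
      by (intro distr_cong refl)
         (auto simp: gauss2_def space_pair_measure space_gauss PiE_def extensional_def fun_eq_iff)
    finally show ?thesis by simp
  qed
  have "distr (gauss2 I) (gauss2 I) (\<lambda>z. (mix S (fst z) (snd z), mix S (snd z) (fst z)))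
     = distr (gauss2 I) (gauss2 I) (?m \<circ> (?re \<circ> ?u))"
    by (intro distr_cong refl)
       (auto simp: gauss2_def space_pair_measure space_gauss PiE_def extensional_def fun_eq_iff mix_def)
  also have "\<dots> = distr (distr (distr (gauss2 I) ?Q ?u) ?Q ?re) (gauss2 I) ?m"
    unfolding distr_distr[OF re_meas u_meas]
    by (rule distr_distr[OF m_meas measurable_comp[OF u_meas re_meas], symmetric])
  also have "\<dots> = gauss2 I"
    unfolding Qu Qre Qm ..
  finally show ?thesis .
qed

lemma pair_prob_space_gauss: "pair_prob_space (gauss I) (gauss I)"
proof -
  interpret g: prob_space "gauss I" by (rule prob_space_gauss)
  show ?thesis ..
qed

lemma integrable_gauss2_bounded:
  fixes f :: "_ \<Rightarrow> real"
  assumes "f \<in> borel_measurable (gauss2 I)" "\<And>z. \<bar>f z\<bar> \<le> B"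
  shows "integrable (gauss2 I) f"
  using integrable_bounded_prob[OF prob_space_gauss2] assms by blast

lemma integrable_gauss_bounded:
  fixes f :: "_ \<Rightarrow> real"
  assumes "f \<in> borel_measurable (gauss I)" "\<And>z. \<bar>f z\<bar> \<le> B"
  shows "integrable (gauss I) f"
  using integrable_bounded_prob[OF prob_space_gauss] assms by blast

lemma integral_gauss2:
  fixes f :: "_ \<Rightarrow> real"
  assumes "integrable (gauss2 I) f"
  shows "(\<integral>z. f z \<partial>gauss2 I) = (\<integral>x. (\<integral>y. f (x, y) \<partial>gauss I) \<partial>gauss I)"
    and "(\<integral>z. f z \<partial>gauss2 I) = (\<integral>y. (\<integral>x. f (x, y) \<partial>gauss I) \<partial>gauss I)"
proof -
  interpret pair_prob_space "gauss I" "gauss I" by (rule pair_prob_space_gauss)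
  show "(\<integral>z. f z \<partial>gauss2 I) = (\<integral>x. (\<integral>y. f (x, y) \<partial>gauss I) \<partial>gauss I)"
    using integral_fst'[of f] assms by (simp only: gauss2_def)
  show "(\<integral>z. f z \<partial>gauss2 I) = (\<integral>y. (\<integral>x. f (x, y) \<partial>gauss I) \<partial>gauss I)"
    using integral_snd[of "\<lambda>x y. f (x, y)"] assms by (simp add: gauss2_def)
qed

lemma gauss2_prod:
  fixes P Q :: "('i \<Rightarrow> real) \<Rightarrow> real"
  assumes P: "integrable (gauss I) P" and Q: "integrable (gauss I) Q"
  shows "integrable (gauss2 I) (\<lambda>z. P (fst z) * Q (snd z))"
    and "(\<integral>z. P (fst z) * Q (snd z) \<partial>gauss2 I) = (\<integral>x. P x \<partial>gauss I) * (\<integral>x. Q x \<partial>gauss I)"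
proof -
  interpret pair_prob_space "gauss I" "gauss I" by (rule pair_prob_space_gauss)
  have [measurable]: "P \<in> borel_measurable (gauss I)" "Q \<in> borel_measurable (gauss I)"
    using P Q by (auto intro: borel_measurable_integrable)
  show int: "integrable (gauss2 I) (\<lambda>z. P (fst z) * Q (snd z))"
    unfolding gauss2_def
  proof (rule Fubini_integrable)
    show "(\<lambda>z. P (fst z) * Q (snd z)) \<in> borel_measurable (gauss I \<Otimes>\<^sub>M gauss I)" by measurable
    show "integrable (gauss I) (\<lambda>x. \<integral>y. norm (P (fst (x, y)) * Q (snd (x, y))) \<partial>gauss I)"
      using P by (simp add: abs_mult)
    show "AE x in gauss I. integrable (gauss I) (\<lambda>y. P (fst (x, y)) * Q (snd (x, y)))"
      using Q by (intro AE_I2) simp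
  qed
  show "(\<integral>z. P (fst z) * Q (snd z) \<partial>gauss2 I) = (\<integral>x. P x \<partial>gauss I) * (\<integral>x. Q x \<partial>gauss I)"
    by (simp add: integral_gauss2(1)[OF int])
qed

lemma mix_pair_measurable:
  "(\<lambda>z. (mix S (fst z) (snd z), mix S (snd z) (fst z))) \<in> measurable (gauss2 I) (gauss2 I)"
proof -
  have swap: "(\<lambda>z. (snd z, fst z)) \<in> measurable (gauss2 I) (gauss2 I)"
    unfolding gauss2_def by measurable
  have "(\<lambda>z. mix S (snd z) (fst z)) \<in> measurable (gauss2 I) (gauss I)"
    using measurable_compose[OF swap measurable_mix[of S]] by simp
  with measurable_mix[of S I] show ?thesis unfolding gauss2_def by (rule measurable_Pair)
qed

lemma integral_gauss2_mix_swap: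
  fixes f :: "_ \<Rightarrow> real"
  assumes "finite I" "f \<in> borel_measurable (gauss2 I)"
  shows "(\<integral>z. f (mix S (fst z) (snd z), mix S (snd z) (fst z)) \<partial>gauss2 I) = (\<integral>z. f z \<partial>gauss2 I)"
  using integral_distr[OF mix_pair_measurable[of S I] assms(2)]
  by (simp only: distr_gauss2_mix_swap[OF assms(1)])

lemma gauss2_fst:
  fixes g :: "_ \<Rightarrow> real"
  assumes "integrable (gauss I) g"
  shows "integrable (gauss2 I) (\<lambda>z. g (fst z))"
    and "(\<integral>z. g (fst z) \<partial>gauss2 I) = (\<integral>x. g x \<partial>gauss I)"
proof -
  interpret g: prob_space "gauss I" by (rule prob_space_gauss)
  have 1: "integrable (gauss I) (\<lambda>_. 1 :: real)" by simp
  show "integrable (gauss2 I) (\<lambda>z. g (fst z))" "(\<integral>z. g (fst z) \<partial>gauss2 I) = (\<integral>x. g x \<partial>gauss I)"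
    using gauss2_prod[OF assms 1] by (simp_all add: g.prob_space)
qed

text \<open>The mixed field is the first component of a measure-preserving swap of the two copies,
  so it has the law of a single field.\<close>

lemma gauss2_mix:
  fixes g :: "_ \<Rightarrow> real"
  assumes "finite I" "integrable (gauss I) g"
  shows "integrable (gauss2 I) (\<lambda>z. g (mix S (fst z) (snd z)))"
    and "(\<integral>z. g (mix S (fst z) (snd z)) \<partial>gauss2 I) = (\<integral>x. g x \<partial>gauss I)"
proof -
  have m: "(\<lambda>z. g (fst z)) \<in> borel_measurable (gauss2 I)"
    using gauss2_fst(1)[OF assms(2)] by (rule borel_measurable_integrable)
  have "integrable (distr (gauss2 I) (gauss2 I) (\<lambda>z. (mix S (fst z) (snd z), mix S (snd z) (fst z)))) (\<lambda>z. g (fst z))"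
    using gauss2_fst(1)[OF assms(2)] by (simp only: distr_gauss2_mix_swap[OF assms(1)])
  from integrable_distr[OF mix_pair_measurable this]
  show "integrable (gauss2 I) (\<lambda>z. g (mix S (fst z) (snd z)))" by simp
  show "(\<integral>z. g (mix S (fst z) (snd z)) \<partial>gauss2 I) = (\<integral>x. g x \<partial>gauss I)"
    using integral_gauss2_mix_swap[OF assms(1) m] by (simp add: gauss2_fst(2)[OF assms(2)])
qed

text \<open>Splitting off both copies of one coupling, first in \<open>x\<close> for fixed
  \<open>y\<close>, then in \<open>y\<close> for the partial integral \<open>H\<close>.\<close>

lemma gauss2_isolate:
  fixes p q :: "real \<Rightarrow> real" and h :: "_ \<Rightarrow> real"
  assumes I: "finite I" "a \<in> I" and p: "integrable stdn p" and q: "integrable stdn q"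
    and hm: "h \<in> borel_measurable (gauss2 I)" and hB: "\<And>z. \<bar>h z\<bar> \<le> B"
    and inv: "\<And>x y s t. h (x(a := s), y(a := t)) = h (x, y)"
  shows "integrable (gauss2 I) (\<lambda>z. p (fst z a) * q (snd z a) * h z)"
    and "(\<integral>z. p (fst z a) * q (snd z a) * h z \<partial>gauss2 I)
      = (\<integral>u. p u \<partial>stdn) * (\<integral>u. q u \<partial>stdn) * (\<integral>z. h z \<partial>gauss2 I)"
proof -
  interpret pair_prob_space "gauss I" "gauss I" by (rule pair_prob_space_gauss)
  note pa = integrable_gauss_component[OF I(2) p] and qa = integrable_gauss_component[OF I(2) q]
  have pq: "integrable (gauss2 I) (\<lambda>z. p (fst z a) * q (snd z a))"
    by (rule gauss2_prod(1)[OF pa qa])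
  show int: "integrable (gauss2 I) (\<lambda>z. p (fst z a) * q (snd z a) * h z)"
  proof (rule Bochner_Integration.integrable_bound)
    show "integrable (gauss2 I) (\<lambda>z. B * (p (fst z a) * q (snd z a)))"
      using pq by (rule integrable_mult_right)
    show "(\<lambda>z. p (fst z a) * q (snd z a) * h z) \<in> borel_measurable (gauss2 I)"
      using borel_measurable_integrable[OF pq] hm by (rule borel_measurable_times)
    show "AE z in gauss2 I. norm (p (fst z a) * q (snd z a) * h z) \<le> norm (B * (p (fst z a) * q (snd z a)))"
    proof (rule AE_I2)
      fix z
      have "\<bar>h z\<bar> * \<bar>p (fst z a) * q (snd z a)\<bar> \<le> \<bar>B\<bar> * \<bar>p (fst z a) * q (snd z a)\<bar>"
        using hB[of z] by (intro mult_right_mono) auto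
      then show "norm (p (fst z a) * q (snd z a) * h z) \<le> norm (B * (p (fst z a) * q (snd z a)))"
        by (simp add: abs_mult mult_ac)
    qed
  qed
  define H where "H y = (\<integral>x. h (x, y) \<partial>gauss I)" for y
  have hint: "integrable (gauss2 I) h" by (rule integrable_gauss2_bounded[OF hm hB])
  have hxy: "integrable (gauss I) (\<lambda>x. h (x, y))" if "y \<in> space (gauss I)" for y
  proof (rule integrable_gauss_bounded)
    show "(\<lambda>x. h (x, y)) \<in> borel_measurable (gauss I)"
      using hm that unfolding gauss2_def by (intro measurable_Pair1) auto
  qed (rule hB)
  have Hint: "integrable (gauss I) H"
    using integrable_snd[of "\<lambda>x y. h (x, y)"] hint unfolding H_def gauss2_def by simp
  have inner: "(\<integral>x. p (x a) * q (y a) * h (x, y) \<partial>gauss I) = (\<integral>u. p u \<partial>stdn) * (q (y a) * H y)"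
    if y: "y \<in> space (gauss I)" for y
  proof -
    have "(\<integral>x. p (x a) * h (x, y) \<partial>gauss I) = (\<integral>u. p u \<partial>stdn) * H y"
      unfolding H_def
    proof (rule gauss_isolate(2)[OF I p hxy[OF y]])
      fix x t show "h (x(a := t), y) = h (x, y)" using inv[of x t y "y a"] by simp
    qed
    moreover have "(\<integral>x. p (x a) * q (y a) * h (x, y) \<partial>gauss I) = (\<integral>x. q (y a) * (p (x a) * h (x, y)) \<partial>gauss I)"
      by (simp add: mult_ac)
    ultimately show ?thesis by simp
  qed
  have "(\<integral>z. p (fst z a) * q (snd z a) * h z \<partial>gauss2 I)
    = (\<integral>y. (\<integral>u. p u \<partial>stdn) * (q (y a) * H y) \<partial>gauss I)"
    unfolding integral_gauss2(2)[OF int]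
    by (intro Bochner_Integration.integral_cong refl) (simp add: inner)
  also have "\<dots> = (\<integral>u. p u \<partial>stdn) * (\<integral>y. q (y a) * H y \<partial>gauss I)" by simp
  also have "(\<integral>y. q (y a) * H y \<partial>gauss I) = (\<integral>u. q u \<partial>stdn) * (\<integral>y. H y \<partial>gauss I)"
  proof (rule gauss_isolate(2)[OF I q Hint])
    fix y t
    have "h (x, y(a := t)) = h (x, y)" for x using inv[of x "x a" y t] by simp
    then show "H (y(a := t)) = H y" by (simp add: H_def)
  qed
  also have "(\<integral>y. H y \<partial>gauss I) = (\<integral>z. h z \<partial>gauss2 I)"
    unfolding H_def by (rule integral_gauss2(2)[OF hint, symmetric])
  finally show "(\<integral>z. p (fst z a) * q (snd z a) * h z \<partial>gauss2 I)
      = (\<integral>u. p u \<partial>stdn) * (\<integral>u. q u \<partial>stdn) * (\<integral>z. h z \<partial>gauss2 I)" by simp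
qed

subsection \<open>Resampling operators\<close>

text \<open>The conditional expectation of \<open>f\<close> given the coordinates in
  \<open>S\<close>. As an explicit integral it is defined at every point, so identities hold
  pointwise and not just almost everywhere.\<close>

definition cavg :: "'i set \<Rightarrow> 'i set \<Rightarrow> (('i \<Rightarrow> real) \<Rightarrow> real) \<Rightarrow> ('i \<Rightarrow> real) \<Rightarrow> real" where
  "cavg I S f x = (\<integral>y. f (mix S x y) \<partial>gauss I)"

context
  fixes I :: "'i set" and f :: "('i \<Rightarrow> real) \<Rightarrow> real" and B :: real
  assumes I: "finite I" and fm: "f \<in> borel_measurable (gauss I)" and fB: "\<And>x. \<bar>f x\<bar> \<le> B"
begin

lemma f_mix_measurable: "(\<lambda>z. f (mix S (fst z) (snd z))) \<in> borel_measurable (gauss2 I)"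
  by (rule measurable_compose[OF measurable_mix fm])

lemma f_mix_y_measurable: "x \<in> space (gauss I) \<Longrightarrow> (\<lambda>y. f (mix S x y)) \<in> borel_measurable (gauss I)"
  using measurable_Pair2[of "\<lambda>z. f (mix S (fst z) (snd z))" "gauss I" "gauss I" borel x]
    f_mix_measurable[of S] by (simp add: gauss2_def)

lemma cavg_measurable: "cavg I S f \<in> borel_measurable (gauss I)"
proof -
  interpret pair_prob_space "gauss I" "gauss I" by (rule pair_prob_space_gauss)
  have "integrable (gauss I \<Otimes>\<^sub>M gauss I) (\<lambda>z. f (mix S (fst z) (snd z)))"
    using integrable_gauss2_bounded[OF f_mix_measurable fB] by (simp add: gauss2_def)
  from integrable_fst'[OF this] show ?thesis
    unfolding cavg_def[abs_def] by (auto dest: borel_measurable_integrable)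
qed

lemma cavg_bound: "\<bar>cavg I S f x\<bar> \<le> B"
proof -
  interpret g: prob_space "gauss I" by (rule prob_space_gauss)
  have B0: "0 \<le> B" using fB[of undefined] by linarith
  show ?thesis
  proof (cases "integrable (gauss I) (\<lambda>y. f (mix S x y))")
    case True
    have "\<bar>cavg I S f x\<bar> \<le> (\<integral>y. \<bar>f (mix S x y)\<bar> \<partial>gauss I)"
      unfolding cavg_def by (rule integral_abs_bound)
    also have "\<dots> \<le> (\<integral>y. B \<partial>gauss I)"
      using True fB by (intro integral_mono) auto
    finally show ?thesis by (simp add: g.prob_space)
  next
    case False
    then show ?thesis using B0 by (simp add: cavg_def not_integrable_integral_eq)
  qed
qed

lemma cavg_pairing:
  assumes gm: "g \<in> borel_measurable (gauss I)" and gB: "\<And>x. \<bar>g x\<bar> \<le> (A::real)"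
  shows "(\<integral>x. g x * cavg I S f x \<partial>gauss I) = (\<integral>z. g (fst z) * f (mix S (fst z) (snd z)) \<partial>gauss2 I)"
proof -
  have A0: "0 \<le> A" using gB[of undefined] by linarith
  have int: "integrable (gauss2 I) (\<lambda>z. g (fst z) * f (mix S (fst z) (snd z)))"
  proof (rule integrable_gauss2_bounded)
    show "(\<lambda>z. g (fst z) * f (mix S (fst z) (snd z))) \<in> borel_measurable (gauss2 I)"
      by (intro borel_measurable_times f_mix_measurable measurable_compose[OF measurable_fst_gauss2 gm])
    show "\<bar>g (fst z) * f (mix S (fst z) (snd z))\<bar> \<le> A * B" for z
      unfolding abs_mult using A0 gB fB by (intro mult_mono) auto
  qed
  show ?thesis unfolding integral_gauss2(1)[OF int] by (simp add: cavg_def)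
qed

text \<open>Conditional expectations for a product measure commute: after both averagings only the
  coordinates in \<open>S \<inter> T\<close> of \<open>x\<close> remain, and all others come from a
  field which, being a mix of two copies, is again standard Gaussian.\<close>

lemma cavg_comp:
  assumes x: "x \<in> space (gauss I)"
  shows "cavg I S (cavg I T f) x = cavg I (S \<inter> T) f x"
proof -
  have m: "(\<lambda>y. f (mix (S \<inter> T) x y)) \<in> borel_measurable (gauss I)" by (rule f_mix_y_measurable[OF x])
  have e: "mix T (mix S x y) y' = mix (S \<inter> T) x (mix T y y')" for y y' :: "'i \<Rightarrow> real"
    by (auto simp: mix_def)
  have int: "integrable (gauss I) (\<lambda>y. f (mix (S \<inter> T) x y))"
    by (rule integrable_gauss_bounded[OF m fB])
  have "cavg I S (cavg I T f) x = (\<integral>y. (\<integral>y'. f (mix (S \<inter> T) x (mix T y y')) \<partial>gauss I) \<partial>gauss I)"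
    by (simp add: cavg_def e)
  also have "\<dots> = (\<integral>z. f (mix (S \<inter> T) x (mix T (fst z) (snd z))) \<partial>gauss2 I)"
    using integral_gauss2(1)[OF gauss2_mix(1)[OF I int, of T]] by simp
  also have "\<dots> = cavg I (S \<inter> T) f x"
    unfolding gauss2_mix(2)[OF I int] cavg_def ..
  finally show ?thesis .
qed

end

lemma cavg_adjoint:
  fixes I :: "'i set"
  assumes I: "finite I" and f: "f \<in> borel_measurable (gauss I)" "\<And>x. \<bar>f x\<bar> \<le> B"
    and g: "g \<in> borel_measurable (gauss I)" "\<And>x. \<bar>g x\<bar> \<le> A"
  shows "(\<integral>x. g x * cavg I S f x \<partial>gauss I) = (\<integral>x. f x * cavg I S g x \<partial>gauss I)"
proof -
  \<comment> \<open>The swap is an involution; self-adjointness is its invariance of the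
    law.\<close>
  have e: "mix S (mix S x y) (mix S y x) = x" for x y :: "'i \<Rightarrow> real"
    by (auto simp: mix_def)
  have m: "(\<lambda>z. g (fst z) * f (mix S (fst z) (snd z))) \<in> borel_measurable (gauss2 I)"
    by (intro borel_measurable_times f_mix_measurable[OF I f] measurable_compose[OF measurable_fst_gauss2 g(1)])
  have "(\<integral>x. g x * cavg I S f x \<partial>gauss I) = (\<integral>z. g (mix S (fst z) (snd z)) * f (fst z) \<partial>gauss2 I)"
    unfolding cavg_pairing[OF I f g]
    using integral_gauss2_mix_swap[OF I m, of S] by (simp add: e)
  also have "\<dots> = (\<integral>x. f x * cavg I S g x \<partial>gauss I)"
    unfolding cavg_pairing[OF I g f] by (simp add: mult.commute)
  finally show ?thesis .
qed

text \<open>Self-adjointness moves one operator to the other side, where composition intersects the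
  two sets.\<close>

lemma cavg_inner:
  assumes I: "finite I" and f: "f \<in> borel_measurable (gauss I)" "\<And>x. \<bar>f x\<bar> \<le> B"
  shows "(\<integral>x. cavg I S f x * cavg I T f x \<partial>gauss I) = (\<integral>x. f x * cavg I (S \<inter> T) f x \<partial>gauss I)"
proof -
  note cT = cavg_measurable[OF I f, of T] cavg_bound[OF I f, of T]
  have "(\<integral>x. cavg I S f x * cavg I T f x \<partial>gauss I) = (\<integral>x. cavg I T f x * cavg I S f x \<partial>gauss I)"
    by (simp add: mult.commute)
  also have "\<dots> = (\<integral>x. f x * cavg I S (cavg I T f) x \<partial>gauss I)"
    by (rule cavg_adjoint[OF I f cT])
  also have "\<dots> = (\<integral>x. f x * cavg I (S \<inter> T) f x \<partial>gauss I)"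
    by (intro Bochner_Integration.integral_cong refl) (simp add: cavg_comp[OF I f])
  finally show ?thesis .
qed

text \<open>The noise operator, keeping each coordinate with probability \<open>r\<close>. The
  quadratic form \<open>stab\<close> is the noise stability of \<open>f\<close>.\<close>

definition noise :: "real \<Rightarrow> 'i set \<Rightarrow> (('i \<Rightarrow> real) \<Rightarrow> real) \<Rightarrow> ('i \<Rightarrow> real) \<Rightarrow> real" where
  "noise r I f x = bern r I (\<lambda>S. cavg I S f x)"

definition stab :: "real \<Rightarrow> 'i set \<Rightarrow> (('i \<Rightarrow> real) \<Rightarrow> real) \<Rightarrow> real" where
  "stab s I f = bern s I (\<lambda>S. \<integral>x. f x * cavg I S f x \<partial>gauss I)"

lemma noise_measurable:
  assumes "finite I" "f \<in> borel_measurable (gauss I)" "\<And>x. \<bar>f x\<bar> \<le> B"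
  shows "noise r I f \<in> borel_measurable (gauss I)"
  unfolding noise_def[abs_def] bern_def
  by (intro borel_measurable_sum borel_measurable_times borel_measurable_const cavg_measurable[OF assms])

lemma noise_bound:
  assumes "finite I" "f \<in> borel_measurable (gauss I)" "\<And>x. \<bar>f x\<bar> \<le> B" "0 \<le> r" "r \<le> 1"
  shows "\<bar>noise r I f x\<bar> \<le> B"
proof -
  have c: "\<bar>cavg I S f x\<bar> \<le> B" for S by (rule cavg_bound[OF assms(1-3)])
  have "bern r I (\<lambda>S. cavg I S f x) \<le> bern r I (\<lambda>_. B)"
    using c assms by (intro bern_mono) (auto simp: abs_le_iff)
  moreover have "bern r I (\<lambda>_. - B) \<le> bern r I (\<lambda>S. cavg I S f x)"
    using c assms by (intro bern_mono) (auto simp: abs_le_iff minus_le_iff)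
  ultimately show ?thesis
    unfolding noise_def bern_const[OF assms(1)] by (simp add: abs_le_iff minus_le_iff)
qed

lemma integral_bern:
  assumes "\<And>S. S \<subseteq> I \<Longrightarrow> integrable M (F S)"
  shows "(\<integral>x. bern s I (\<lambda>S. F S x) \<partial>M) = bern s I (\<lambda>S. \<integral>x. F S x \<partial>M)"
    and "integrable M (\<lambda>x. bern s I (\<lambda>S. F S x))"
  using assms unfolding bern_def
  by (auto simp: Bochner_Integration.integral_sum)

text \<open>Self-adjointness together with the semigroup law: the squared norm of the noised
  function is the quadratic form at the squared parameter.\<close>

lemma noise_sq:
  assumes I: "finite I" and f: "f \<in> borel_measurable (gauss I)" "\<And>x. \<bar>f x\<bar> \<le> B"
  shows "(\<integral>x. (noise r I f x)\<^sup>2 \<partial>gauss I) = stab (r\<^sup>2) I f"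
proof -
  have B0: "0 \<le> B" using f(2)[of undefined] by linarith
  have i: "integrable (gauss I) (\<lambda>x. cavg I S f x * cavg I T f x)" for S T
  proof (rule integrable_gauss_bounded)
    show "(\<lambda>x. cavg I S f x * cavg I T f x) \<in> borel_measurable (gauss I)"
      by (intro borel_measurable_times cavg_measurable[OF I f])
    show "\<bar>cavg I S f x * cavg I T f x\<bar> \<le> B * B" for x
      unfolding abs_mult using B0 cavg_bound[OF I f] by (intro mult_mono) auto
  qed
  have "(noise r I f x)\<^sup>2 = bern r I (\<lambda>S. bern r I (\<lambda>T. cavg I S f x * cavg I T f x))" for x
    unfolding noise_def power2_eq_square bern_cmult by (simp add: bern_cmult[symmetric] mult.commute)
  then have "(\<integral>x. (noise r I f x)\<^sup>2 \<partial>gauss I)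
     = bern r I (\<lambda>S. bern r I (\<lambda>T. \<integral>x. cavg I S f x * cavg I T f x \<partial>gauss I))"
    by (simp add: integral_bern i)
  then show ?thesis
    unfolding cavg_inner[OF I f] stab_def power2_eq_square
    using bern_Int[OF I, of r r "\<lambda>U. \<integral>x. f x * cavg I U f x \<partial>gauss I"] by simp
qed

text \<open>Cauchy-Schwarz for \<open>f\<close> and \<open>noise r I f\<close>, with the norm of
  \<open>f\<close> at most 1 and the other norm given by \<open>noise_sq\<close>.\<close>

lemma stab_sq_le:
  assumes I: "finite I" and f: "f \<in> borel_measurable (gauss I)" "\<And>x. \<bar>f x\<bar> \<le> 1" and r: "0 \<le> r" "r \<le> 1"
  shows "(stab r I f)\<^sup>2 \<le> stab (r\<^sup>2) I f"
proof -
  interpret g: prob_space "gauss I" by (rule prob_space_gauss)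
  note nm = noise_measurable[OF I f, of r] and nb = noise_bound[OF I f r]
  have i1: "integrable (gauss I) (\<lambda>x. f x * cavg I S f x)" for S
  proof (rule integrable_gauss_bounded)
    show "(\<lambda>x. f x * cavg I S f x) \<in> borel_measurable (gauss I)"
      by (intro borel_measurable_times cavg_measurable[OF I f] f)
    show "\<bar>f x * cavg I S f x\<bar> \<le> 1 * 1" for x
      unfolding abs_mult using cavg_bound[OF I f] f by (intro mult_mono) auto
  qed
  have i2: "integrable (gauss I) (\<lambda>x. f x * noise r I f x)"
    unfolding noise_def bern_cmult[symmetric] by (rule integral_bern(2)) (rule i1)
  have i3: "integrable (gauss I) (\<lambda>x. (noise r I f x)\<^sup>2)"
  proof (rule integrable_gauss_bounded)
    show "(\<lambda>x. (noise r I f x)\<^sup>2) \<in> borel_measurable (gauss I)"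
      by (intro borel_measurable_power nm)
    show "\<bar>(noise r I f x)\<^sup>2\<bar> \<le> 1" for x using nb[of x] by (simp add: abs_square_le_1)
  qed
  let ?m = "stab r I f"
  have m: "?m = (\<integral>x. f x * noise r I f x \<partial>gauss I)"
    unfolding stab_def noise_def bern_cmult[symmetric] by (rule integral_bern(1)[symmetric]) (rule i1)
  \<comment> \<open>Cauchy-Schwarz in pointwise form: expand the square of
    \<open>noise r I f x - ?m * f x\<close>, with the inner product \<open>?m\<close> as
    multiplier.\<close>
  have pt: "2 * ?m * (f x * noise r I f x) - ?m\<^sup>2 \<le> (noise r I f x)\<^sup>2" for x
  proof -
    have "0 \<le> (noise r I f x - ?m * f x)\<^sup>2" by simp
    then have "2 * ?m * (f x * noise r I f x) - ?m\<^sup>2 * (f x)\<^sup>2 \<le> (noise r I f x)\<^sup>2"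
      by (simp add: power2_eq_square algebra_simps)
    moreover have "?m\<^sup>2 * (f x)\<^sup>2 \<le> ?m\<^sup>2 * 1"
      using f(2)[of x] by (intro mult_left_mono) (auto simp: abs_square_le_1)
    ultimately show ?thesis by simp
  qed
  have "(\<integral>x. 2 * ?m * (f x * noise r I f x) - ?m\<^sup>2 \<partial>gauss I) \<le> (\<integral>x. (noise r I f x)\<^sup>2 \<partial>gauss I)"
    using i2 i3 pt by (intro integral_mono) auto
  also have "(\<integral>x. 2 * ?m * (f x * noise r I f x) - ?m\<^sup>2 \<partial>gauss I) = ?m\<^sup>2"
    using i2 by (simp add: m[symmetric] g.prob_space power2_eq_square)
  finally show ?thesis unfolding noise_sq[OF I f] .
qed

context finite_gibbs begin

lemma lse_abs_le:
  assumes "\<And>c. c \<in> C \<Longrightarrow> \<bar>h c\<bar> \<le> B"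
  shows "\<bar>lse C h\<bar> \<le> ln (card C) + B"
proof -
  have n: "real (card C) \<ge> 1" using finC neC by (simp add: Suc_le_eq card_gt_0_iff)
  have "(\<Sum>c\<in>C. exp (h c)) \<le> (\<Sum>c\<in>C. exp B)"
    using assms by (intro sum_mono) (auto simp: abs_le_iff)
  then have u: "lse C h \<le> ln (card C) + B"
  proof -
    assume "(\<Sum>c\<in>C. exp (h c)) \<le> (\<Sum>c\<in>C. exp B)"
    then have "ln (\<Sum>c\<in>C. exp (h c)) \<le> ln (card C * exp B)"
      using Z_pos[of h] by (subst ln_le_cancel_iff) auto
    also have "\<dots> = ln (card C) + B" using n by (subst ln_mult_pos) auto
    finally show ?thesis unfolding lse_def .
  qed
  have "(\<Sum>c\<in>C. exp (- B)) \<le> (\<Sum>c\<in>C. exp (h c))"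
    using assms by (intro sum_mono) (auto simp: abs_le_iff minus_le_iff)
  then have "card C * exp (- B) \<le> (\<Sum>c\<in>C. exp (h c))" by simp
  moreover have "1 * exp (- B) \<le> card C * exp (- B)" using n by (intro mult_right_mono) auto
  ultimately have "- B \<le> lse C h"
    unfolding lse_def ln_ge_iff[OF Z_pos] by linarith
  moreover have "0 \<le> ln (card C)" using n by simp
  ultimately show ?thesis using u by (simp add: abs_le_iff)
qed

lemma gcov_bilinear:
  "gcov h (\<lambda>c. p * f c + q * g c) (\<lambda>c. p * f c + q * g c)
    = p\<^sup>2 * gcov h f f + q\<^sup>2 * gcov h g g + 2 * p * q * gcov h f g"
proof -
  have "(\<lambda>c. (p * f c + q * g c) * (p * f c + q * g c))
     = (\<lambda>c. p\<^sup>2 * (f c * f c) + q\<^sup>2 * (g c * g c) + 2 * p * q * (f c * g c))"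
    by (simp add: fun_eq_iff power2_eq_square algebra_simps)
  then show ?thesis
    unfolding gcov_def by (simp only: gavg_add gavg_cmult) (simp add: power2_eq_square algebra_simps)
qed

lemma gcov_abs_le:
  assumes "\<And>c. c \<in> C \<Longrightarrow> \<bar>f c\<bar> \<le> 1" "\<And>c. c \<in> C \<Longrightarrow> \<bar>g c\<bar> \<le> 1"
  shows "\<bar>gcov h f g\<bar> \<le> 2"
proof -
  have "\<bar>gavg C h (\<lambda>c. f c * g c)\<bar> \<le> 1 * 1"
    using assms by (intro gavg_abs_le) (simp add: abs_mult mult_le_one)
  moreover have "\<bar>gavg C h f * gavg C h g\<bar> \<le> 1 * 1"
    unfolding abs_mult using assms by (intro mult_mono gavg_abs_le) auto
  ultimately show ?thesis unfolding gcov_def by linarith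
qed

end

text \<open>Turns the integrated first-order expansion of a free energy into a derivative.\<close>

lemma DERIV_from_quadratic:
  assumes "\<And>h. \<bar>f (x + h) - f x - h * D\<bar> \<le> K * h\<^sup>2"
  shows "(f has_real_derivative D) (at x)"
  unfolding DERIV_def
proof (rule LIM_equal2[where R = 1 and g = "\<lambda>h. D + (f (x + h) - f x - h * D) / h"])
  have "(\<lambda>h. (f (x + h) - f x - h * D) / h) \<midarrow>0\<rightarrow> 0"
  proof (rule Lim_null_comparison)
    show "\<forall>\<^sub>F h in at 0. norm ((f (x + h) - f x - h * D) / h) \<le> K * \<bar>h\<bar>"
      unfolding eventually_at_filter
    proof (intro always_eventually allI impI)
      fix h :: real assume "h \<noteq> 0"
      then show "norm ((f (x + h) - f x - h * D) / h) \<le> K * \<bar>h\<bar>"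
        using assms[of h] by (simp add: field_simps power2_eq_square abs_mult)
    qed
    show "(\<lambda>h. K * \<bar>h\<bar>) \<midarrow>0\<rightarrow> 0"
      by (rule tendsto_eq_intros refl)+ simp
  qed
  from tendsto_add[OF tendsto_const[of D] this]
  show "(\<lambda>h. D + (f (x + h) - f x - h * D) / h) \<midarrow>0\<rightarrow> D" by simp
qed (auto simp: field_simps)

subsection \<open>Chaos under resampling\<close>

text \<open>The abstract setting is a Gaussian field on \<open>C\<close> with feature vectors
  \<open>e\<close>. Nonnegativity of all covariances is what gives the interpolation its sign; in
  the application they are squares. The bound on \<open>e\<close> is required everywhere, so that
  estimates need no membership conditions.\<close>

locale chaos = finite_gibbs C for C :: "'c set" +
  fixes I :: "'i set" and e :: "'i \<Rightarrow> 'c \<Rightarrow> real" and b :: real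
  assumes finI: "finite I" and b_pos: "b > 0"
    and e_bound: "\<And>a c. \<bar>e a c\<bar> \<le> 1"
    and V_nonneg: "\<And>c d. 0 \<le> (\<Sum>a\<in>I. e a c * e a d)"
begin

sublocale P: finite_gibbs "C \<times> C"
  using finC neC by unfold_locales auto

definition field :: "('i \<Rightarrow> real) \<Rightarrow> 'c \<Rightarrow> real" where
  "field x c = (\<Sum>a\<in>I. x a * e a c)"

definition V :: "'c \<times> 'c \<Rightarrow> real" where
  "V k = (\<Sum>a\<in>I. e a (fst k) * e a (snd k))"

text \<open>Two replicas, each in its own disorder and at inverse temperature \<open>b\<close>,
  coupled through their covariance with strength \<open>l\<close>.\<close>

definition ham :: "real \<Rightarrow> ('i \<Rightarrow> real) \<times> ('i \<Rightarrow> real) \<Rightarrow> 'c \<times> 'c \<Rightarrow> real" where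
  "ham l z k = b * field (fst z) (fst k) + b * field (snd z) (snd k) + l * V k"

text \<open>The pair of disorders which agree on \<open>S\<close> and are independent
  elsewhere.\<close>

definition part :: "'i set \<Rightarrow> ('i \<Rightarrow> real) \<times> ('i \<Rightarrow> real) \<Rightarrow> ('i \<Rightarrow> real) \<times> ('i \<Rightarrow> real)" where
  "part S z = (fst z, mix S (fst z) (snd z))"

text \<open>Removes coupling \<open>a\<close> from both disorders. What is left cannot tell whether
  \<open>a\<close> was shared, which makes it the common base point for comparing \<open>S\<close>
  with \<open>insert a S\<close>.\<close>

definition zap :: "'i \<Rightarrow> ('i \<Rightarrow> real) \<times> ('i \<Rightarrow> real) \<Rightarrow> ('i \<Rightarrow> real) \<times> ('i \<Rightarrow> real)" where
  "zap a z = ((fst z)(a := 0), (snd z)(a := 0))"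

lemma V_bound: "\<bar>V k\<bar> \<le> card I"
proof -
  have "\<bar>V k\<bar> \<le> (\<Sum>a\<in>I. \<bar>e a (fst k) * e a (snd k)\<bar>)" unfolding V_def by (rule sum_abs)
  also have "\<dots> \<le> (\<Sum>a\<in>I. 1)"
    using e_bound by (intro sum_mono) (simp add: abs_mult mult_le_one)
  finally show ?thesis by simp
qed

lemma V_pos: "0 \<le> V k"
  unfolding V_def by (rule V_nonneg)

lemma field_measurable: "(\<lambda>x. field x c) \<in> borel_measurable (gauss I)"
  unfolding field_def
  by (intro borel_measurable_sum borel_measurable_times measurable_gauss_component borel_measurable_const)

lemma ham_measurable: "(\<lambda>z. ham l z k) \<in> borel_measurable (gauss2 I)"
  unfolding ham_def
  by (intro borel_measurable_add borel_measurable_times borel_measurable_const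
      measurable_compose[OF measurable_fst_gauss2 field_measurable]
      measurable_compose[OF measurable_snd_gauss2 field_measurable])

lemma part_measurable: "part S \<in> measurable (gauss2 I) (gauss2 I)"
  unfolding part_def[abs_def] using measurable_fst_gauss2[of I] measurable_mix[of S I]
  unfolding gauss2_def by (rule measurable_Pair)

lemma zap_measurable: "a \<in> I \<Longrightarrow> zap a \<in> measurable (gauss2 I) (gauss2 I)"
proof -
  assume a: "a \<in> I"
  have "(\<lambda>x. x(a := 0)) \<in> measurable (gauss I) (gauss I)"
  proof (rule measurable_gaussI)
    fix i assume "i \<in> I"
    then show "(\<lambda>w. (w(a := 0)) i) \<in> borel_measurable (gauss I)"
      by (cases "i = a") (auto intro: measurable_gauss_component)
  qed (use a in \<open>auto simp: space_gauss PiE_def extensional_def\<close>)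
  note m = this
  show ?thesis unfolding zap_def[abs_def]
    using measurable_compose[OF measurable_fst_gauss2 m] measurable_compose[OF measurable_snd_gauss2 m]
    unfolding gauss2_def by (rule measurable_Pair)
qed

lemma gavg_measurable:
  assumes "\<And>k. (\<lambda>z. H z k) \<in> borel_measurable M"
  shows "(\<lambda>z. gavg K (H z) f) \<in> borel_measurable M"
  unfolding gavg_def gibbs_def using assms
  by (intro borel_measurable_sum borel_measurable_times borel_measurable_divide
      measurable_compose[OF _ borel_measurable_exp] borel_measurable_const)

lemma lse_measurable:
  assumes "\<And>k. (\<lambda>z. H z k) \<in> borel_measurable M"
  shows "(\<lambda>z. lse K (H z)) \<in> borel_measurable M"
  unfolding lse_def using assms
  by (intro borel_measurable_ln borel_measurable_sum measurable_compose[OF _ borel_measurable_exp])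

lemmas ham_part_measurable = measurable_compose[OF part_measurable ham_measurable]

lemma ham_zap_part_measurable: "a \<in> I \<Longrightarrow> (\<lambda>z. ham l (zap a (part S z)) k) \<in> borel_measurable (gauss2 I)"
  by (rule measurable_compose[OF part_measurable measurable_compose[OF zap_measurable ham_measurable]])

lemma abs_field_le: "\<bar>field x c\<bar> \<le> (\<Sum>a\<in>I. \<bar>x a\<bar>)"
  unfolding field_def using e_bound
  by (intro order_trans[OF sum_abs] sum_mono) (simp add: abs_mult mult_left_le)

lemma lse_part_integrable: "integrable (gauss2 I) (\<lambda>z. lse (C \<times> C) (ham l (part S z)))"
proof (rule Bochner_Integration.integrable_bound)
  let ?g = "\<lambda>z. ln (card (C \<times> C)) + (b * (\<Sum>a\<in>I. \<bar>fst z a\<bar>) + b * (\<Sum>a\<in>I. \<bar>mix S (fst z) (snd z) a\<bar>) + \<bar>l\<bar> * card I)"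
  interpret g2: prob_space "gauss2 I" by (rule prob_space_gauss2)
  have i: "integrable (gauss I) (\<lambda>x. \<Sum>a\<in>I. \<bar>x a\<bar>)"
    by (intro Bochner_Integration.integrable_sum integrable_gauss_component integrable_stdn_abs)
  show "integrable (gauss2 I) ?g"
    using gauss2_fst(1)[OF i] gauss2_mix(1)[OF finI i, of S] by simp
  show "(\<lambda>z. lse (C \<times> C) (ham l (part S z))) \<in> borel_measurable (gauss2 I)"
    by (intro lse_measurable ham_part_measurable)
  show "AE z in gauss2 I. norm (lse (C \<times> C) (ham l (part S z))) \<le> norm (?g z)"
  proof (rule AE_I2)
    fix z
    have "\<bar>ham l (part S z) k\<bar> \<le> b * (\<Sum>a\<in>I. \<bar>fst z a\<bar>) + b * (\<Sum>a\<in>I. \<bar>mix S (fst z) (snd z) a\<bar>) + \<bar>l\<bar> * card I" for k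
    proof -
      have "\<bar>ham l (part S z) k\<bar> \<le> \<bar>b * field (fst z) (fst k)\<bar> + \<bar>b * field (mix S (fst z) (snd z)) (snd k)\<bar> + \<bar>l * V k\<bar>"
        unfolding ham_def part_def by simp
      also have "\<dots> \<le> b * (\<Sum>a\<in>I. \<bar>fst z a\<bar>) + b * (\<Sum>a\<in>I. \<bar>mix S (fst z) (snd z) a\<bar>) + \<bar>l\<bar> * card I"
        unfolding abs_mult using b_pos abs_field_le V_bound
        by (intro add_mono mult_mono) auto
      finally show ?thesis .
    qed
    from P.lse_abs_le[of "ham l (part S z)", OF this] show "norm (lse (C \<times> C) (ham l (part S z))) \<le> norm (?g z)" by simp
  qed
qed

definition F :: "real \<Rightarrow> 'i set \<Rightarrow> real" where
  "F l S = (\<integral>z. lse (C \<times> C) (ham l (part S z)) \<partial>gauss2 I)"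

definition VE :: "real \<Rightarrow> 'i set \<Rightarrow> real" where
  "VE l S = (\<integral>z. gavg (C \<times> C) (ham l (part S z)) V \<partial>gauss2 I)"

lemma gavg_part_integrable:
  assumes "\<And>k. \<bar>f k\<bar> \<le> B"
  shows "integrable (gauss2 I) (\<lambda>z. gavg (C \<times> C) (ham l (part S z)) f)"
  using assms
  by (intro integrable_gauss2_bounded[of _ _ B] gavg_measurable ham_part_measurable P.gavg_abs_le) auto

lemma DERIV_F: "((\<lambda>l. F l S) has_real_derivative VE l S) (at l)"
proof (rule DERIV_from_quadratic)
  fix h :: real
  interpret g2: prob_space "gauss2 I" by (rule prob_space_gauss2)
  let ?d = "\<lambda>z. lse (C \<times> C) (ham (l + h) (part S z)) - lse (C \<times> C) (ham l (part S z))
     - h * gavg (C \<times> C) (ham l (part S z)) V"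
  have i: "integrable (gauss2 I) ?d"
    by (intro Bochner_Integration.integrable_diff lse_part_integrable integrable_mult_right
        gavg_part_integrable[of _ "card I"] V_bound)
  have "\<bar>?d z\<bar> \<le> 2 * (\<bar>h\<bar> * card I)\<^sup>2" for z
  proof -
    have eq: "ham (l + h) (part S z) = (\<lambda>k. ham l (part S z) k + h * V k)"
      by (simp add: ham_def fun_eq_iff algebra_simps)
    show ?thesis
      unfolding eq P.gavg_cmult[symmetric]
      by (rule P.lse_first_order) (auto simp: abs_mult intro!: mult_left_mono V_bound)
  qed
  then have "\<bar>\<integral>z. ?d z \<partial>gauss2 I\<bar> \<le> (\<integral>z. 2 * (\<bar>h\<bar> * card I)\<^sup>2 \<partial>gauss2 I)"
    by (intro order_trans[OF integral_abs_bound] integral_mono integrable_abs i) auto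
  moreover have "(\<integral>z. ?d z \<partial>gauss2 I) = F (l + h) S - F l S - h * VE l S"
    unfolding F_def VE_def
    by (subst Bochner_Integration.integral_diff Bochner_Integration.integral_diff integral_mult_right_zero;
        (intro Bochner_Integration.integrable_diff lse_part_integrable integrable_mult_right
        gavg_part_integrable[of _ "card I"] V_bound)?)+ simp
  ultimately show "\<bar>F (l + h) S - F l S - h * VE l S\<bar> \<le> (2 * (real (card I))\<^sup>2) * h\<^sup>2"
    by (simp add: g2.prob_space power_mult_distrib mult_ac)
qed

abbreviation "e1 a \<equiv> \<lambda>k :: 'c \<times> 'c. e a (fst k)"
abbreviation "e2 a \<equiv> \<lambda>k :: 'c \<times> 'c. e a (snd k)"

definition J :: "real \<Rightarrow> 'i \<Rightarrow> 'i set \<Rightarrow> real" where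
  "J l a S = (\<integral>z. P.gcov (ham l (part S z)) (e1 a) (e2 a) \<partial>gauss2 I)"

text \<open>The covariance with coupling \<open>a\<close> switched off. Unlike \<open>J\<close> it
  factors out of integrals over that coupling.\<close>

definition J0 :: "real \<Rightarrow> 'i \<Rightarrow> 'i set \<Rightarrow> real" where
  "J0 l a S = (\<integral>z. P.gcov (ham l (zap a (part S z))) (e1 a) (e2 a) \<partial>gauss2 I)"

lemma field_split: "a \<in> I \<Longrightarrow> field x c = field (x(a := 0)) c + x a * e a c"
  unfolding field_def using finI by (simp add: sum.remove[of I a])

lemma ham_split:
  assumes "a \<in> I"
  shows "ham l z = (\<lambda>k. ham l (zap a z) k + (b * fst z a * e1 a k + b * snd z a * e2 a k))"
  using assms
  by (simp add: ham_def zap_def fun_eq_iff field_split[of a "fst z"] field_split[of a "snd z"] algebra_simps)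

lemma zap_part_insert: "zap a (part (insert a S) z) = zap a (part S z)"
  by (auto simp: zap_def part_def mix_def fun_eq_iff)

lemma gcov_measurable:
  assumes "\<And>k. (\<lambda>z. H z k) \<in> borel_measurable M"
  shows "(\<lambda>z. P.gcov (H z) f g) \<in> borel_measurable M"
  unfolding P.gcov_def using assms
  by (intro borel_measurable_diff borel_measurable_times gavg_measurable)

lemma Y_bound: "\<bar>b * u * e1 a k + b * v * e2 a k\<bar> \<le> b * (\<bar>u\<bar> + \<bar>v\<bar>)"
proof -
  have "\<bar>b * u * e1 a k + b * v * e2 a k\<bar> \<le> \<bar>b * u * e1 a k\<bar> + \<bar>b * v * e2 a k\<bar>" by (rule abs_triangle_ineq)
  also have "\<dots> \<le> b * \<bar>u\<bar> * 1 + b * \<bar>v\<bar> * 1"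
    unfolding abs_mult using b_pos e_bound by (intro add_mono mult_mono) auto
  finally show ?thesis by (simp add: algebra_simps)
qed

text \<open>Restoring the coupling is a tilt of size \<open>b\<close> times the sum of the absolute
  values of its two copies. Each has mean at most 1, so the covariance moves by at most
  \<open>6 * b * 2\<close>.\<close>

lemma J_near_J0:
  assumes a: "a \<in> I"
  shows "\<bar>J l a S - J0 l a S\<bar> \<le> 12 * b"
proof -
  let ?d = "\<lambda>z. P.gcov (ham l (part S z)) (e1 a) (e2 a) - P.gcov (ham l (zap a (part S z))) (e1 a) (e2 a)"
  have i1: "integrable (gauss2 I) (\<lambda>z. P.gcov (ham l (part S z)) (e1 a) (e2 a))"
    by (intro integrable_gauss2_bounded[of _ _ 2] gcov_measurable ham_part_measurable P.gcov_abs_le e_bound)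
  have i2: "integrable (gauss2 I) (\<lambda>z. P.gcov (ham l (zap a (part S z))) (e1 a) (e2 a))"
    by (intro integrable_gauss2_bounded[of _ _ 2] gcov_measurable ham_zap_part_measurable P.gcov_abs_le e_bound a)
  have ia: "integrable (gauss I) (\<lambda>x. \<bar>x a\<bar>)"
    by (intro integrable_gauss_component integrable_stdn_abs a)
  have ua: "(\<integral>x. \<bar>x a\<bar> \<partial>gauss I) \<le> 1"
    using integral_gauss_component[OF a, of "\<lambda>u. \<bar>u\<bar>"] integral_stdn_abs by simp
  let ?g = "\<lambda>z. 6 * b * (\<bar>fst z a\<bar> + \<bar>mix S (fst z) (snd z) a\<bar>)"
  have ig: "integrable (gauss2 I) ?g"
    using gauss2_fst(1)[OF ia] gauss2_mix(1)[OF finI ia, of S] by simp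
  have "\<bar>?d z\<bar> \<le> ?g z" for z
  proof -
    have "\<bar>?d z\<bar> \<le> 6 * 1 * 1 * (b * (\<bar>fst (part S z) a\<bar> + \<bar>snd (part S z) a\<bar>))"
      by (subst ham_split[OF a, of l "part S z"]) (intro P.gcov_tilt e_bound Y_bound)
    then show ?thesis by (simp add: part_def)
  qed
  then have "\<bar>\<integral>z. ?d z \<partial>gauss2 I\<bar> \<le> (\<integral>z. ?g z \<partial>gauss2 I)"
    by (intro order_trans[OF integral_abs_bound] integral_mono integrable_abs Bochner_Integration.integrable_diff i1 i2 ig)
  also have "\<dots> = 6 * b * ((\<integral>x. \<bar>x a\<bar> \<partial>gauss I) + (\<integral>x. \<bar>x a\<bar> \<partial>gauss I))"
    using gauss2_fst[OF ia] gauss2_mix[OF finI ia, of S] by simp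
  also have "\<dots> \<le> 6 * b * (1 + 1)" using ua b_pos by (intro mult_left_mono) auto
  finally show ?thesis unfolding J_def J0_def using i1 i2 by simp
qed

lemma zap_part_upd: "zap a (part S (x(a := s), y(a := t))) = zap a (part S (x, y))"
  by (auto simp: zap_def part_def mix_def fun_eq_iff)

lemma cube_sum_le: "(u + v) ^ 3 \<le> 4 * (u ^ 3 + v ^ 3)" if "0 \<le> u" "0 \<le> v" for u v :: real
proof -
  have "0 \<le> 3 * ((u + v) * (u - v)\<^sup>2)" using that by simp
  also have "3 * ((u + v) * (u - v)\<^sup>2) = 4 * (u ^ 3 + v ^ 3) - (u + v) ^ 3"
    by (simp add: power2_eq_square power3_eq_cube algebra_simps)
  finally show ?thesis by simp
qed

text \<open>Difference of two second-order expansions about the same base point: \<open>u\<close> in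
  both replicas against \<open>u\<close> and \<open>v\<close>; everything concerning the first
  replica alone cancels. The factors 1 give each term the product form that
  \<open>gauss2_isolate\<close> integrates.\<close>

lemma second_order_diff:
  fixes L1 L2 L0 m1 m2 V1 V2 K p q u v w :: real
  assumes "\<bar>L1 - L0 - (w * u * m1 + w * u * m2) - ((w * u)\<^sup>2 * V1 + (w * u)\<^sup>2 * V2 + 2 * (w * u) * (w * u) * K) / 2\<bar> \<le> 24 * w ^ 3 * p"
    and "\<bar>L2 - L0 - (w * u * m1 + w * v * m2) - ((w * u)\<^sup>2 * V1 + (w * v)\<^sup>2 * V2 + 2 * (w * u) * (w * v) * K) / 2\<bar>
      \<le> 12 * w ^ 3 * p + 12 * w ^ 3 * q"
  shows "L1 - L2 \<le> w * (u * 1 * m2) - w * (1 * v * m2) + w\<^sup>2 / 2 * (u\<^sup>2 * 1 * V2) - w\<^sup>2 / 2 * (1 * v\<^sup>2 * V2)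
       + w\<^sup>2 * (u\<^sup>2 * 1 * K) - w\<^sup>2 * (u * v * K) + 36 * w ^ 3 * (p * 1 * 1) + 12 * w ^ 3 * (1 * q * 1)"
proof -
  have "L1 - L0 - (w * u * m1 + w * u * m2) - ((w * u)\<^sup>2 * V1 + (w * u)\<^sup>2 * V2 + 2 * (w * u) * (w * u) * K) / 2
     - (L2 - L0 - (w * u * m1 + w * v * m2) - ((w * u)\<^sup>2 * V1 + (w * v)\<^sup>2 * V2 + 2 * (w * u) * (w * v) * K) / 2)
     = L1 - L2 - (w * (u * 1 * m2) - w * (1 * v * m2) + w\<^sup>2 / 2 * (u\<^sup>2 * 1 * V2) - w\<^sup>2 / 2 * (1 * v\<^sup>2 * V2)
       + w\<^sup>2 * (u\<^sup>2 * 1 * K) - w\<^sup>2 * (u * v * K))"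
    by (simp add: power2_eq_square field_simps)
  then show ?thesis using assms by (simp add: abs_le_iff)
qed

text \<open>Sharing one more coordinate: after the terms of first and second order have been integrated
  over the two copies of that coordinate, only the covariance survives.\<close>

lemma F_step:
  assumes a: "a \<in> I" and S: "a \<notin> S"
  shows "F l (insert a S) - F l S \<le> b\<^sup>2 * J0 l a S + 96 * b ^ 3"
proof -
  let ?h = "\<lambda>z. ham l (zap a (part S z))"
  let ?m1 = "\<lambda>z. gavg (C \<times> C) (?h z) (e1 a)"
  let ?m2 = "\<lambda>z. gavg (C \<times> C) (?h z) (e2 a)"
  let ?V1 = "\<lambda>z. P.gcov (?h z) (e1 a) (e1 a)"
  let ?V2 = "\<lambda>z. P.gcov (?h z) (e2 a) (e2 a)"
  let ?C = "\<lambda>z. P.gcov (?h z) (e1 a) (e2 a)"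
  have exp2: "\<bar>lse (C \<times> C) (\<lambda>k. ?h z k + (b * u * e1 a k + b * v * e2 a k)) - lse (C \<times> C) (?h z)
      - (b * u * ?m1 z + b * v * ?m2 z)
      - ((b * u)\<^sup>2 * ?V1 z + (b * v)\<^sup>2 * ?V2 z + 2 * (b * u) * (b * v) * ?C z) / 2\<bar>
      \<le> 3 * (b * (\<bar>u\<bar> + \<bar>v\<bar>)) ^ 3" for z u v
    using P.lse_second_order[of "\<lambda>k. b * u * e1 a k + b * v * e2 a k" "b * (\<bar>u\<bar> + \<bar>v\<bar>)" "?h z", OF Y_bound]
    by (simp only: P.gcov_bilinear P.gavg_add P.gavg_cmult)
  have step: "lse (C \<times> C) (ham l (part (insert a S) z)) - lse (C \<times> C) (ham l (part S z))
     \<le> (\<lambda>u v. b * (u * 1 * ?m2 z) - b * (1 * v * ?m2 z) + b\<^sup>2 / 2 * (u\<^sup>2 * 1 * ?V2 z) - b\<^sup>2 / 2 * (1 * v\<^sup>2 * ?V2 z)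
       + b\<^sup>2 * (u\<^sup>2 * 1 * ?C z) - b\<^sup>2 * (u * v * ?C z)
       + 36 * b ^ 3 * (\<bar>u\<bar> ^ 3 * 1 * 1) + 12 * b ^ 3 * (1 * \<bar>v\<bar> ^ 3 * 1)) (fst z a) (snd z a)" for z
  proof -
    define u v where "u = fst z a" and "v = snd z a"
    have s1: "ham l (part (insert a S) z) = (\<lambda>k. ?h z k + (b * u * e1 a k + b * u * e2 a k))"
      by (subst ham_split[OF a]) (simp add: zap_part_insert u_def, simp add: part_def mix_def)
    have s2: "ham l (part S z) = (\<lambda>k. ?h z k + (b * u * e1 a k + b * v * e2 a k))"
      using S by (subst ham_split[OF a]) (simp add: u_def v_def, simp add: part_def mix_def)
    have c1: "3 * (b * (\<bar>u\<bar> + \<bar>u\<bar>)) ^ 3 = 24 * b ^ 3 * \<bar>u\<bar> ^ 3"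
      by (simp add: power_mult_distrib power3_eq_cube)
    have "b ^ 3 * (\<bar>u\<bar> + \<bar>v\<bar>) ^ 3 \<le> b ^ 3 * (4 * (\<bar>u\<bar> ^ 3 + \<bar>v\<bar> ^ 3))"
      using b_pos by (intro mult_left_mono cube_sum_le) auto
    then have "3 * (b * (\<bar>u\<bar> + \<bar>v\<bar>)) ^ 3 \<le> 3 * (b ^ 3 * (4 * (\<bar>u\<bar> ^ 3 + \<bar>v\<bar> ^ 3)))"
      unfolding power_mult_distrib[of b] by (rule mult_left_mono) simp
    also have "\<dots> = 12 * b ^ 3 * \<bar>u\<bar> ^ 3 + 12 * b ^ 3 * \<bar>v\<bar> ^ 3" by (simp add: algebra_simps)
    finally have c2: "3 * (b * (\<bar>u\<bar> + \<bar>v\<bar>)) ^ 3 \<le> 12 * b ^ 3 * \<bar>u\<bar> ^ 3 + 12 * b ^ 3 * \<bar>v\<bar> ^ 3" .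
    show ?thesis
      unfolding s1 s2 u_def[symmetric] v_def[symmetric]
      by (rule second_order_diff[OF exp2[of z u u, unfolded c1] order_trans[OF exp2[of z u v] c2]])
  qed
  have hb: "has_bochner_integral (gauss2 I) (\<lambda>z. p (fst z a) * q (snd z a) * H z)
      ((\<integral>u. p u \<partial>stdn) * (\<integral>u. q u \<partial>stdn) * (\<integral>z. H z \<partial>gauss2 I))"
    if "integrable stdn p" "integrable stdn q" "H \<in> borel_measurable (gauss2 I)" "\<And>z. \<bar>H z\<bar> \<le> 2"
      "\<And>x y s t. H (x(a := s), y(a := t)) = H (x, y)" for p q :: "real \<Rightarrow> real" and H
    using gauss2_isolate[OF finI a that] by (simp add: has_bochner_integral_iff)
  have i1: "integrable stdn (\<lambda>_. 1 :: real)" by simp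
  have one: "(\<integral>u. 1 \<partial>stdn) = (1 :: real)" using stdn.prob_space by simp
  have i2: "integrable stdn (\<lambda>u. u\<^sup>2)" by (rule integrable_stdn_power)
  note ii = integrable_stdn_id i1 i2 integrable_stdn_abs_power
  have mm: "?m2 \<in> borel_measurable (gauss2 I)"
    by (intro gavg_measurable ham_zap_part_measurable a)
  have mb: "\<bar>?m2 z\<bar> \<le> 2" for z
    using P.gavg_abs_le[of "e2 a" 1 "?h z"] e_bound by fastforce
  have gm: "(\<lambda>z. P.gcov (?h z) f g) \<in> borel_measurable (gauss2 I)" for f g
    by (intro gcov_measurable ham_zap_part_measurable a)
  have gb: "\<bar>?V2 z\<bar> \<le> 2" "\<bar>?C z\<bar> \<le> 2" for z
    by (rule P.gcov_abs_le; rule e_bound)+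
  interpret g2: prob_space "gauss2 I" by (rule prob_space_gauss2)
  have oneg: "(\<integral>z. 1 \<partial>gauss2 I) = (1 :: real)" using g2.prob_space by simp
  let ?M2 = "\<integral>z. ?m2 z \<partial>gauss2 I" and ?W2 = "\<integral>z. ?V2 z \<partial>gauss2 I"
  let ?m3 = "\<integral>u. \<bar>u\<bar> ^ 3 \<partial>stdn"
  let ?R = "\<lambda>z. b * (fst z a * 1 * ?m2 z) - b * (1 * snd z a * ?m2 z) + b\<^sup>2 / 2 * ((fst z a)\<^sup>2 * 1 * ?V2 z)
       - b\<^sup>2 / 2 * (1 * (snd z a)\<^sup>2 * ?V2 z)
       + b\<^sup>2 * ((fst z a)\<^sup>2 * 1 * ?C z) - b\<^sup>2 * (fst z a * snd z a * ?C z)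
       + 36 * b ^ 3 * (\<bar>fst z a\<bar> ^ 3 * 1 * 1) + 12 * b ^ 3 * (1 * \<bar>snd z a\<bar> ^ 3 * 1)"
  have tot: "has_bochner_integral (gauss2 I) ?R
     (b * ((\<integral>u. u \<partial>stdn) * (\<integral>u. 1 \<partial>stdn) * ?M2) - b * ((\<integral>u. 1 \<partial>stdn) * (\<integral>u. u \<partial>stdn) * ?M2)
      + b\<^sup>2 / 2 * ((\<integral>u. u\<^sup>2 \<partial>stdn) * (\<integral>u. 1 \<partial>stdn) * ?W2) - b\<^sup>2 / 2 * ((\<integral>u. 1 \<partial>stdn) * (\<integral>u. u\<^sup>2 \<partial>stdn) * ?W2)
      + b\<^sup>2 * ((\<integral>u. u\<^sup>2 \<partial>stdn) * (\<integral>u. 1 \<partial>stdn) * J0 l a S) - b\<^sup>2 * ((\<integral>u. u \<partial>stdn) * (\<integral>u. u \<partial>stdn) * J0 l a S)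
      + 36 * b ^ 3 * (?m3 * (\<integral>u. 1 \<partial>stdn) * (\<integral>z. 1 \<partial>gauss2 I)) + 12 * b ^ 3 * ((\<integral>u. 1 \<partial>stdn) * ?m3 * (\<integral>z. 1 \<partial>gauss2 I)))"
    unfolding J0_def
    by (intro has_bochner_integral_add has_bochner_integral_diff has_bochner_integral_mult_right
       hb[of "\<lambda>u. u" "\<lambda>_. 1" ?m2] hb[of "\<lambda>_. 1" "\<lambda>u. u" ?m2] hb[of "\<lambda>u. u\<^sup>2" "\<lambda>_. 1" ?V2]
       hb[of "\<lambda>_. 1" "\<lambda>u. u\<^sup>2" ?V2] hb[of "\<lambda>u. u\<^sup>2" "\<lambda>_. 1" ?C] hb[of "\<lambda>u. u" "\<lambda>u. u" ?C]
       hb[of "\<lambda>u. \<bar>u\<bar> ^ 3" "\<lambda>_. 1" "\<lambda>_. 1"] hb[of "\<lambda>_. 1" "\<lambda>u. \<bar>u\<bar> ^ 3" "\<lambda>_. 1"]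
       ii mm mb gm gb borel_measurable_const) (simp_all add: zap_part_upd)
  have "F l (insert a S) - F l S
     = (\<integral>z. lse (C \<times> C) (ham l (part (insert a S) z)) - lse (C \<times> C) (ham l (part S z)) \<partial>gauss2 I)"
    unfolding F_def by (simp add: lse_part_integrable)
  also have "\<dots> \<le> (\<integral>z. ?R z \<partial>gauss2 I)"
    by (intro integral_mono Bochner_Integration.integrable_diff lse_part_integrable
        integrable.intros[OF tot]) (rule step)
  \<comment> \<open>The two \<open>?V2\<close> terms cancel because both copies have variance 1. The
    cubic constants 36 and 12 add up to 48; third absolute moments are at most 2, whence 96.\<close>
  also have "\<dots> = b\<^sup>2 * J0 l a S + 48 * b ^ 3 * ?m3"
    unfolding has_bochner_integral_integral_eq[OF tot] one oneg integral_stdn_id integral_stdn_sq by simp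
  also have "48 * b ^ 3 * ?m3 \<le> 48 * b ^ 3 * 2"
    using integral_stdn_abs3 b_pos by (intro mult_left_mono) auto
  finally show ?thesis by simp
qed

end

section \<open>Monotone interpolation and the bound on the coupled free energy\<close>

context chaos begin

text \<open>The subtracted products of averages sum to the mean covariance between the first
  component of one replica pair and the second component of an independent one, which is nonnegative
  by \<open>V_nonneg\<close>.\<close>

lemma sum_cov_le:
  "(\<Sum>a\<in>I. P.gcov h (e1 a) (e2 a)) \<le> gavg (C \<times> C) h V"
proof -
  have "(\<Sum>a\<in>I. gavg (C \<times> C) h (\<lambda>k. e1 a k * e2 a k)) = gavg (C \<times> C) h V"
    unfolding V_def gavg_def by (subst sum.swap) (simp add: sum_distrib_left)
  moreover have "0 \<le> (\<Sum>a\<in>I. gavg (C \<times> C) h (e1 a) * gavg (C \<times> C) h (e2 a))"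
  proof -
    have "(\<Sum>a\<in>I. gavg (C \<times> C) h (e1 a) * gavg (C \<times> C) h (e2 a))
       = (\<Sum>a\<in>I. \<Sum>k\<in>C\<times>C. \<Sum>m\<in>C\<times>C. (gibbs (C \<times> C) h k * gibbs (C \<times> C) h m) * (e a (fst k) * e a (snd m)))"
      unfolding gavg_def sum_product by (simp add: mult_ac)
    also have "\<dots> = (\<Sum>k\<in>C\<times>C. \<Sum>m\<in>C\<times>C. \<Sum>a\<in>I. (gibbs (C \<times> C) h k * gibbs (C \<times> C) h m) * (e a (fst k) * e a (snd m)))"
      by (subst sum.swap) (intro sum.cong refl sum.swap)
    also have "\<dots> \<ge> 0"
      unfolding sum_distrib_left[symmetric]
      using P.gibbs_pos[THEN less_imp_le] by (intro sum_nonneg mult_nonneg_nonneg V_nonneg) auto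
    finally show ?thesis .
  qed
  ultimately show ?thesis unfolding P.gcov_def by (simp add: sum_subtractf)
qed

lemma sum_J_le: "(\<Sum>a\<in>I. J l a S) \<le> VE l S"
proof -
  have i: "integrable (gauss2 I) (\<lambda>z. P.gcov (ham l (part S z)) (e1 a) (e2 a))" for a
    by (intro integrable_gauss2_bounded[of _ _ 2] gcov_measurable ham_part_measurable P.gcov_abs_le e_bound)
  have "(\<Sum>a\<in>I. J l a S) = (\<integral>z. (\<Sum>a\<in>I. P.gcov (ham l (part S z)) (e1 a) (e2 a)) \<partial>gauss2 I)"
    unfolding J_def using i by simp
  also have "\<dots> \<le> VE l S"
    unfolding VE_def
    by (intro integral_mono Bochner_Integration.integrable_sum i gavg_part_integrable[of _ "card I"] V_bound sum_cov_le)
  finally show ?thesis .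
qed

lemma J0_insert: "J0 l a (insert a S) = J0 l a S"
  by (simp add: J0_def zap_part_insert)

text \<open>\<open>F_step\<close> yields a covariance without coupling \<open>a\<close>, averaged
  over subsets of \<open>I - {a}\<close>. Returning to \<open>J\<close>, averaged over subsets of
  \<open>I\<close>, costs \<open>12 * b\<close> more, hence 96 + 12 = 108.\<close>

lemma russo_term_le:
  assumes a: "a \<in> I" and s: "0 \<le> s" "s \<le> 1"
  shows "bern s (I - {a}) (\<lambda>S. F l (insert a S) - F l S) \<le> b\<^sup>2 * bern s I (J l a) + 108 * b ^ 3"
proof -
  have near: "J0 l a S \<le> J l a S + 12 * b" "J0 l a S \<le> J l a (insert a S) + 12 * b" for S
    using J_near_J0[OF a, of l S] J_near_J0[OF a, of l "insert a S"] by (auto simp: J0_insert abs_le_iff)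
  have fin: "finite (I - {a})" using finI by simp
  have "bern s (I - {a}) (\<lambda>S. F l (insert a S) - F l S) \<le> bern s (I - {a}) (\<lambda>S. b\<^sup>2 * J0 l a S + 96 * b ^ 3)"
    using s by (intro bern_mono F_step a) auto
  also have "\<dots> = b\<^sup>2 * bern s (I - {a}) (J0 l a) + 96 * b ^ 3"
    by (simp only: bern_add bern_cmult bern_const[OF fin])
  \<comment> \<open>The quantity \<open>J0\<close> ignores membership of \<open>a\<close>, so it is
    compared with \<open>J\<close> in both cases, weighted by \<open>s\<close> and
    \<open>1 - s\<close>.\<close>
  also have "bern s (I - {a}) (J0 l a) \<le> bern s I (J l a) + 12 * b"
  proof -
    have "I = insert a (I - {a})" using a by auto
    then have "bern s I (J l a) = s * bern s (I - {a}) (\<lambda>S. J l a (insert a S)) + (1 - s) * bern s (I - {a}) (J l a)"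
      using bern_insert[OF fin, of a s "J l a"] by simp
    moreover have "bern s (I - {a}) (J0 l a) \<le> bern s (I - {a}) (\<lambda>S. J l a S + 12 * b)"
      using s by (intro bern_mono near)
    moreover have "bern s (I - {a}) (J0 l a) \<le> bern s (I - {a}) (\<lambda>S. J l a (insert a S) + 12 * b)"
      using s by (intro bern_mono near)
    ultimately have "s * (bern s (I - {a}) (J0 l a)) + (1 - s) * (bern s (I - {a}) (J0 l a)) \<le>
       s * (bern s (I - {a}) (\<lambda>S. J l a (insert a S)) + 12 * b) + (1 - s) * (bern s (I - {a}) (J l a) + 12 * b)"
      using s by (intro add_mono mult_left_mono) (simp_all only: bern_add bern_const[OF fin])
    then show ?thesis
      using \<open>bern s I (J l a) = _\<close> by (simp add: algebra_simps)
  qed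
  finally show ?thesis
    using b_pos by (simp add: power2_eq_square power3_eq_cube algebra_simps)
qed

text \<open>Sharing more couplings raises the free energy at rate at most \<open>b\<^sup>2\<close>
  times the mean of \<open>V\<close>, up to the remainder. Lowering the strength \<open>l\<close> at
  rate \<open>b\<^sup>2\<close> takes back exactly that.\<close>

lemma F_decrease:
  assumes s: "0 \<le> s" "s \<le> 1"
  shows "bern s I (F (l0 - b\<^sup>2 * s)) \<le> F l0 {} + 108 * card I * b ^ 3"
proof -
  let ?K = "108 * card I * b ^ 3"
  \<comment> \<open>Subtracting the accumulated remainder makes the interpolation genuinely
    nonincreasing.\<close>
  let ?G = "\<lambda>t. bern t I (\<lambda>S. F (l0 - b\<^sup>2 * t) S) - ?K * t"
  have "?G s \<le> ?G 0"
  proof (rule DERIV_nonpos_imp_nonincreasing[OF s(1)])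
    fix t assume t: "0 \<le> t" "t \<le> s"
    let ?l = "l0 - b\<^sup>2 * t"
    have dF: "((\<lambda>t. F (l0 - b\<^sup>2 * t) S) has_real_derivative VE ?l S * (- b\<^sup>2)) (at t)" for S
      by (rule DERIV_chain2[OF DERIV_F]) (auto intro!: derivative_eq_intros)
    have D: "((\<lambda>t. bern t I (\<lambda>S. F (l0 - b\<^sup>2 * t) S)) has_real_derivative
       bern t I (\<lambda>S. VE ?l S * (- b\<^sup>2)) + (\<Sum>a\<in>I. bern t (I - {a}) (\<lambda>S. F ?l (insert a S) - F ?l S))) (at t)"
      by (rule DERIV_bern[OF finI]) (rule dF)
    have "(\<Sum>a\<in>I. bern t (I - {a}) (\<lambda>S. F ?l (insert a S) - F ?l S))
       \<le> (\<Sum>a\<in>I. b\<^sup>2 * bern t I (J ?l a) + 108 * b ^ 3)"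
      using s t by (intro sum_mono russo_term_le) auto
    also have "\<dots> = b\<^sup>2 * bern t I (\<lambda>S. \<Sum>a\<in>I. J ?l a S) + ?K"
      by (simp add: sum.distrib bern_sum sum_distrib_left)
    also have "\<dots> \<le> b\<^sup>2 * bern t I (VE ?l) + ?K"
      using s t by (intro add_right_mono mult_left_mono bern_mono sum_J_le) auto
    finally have "bern t I (\<lambda>S. VE ?l S * (- b\<^sup>2)) + (\<Sum>a\<in>I. bern t (I - {a}) (\<lambda>S. F ?l (insert a S) - F ?l S)) - ?K \<le> 0"
      using bern_cmult[of t I "- b\<^sup>2" "VE ?l"] by (simp add: mult.commute)
    moreover have "(?G has_real_derivative
       bern t I (\<lambda>S. VE ?l S * (- b\<^sup>2)) + (\<Sum>a\<in>I. bern t (I - {a}) (\<lambda>S. F ?l (insert a S) - F ?l S)) - ?K) (at t)"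
      using DERIV_diff[OF D DERIV_cmult_Id[of ?K]] by simp
    ultimately show "\<exists>y. (?G has_real_derivative y) (at t) \<and> y \<le> 0" by blast
  qed
  moreover have "?K * s \<le> ?K * 1" using s b_pos by (intro mult_left_mono) auto
  ultimately show ?thesis by (simp add: bern_zero[OF finI])
qed

lemma ham_zero_prod: "ham 0 z = (\<lambda>k. b * field (fst z) (fst k) + b * field (snd z) (snd k))"
  by (simp add: ham_def fun_eq_iff)

abbreviation "gm x \<equiv> gibbs C (\<lambda>c. b * field x c)"

lemma gibbs_ham_zero: "gibbs (C \<times> C) (ham 0 z) k = gm (fst z) (fst k) * gm (snd z) (snd k)"
proof -
  have "(\<Sum>k\<in>C \<times> C. exp (ham 0 z k)) = (\<Sum>c\<in>C. exp (b * field (fst z) c)) * (\<Sum>c\<in>C. exp (b * field (snd z) c))"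
    unfolding ham_zero_prod sum_product sum.cartesian_product
    by (intro sum.cong refl) (auto simp: exp_add)
  then show ?thesis by (simp add: gibbs_def ham_zero_prod exp_add)
qed

lemma gavg_ham_zero:
  "gavg (C \<times> C) (ham 0 z) f = (\<Sum>c\<in>C. \<Sum>d\<in>C. gm (fst z) c * gm (snd z) d * f (c, d))"
  unfolding gavg_def gibbs_ham_zero sum.cartesian_product
  by (intro sum.cong refl) auto

lemma lse_ham_zero:
  "lse (C \<times> C) (ham 0 z) = lse C (\<lambda>c. b * field (fst z) c) + lse C (\<lambda>c. b * field (snd z) c)"
proof -
  have "(\<Sum>k\<in>C \<times> C. exp (ham 0 z k)) = (\<Sum>c\<in>C. exp (b * field (fst z) c)) * (\<Sum>c\<in>C. exp (b * field (snd z) c))"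
    unfolding ham_zero_prod sum_product sum.cartesian_product
    by (intro sum.cong refl) (auto simp: exp_add)
  then show ?thesis
    using Z_pos[of "\<lambda>c. b * field (fst z) c"] Z_pos[of "\<lambda>c. b * field (snd z) c"]
    by (simp add: lse_def ln_mult)
qed

lemma gm_measurable: "(\<lambda>x. gm x c) \<in> borel_measurable (gauss I)"
  unfolding gibbs_def
  by (intro borel_measurable_divide borel_measurable_sum measurable_compose[OF _ borel_measurable_exp]
      borel_measurable_times borel_measurable_const field_measurable)

lemma gm_le_1: "c \<in> C \<Longrightarrow> gm x c \<le> 1"
  using gibbs_sum[of "\<lambda>c. b * field x c"] gibbs_pos[of "\<lambda>c. b * field x c"] finC
    member_le_sum[of c C "gm x"] by (simp add: less_imp_le)

lemma lse_field_integrable: "integrable (gauss I) (\<lambda>x. lse C (\<lambda>c. b * field x c))"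
proof (rule Bochner_Integration.integrable_bound)
  interpret g: prob_space "gauss I" by (rule prob_space_gauss)
  let ?g = "\<lambda>x. ln (card C) + b * (\<Sum>a\<in>I. \<bar>x a\<bar>)"
  have "integrable (gauss I) (\<lambda>x. \<Sum>a\<in>I. \<bar>x a\<bar>)"
    by (intro Bochner_Integration.integrable_sum integrable_gauss_component integrable_stdn_abs)
  then show "integrable (gauss I) ?g" by simp
  show "(\<lambda>x. lse C (\<lambda>c. b * field x c)) \<in> borel_measurable (gauss I)"
    by (intro lse_measurable borel_measurable_times borel_measurable_const field_measurable)
  show "AE x in gauss I. norm (lse C (\<lambda>c. b * field x c)) \<le> norm (?g x)"
  proof (rule AE_I2)
    fix x
    have "\<bar>b * field x c\<bar> \<le> b * (\<Sum>a\<in>I. \<bar>x a\<bar>)" for c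
      unfolding abs_mult using b_pos abs_field_le by (intro mult_mono) auto
    from lse_abs_le[of "\<lambda>c. b * field x c", OF this] show "norm (lse C (\<lambda>c. b * field x c)) \<le> norm (?g x)" by simp
  qed
qed

text \<open>Without coupling the replicas separate, and each disorder by itself has the law of
  \<open>gauss I\<close>, however much is shared. Hence the value is the same for every
  \<open>S\<close>.\<close>

lemma F_zero: "F 0 S = 2 * (\<integral>x. lse C (\<lambda>c. b * field x c) \<partial>gauss I)"
  unfolding F_def lse_ham_zero
  using gauss2_fst[OF lse_field_integrable] gauss2_mix[OF finI lse_field_integrable, of S]
  by (simp add: part_def)

text \<open>A convex function lies above its tangent; at \<open>l = 0\<close> the slope is the mean
  of \<open>V\<close> for two uncoupled Gibbs samples.\<close>

lemma F_ge: "F l S \<ge> F 0 S + l * VE 0 S"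
proof -
  have eq: "ham l z = (\<lambda>k. ham 0 z k + l * V k)" for z by (simp add: ham_def fun_eq_iff)
  have "F 0 S + l * VE 0 S = (\<integral>z. lse (C \<times> C) (ham 0 (part S z)) + l * gavg (C \<times> C) (ham 0 (part S z)) V \<partial>gauss2 I)"
    unfolding F_def VE_def using lse_part_integrable[of 0 S] gavg_part_integrable[of V "card I" 0 S] V_bound by simp
  also have "\<dots> \<le> F l S"
    unfolding F_def
  proof (intro integral_mono)
    fix z show "lse (C \<times> C) (ham 0 (part S z)) + l * gavg (C \<times> C) (ham 0 (part S z)) V \<le> lse (C \<times> C) (ham l (part S z))"
      unfolding eq[of "part S z"] using P.lse_convex[of "ham 0 (part S z)" "\<lambda>k. l * V k"] by (simp only: P.gavg_cmult)
  qed (use lse_part_integrable[of 0 S] lse_part_integrable[of l S] gavg_part_integrable[of V "card I" 0 S] V_bound in simp_all)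
  finally show ?thesis .
qed

text \<open>Unnormalized expected covariance of Gibbs samples from two disorders which share each
  coupling with probability \<open>s\<close>.\<close>

definition phi :: "real \<Rightarrow> real" where
  "phi s = bern s I (VE 0)"

text \<open>The tangent inequality at strength 0 bounds \<open>l * phi s\<close> by a free energy
  difference, the interpolation moves this to independent disorders, and there \<open>unif\<close>
  turns it into an exponential moment under two uniform configurations.\<close>

theorem chaos_bound:
  assumes s: "0 \<le> s" "s \<le> 1" and l: "0 \<le> l"
    and unif: "\<And>c. c \<in> C \<Longrightarrow> (\<integral>x. gm x c \<partial>gauss I) = 1 / card C"
    and U: "(\<Sum>c\<in>C. \<Sum>d\<in>C. exp ((l + b\<^sup>2 * s) * V (c, d))) / (real (card C))\<^sup>2 \<le> U" "0 < U"
  shows "l * phi s \<le> ln U + 108 * card I * b ^ 3"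
proof -
  interpret g2: prob_space "gauss2 I" by (rule prob_space_gauss2)
  \<comment> \<open>The starting strength for which the interpolation ends at
    \<open>l\<close>.\<close>
  let ?l0 = "l + b\<^sup>2 * s"
  let ?A = "\<lambda>z. gavg (C \<times> C) (ham 0 (part {} z)) (\<lambda>k. exp (?l0 * V k))"
  have A_int: "integrable (gauss2 I) ?A"
  proof (rule gavg_part_integrable)
    fix k
    have "\<bar>?l0 * V k\<bar> \<le> \<bar>?l0\<bar> * card I" unfolding abs_mult using V_bound by (intro mult_left_mono) auto
    then show "\<bar>exp (?l0 * V k)\<bar> \<le> exp (\<bar>?l0\<bar> * card I)" by simp
  qed
  have gmi: "integrable (gauss I) (\<lambda>x. gm x c)" if "c \<in> C" for c
    using gm_measurable gm_le_1[OF that] gibbs_pos[of "\<lambda>c. b * field _ c", THEN less_imp_le]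
    by (intro integrable_gauss_bounded[of _ _ 1]) (auto simp: abs_of_nonneg)
  have "(\<integral>z. ?A z \<partial>gauss2 I)
     = (\<integral>z. (\<Sum>c\<in>C. \<Sum>d\<in>C. exp (?l0 * V (c, d)) * (gm (fst z) c * gm (snd z) d)) \<partial>gauss2 I)"
    unfolding gavg_ham_zero by (simp add: part_def mix_def mult_ac)
  also have "\<dots> = (\<Sum>c\<in>C. \<Sum>d\<in>C. exp (?l0 * V (c, d)) * (1 / card C * (1 / card C)))"
    by (simp add: gauss2_prod[OF gmi gmi] unif)
  also have "\<dots> \<le> U" using U(1) by (simp add: sum_divide_distrib power2_eq_square)
  finally have A_le: "(\<integral>z. ?A z \<partial>gauss2 I) \<le> U" .
  \<comment> \<open>Jensen for the logarithm, by its tangent at \<open>U\<close>, so that only the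
    expectation of \<open>?A\<close> enters.\<close>
  have pt: "lse (C \<times> C) (ham ?l0 (part {} z)) - lse (C \<times> C) (ham 0 (part {} z)) \<le> ln U - 1 + (1 / U) * ?A z" for z
  proof -
    have eq: "ham ?l0 (part {} z) k = ham 0 (part {} z) k + ?l0 * V k" for k by (simp add: ham_def)
    have Zeq: "(\<Sum>k\<in>C\<times>C. exp (?l0 * V k) * exp (ham 0 (part {} z) k)) = (\<Sum>k\<in>C\<times>C. exp (ham ?l0 (part {} z) k))"
      by (intro sum.cong refl) (simp only: eq exp_add, rule mult.commute)
    have "lse (C \<times> C) (ham ?l0 (part {} z)) - lse (C \<times> C) (ham 0 (part {} z)) = ln (?A z)"
      unfolding lse_def P.gavg_alt Zeq using P.Z_pos[of "ham ?l0 (part {} z)"] P.Z_pos[of "ham 0 (part {} z)"]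
      by (simp add: ln_div)
    moreover have "?A z > 0"
    proof -
      have "?A z = (\<Sum>k\<in>C\<times>C. exp (?l0 * V k) * exp (ham 0 (part {} z) k)) / (\<Sum>k\<in>C\<times>C. exp (ham 0 (part {} z) k))"
        by (rule P.gavg_alt)
      also have "\<dots> > 0" using finC neC P.Z_pos[of "ham 0 (part {} z)"] by (intro divide_pos_pos sum_pos) auto
      finally show ?thesis .
    qed
    then have "ln (?A z / U) \<le> ?A z / U - 1" using U(2) by (intro ln_le_minus_one) simp
    moreover have "ln (?A z / U) = ln (?A z) - ln U" using \<open>?A z > 0\<close> U(2) by (simp add: ln_div)
    ultimately show ?thesis by simp
  qed
  have "F ?l0 {} - F 0 {} = (\<integral>z. lse (C \<times> C) (ham ?l0 (part {} z)) - lse (C \<times> C) (ham 0 (part {} z)) \<partial>gauss2 I)"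
    unfolding F_def by (simp add: lse_part_integrable)
  also have "\<dots> \<le> (\<integral>z. ln U - 1 + (1 / U) * ?A z \<partial>gauss2 I)"
    using A_int by (intro integral_mono pt Bochner_Integration.integrable_diff lse_part_integrable) auto
  also have "\<dots> = ln U - 1 + (1 / U) * (\<integral>z. ?A z \<partial>gauss2 I)"
    using A_int by (simp add: g2.prob_space)
  also have "\<dots> \<le> ln U" using A_le U(2) by (simp add: field_simps)
  finally have 1: "F ?l0 {} - F 0 {} \<le> ln U" .
  have "F 0 {} + l * phi s = bern s I (\<lambda>S. F 0 S + l * VE 0 S)"
    using F_zero by (simp add: bern_add bern_cmult phi_def finI)
  also have "\<dots> \<le> bern s I (F l)" using s F_ge by (intro bern_mono) auto
  also have "\<dots> = bern s I (F (?l0 - b\<^sup>2 * s))" by simp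
  also have "\<dots> \<le> F ?l0 {} + 108 * card I * b ^ 3" by (rule F_decrease[OF s])
  finally show ?thesis using 1 by simp
qed

end

section \<open>Noise operators on finite sums, and expected maxima\<close>

lemma noise_sum:
  assumes I: "finite I" and K: "finite K"
    and f: "\<And>k. k \<in> K \<Longrightarrow> f k \<in> borel_measurable (gauss I)" "\<And>k x. k \<in> K \<Longrightarrow> \<bar>f k x\<bar> \<le> B"
    and x: "x \<in> space (gauss I)"
  shows "noise r I (\<lambda>x. \<Sum>k\<in>K. f k x * w k) x = (\<Sum>k\<in>K. noise r I (f k) x * w k)"
proof -
  have i: "integrable (gauss I) (\<lambda>y. f k (mix S x y))" if "k \<in> K" for k S
    by (rule integrable_gauss_bounded[OF f_mix_y_measurable[OF I f(1)[OF that] f(2)[OF that] x] f(2)[OF that]])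
  have "cavg I S (\<lambda>x. \<Sum>k\<in>K. f k x * w k) x = (\<Sum>k\<in>K. w k * cavg I S (f k) x)" for S
    unfolding cavg_def using i by (subst Bochner_Integration.integral_sum) (auto simp: mult.commute)
  then show ?thesis unfolding noise_def by (simp add: bern_sum bern_cmult mult.commute)
qed

text \<open>A version of \<open>cavg_pairing\<close> for unbounded \<open>g\<close>: the energy gap
  below the maximum is merely integrable.\<close>

lemma cavg_pairing_integrable:
  assumes I: "finite I" and f: "f \<in> borel_measurable (gauss I)" "\<And>x. \<bar>f x\<bar> \<le> B"
    and g: "integrable (gauss I) g"
  shows "integrable (gauss2 I) (\<lambda>z. g (fst z) * f (mix S (fst z) (snd z)))"
    and "(\<integral>x. g x * cavg I S f x \<partial>gauss I) = (\<integral>z. g (fst z) * f (mix S (fst z) (snd z)) \<partial>gauss2 I)"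
    and "integrable (gauss I) (\<lambda>x. g x * cavg I S f x)"
proof -
  have B0: "0 \<le> B" using f(2)[of undefined] by linarith
  show int: "integrable (gauss2 I) (\<lambda>z. g (fst z) * f (mix S (fst z) (snd z)))"
  proof (rule Bochner_Integration.integrable_bound)
    show "integrable (gauss2 I) (\<lambda>z. g (fst z) * B)"
      using gauss2_fst(1)[OF g] by simp
    show "(\<lambda>z. g (fst z) * f (mix S (fst z) (snd z))) \<in> borel_measurable (gauss2 I)"
      by (intro borel_measurable_times borel_measurable_integrable[OF gauss2_fst(1)[OF g]] f_mix_measurable[OF I f])
    show "AE z in gauss2 I. norm (g (fst z) * f (mix S (fst z) (snd z))) \<le> norm (g (fst z) * B)"
      using f(2) B0 by (intro AE_I2) (simp add: abs_mult mult_left_mono)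
  qed
  show "(\<integral>x. g x * cavg I S f x \<partial>gauss I) = (\<integral>z. g (fst z) * f (mix S (fst z) (snd z)) \<partial>gauss2 I)"
    unfolding integral_gauss2(1)[OF int] by (simp add: cavg_def)
  show "integrable (gauss I) (\<lambda>x. g x * cavg I S f x)"
  proof (rule Bochner_Integration.integrable_bound)
    show "integrable (gauss I) (\<lambda>x. g x * B)" using g by simp
    show "(\<lambda>x. g x * cavg I S f x) \<in> borel_measurable (gauss I)"
      by (intro borel_measurable_times borel_measurable_integrable[OF g] cavg_measurable[OF I f])
    show "AE x in gauss I. norm (g x * cavg I S f x) \<le> norm (g x * B)"
      using cavg_bound[OF I f, of S] B0 by (intro AE_I2) (simp add: abs_mult mult_left_mono)
  qed
qed

text \<open>The maximal inequality from exponential moments. Stated for any \<open>G\<close>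
  dominated at each point by some \<open>D c\<close>, so that maxima of absolute values are covered
  as well.\<close>

lemma integral_Max_le:
  fixes D :: "'c \<Rightarrow> 'w \<Rightarrow> real"
  assumes M: "prob_space M" and C: "finite C" "C \<noteq> {}" and t: "t > 0"
    and int: "\<And>c. c \<in> C \<Longrightarrow> integrable M (\<lambda>w. exp (t * D c w))"
    and le: "\<And>c. c \<in> C \<Longrightarrow> (\<integral>w. exp (t * D c w) \<partial>M) \<le> exp A"
    and G: "integrable M G" "\<And>w. w \<in> space M \<Longrightarrow> \<exists>c\<in>C. G w \<le> D c w"
  shows "(\<integral>w. G w \<partial>M) \<le> (ln (card C) + A) / t"
proof -
  interpret prob_space M by fact
  have n: "real (card C) > 0" using C by (simp add: card_gt_0_iff)
  let ?U = "card C * exp A"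
  have U: "?U > 0" using n by simp
  let ?s = "\<lambda>w. \<Sum>c\<in>C. exp (t * D c w)"
  have pt: "t * G w \<le> ln ?U - 1 + ?s w / ?U" if w: "w \<in> space M" for w
  proof -
    obtain c where c: "c \<in> C" "G w \<le> D c w" using G(2)[OF w] by auto
    have "exp (t * G w) \<le> exp (t * D c w)" using c t by simp
    also have "\<dots> \<le> ?s w" using C c by (intro member_le_sum) auto
    finally have "exp (t * G w) / ?U \<le> ?s w / ?U" using U by (intro divide_right_mono) auto
    moreover have "ln (exp (t * G w) / ?U) \<le> exp (t * G w) / ?U - 1"
      using U by (intro ln_le_minus_one divide_pos_pos) auto
    moreover have "ln (exp (t * G w) / ?U) = t * G w - ln ?U"
      using U by (subst ln_div) auto
    ultimately show ?thesis by linarith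
  qed
  have si: "integrable M ?s" using int by (intro Bochner_Integration.integrable_sum)
  have "t * (\<integral>w. G w \<partial>M) = (\<integral>w. t * G w \<partial>M)" by simp
  also have "\<dots> \<le> (\<integral>w. ln ?U - 1 + ?s w / ?U \<partial>M)"
    using G(1) si pt by (intro integral_mono) auto
  also have "\<dots> = ln ?U - 1 + (\<Sum>c\<in>C. \<integral>w. exp (t * D c w) \<partial>M) / ?U"
    using si int by (simp add: prob_space)
  also have "\<dots> \<le> ln ?U - 1 + (\<Sum>c\<in>C. exp A) / ?U"
    using le U by (intro add_left_mono divide_right_mono sum_mono) auto
  also have "\<dots> = ln ?U" using n by simp
  also have "\<dots> = ln (card C) + A" using n by (subst ln_mult_pos) auto
  finally show ?thesis using t by (simp add: field_simps)
qed

lemma gauss_exp_linear: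
  assumes "finite I"
  shows "integrable (gauss I) (\<lambda>x. exp (\<Sum>a\<in>I. x a * w a))"
    and "(\<integral>x. exp (\<Sum>a\<in>I. x a * w a) \<partial>gauss I) = exp (\<Sum>a\<in>I. (w a)\<^sup>2 / 2)"
proof -
  interpret P: product_sigma_finite "\<lambda>_::'a. stdn" by (rule product_sigma_finite_stdn)
  have e: "exp (\<Sum>a\<in>I. x a * w a) = (\<Prod>a\<in>I. exp (w a * x a))" for x
    using assms by (simp add: exp_sum mult.commute)
  show "integrable (gauss I) (\<lambda>x. exp (\<Sum>a\<in>I. x a * w a))"
    unfolding e gauss_def by (intro P.product_integrable_prod assms integrable_stdn_exp)
  show "(\<integral>x. exp (\<Sum>a\<in>I. x a * w a) \<partial>gauss I) = exp (\<Sum>a\<in>I. (w a)\<^sup>2 / 2)"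
    unfolding e gauss_def using P.product_integral_prod[OF assms, of "\<lambda>a t. exp (w a * t)"]
    by (simp add: integrable_stdn_exp integral_stdn_exp exp_sum assms)
qed

section \<open>The sampling measure: overlap of two samples and energy gap\<close>

context chaos begin

text \<open>Given the disorder \<open>x\<close>, the law of a Gibbs sample drawn after each coupling
  has been resampled with probability \<open>1 - r\<close>.\<close>

definition nu :: "real \<Rightarrow> ('i \<Rightarrow> real) \<Rightarrow> 'c \<Rightarrow> real" where
  "nu r x c = noise r I (\<lambda>x. gm x c) x"

lemma gm_nonneg: "0 \<le> gm x c"
  by (rule less_imp_le[OF gibbs_pos])

lemma gm_abs_le: "c \<in> C \<Longrightarrow> \<bar>gm x c\<bar> \<le> 1"
  using gm_le_1[of c x] gm_nonneg[of x c] by simp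

lemma gm_integrable: "c \<in> C \<Longrightarrow> integrable (gauss I) (\<lambda>x. gm x c)"
  by (intro integrable_gauss_bounded[of _ _ 1] gm_measurable gm_abs_le)

lemma nu_measurable: "c \<in> C \<Longrightarrow> (\<lambda>x. nu r x c) \<in> borel_measurable (gauss I)"
  unfolding nu_def by (rule noise_measurable[OF finI gm_measurable gm_abs_le])

lemma nu_nonneg: "0 \<le> r \<Longrightarrow> r \<le> 1 \<Longrightarrow> 0 \<le> nu r x c"
  unfolding nu_def noise_def bern_def cavg_def
  by (intro sum_nonneg mult_nonneg_nonneg Bochner_Integration.integral_nonneg gm_nonneg) auto

lemma nu_sum:
  assumes "x \<in> space (gauss I)"
  shows "(\<Sum>c\<in>C. nu r x c) = 1"
proof -
  interpret g: prob_space "gauss I" by (rule prob_space_gauss)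
  have "(\<Sum>c\<in>C. nu r x c) = noise r I (\<lambda>x. \<Sum>c\<in>C. gm x c * 1) x"
    unfolding nu_def by (subst noise_sum[OF finI finC gm_measurable gm_abs_le assms]) auto
  also have "\<dots> = 1"
    unfolding noise_def cavg_def by (simp add: gibbs_sum g.prob_space finI)
  finally show ?thesis .
qed

lemma nu_le_1: "x \<in> space (gauss I) \<Longrightarrow> c \<in> C \<Longrightarrow> 0 \<le> r \<Longrightarrow> r \<le> 1 \<Longrightarrow> nu r x c \<le> 1"
  using nu_sum[of x r] member_le_sum[of c C "nu r x"] nu_nonneg[of r x] finC by simp

text \<open>The local magnetization: the Gibbs average of feature \<open>a\<close>.\<close>

definition mag :: "'i \<Rightarrow> ('i \<Rightarrow> real) \<Rightarrow> real" where
  "mag a x = (\<Sum>c\<in>C. gm x c * e a c)"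

lemma mag_measurable: "mag a \<in> borel_measurable (gauss I)"
  unfolding mag_def[abs_def]
  by (intro borel_measurable_sum borel_measurable_times gm_measurable borel_measurable_const)

lemma mag_bound: "\<bar>mag a x\<bar> \<le> 1"
  unfolding mag_def gavg_def[symmetric] by (intro gavg_abs_le e_bound)

lemma noise_mag:
  assumes "x \<in> space (gauss I)"
  shows "noise r I (mag a) x = (\<Sum>c\<in>C. nu r x c * e a c)"
  unfolding mag_def[abs_def] nu_def by (rule noise_sum[OF finI finC gm_measurable gm_abs_le assms])

lemma gavg_V_eq: "gavg (C \<times> C) (ham 0 z) V = (\<Sum>a\<in>I. mag a (fst z) * mag a (snd z))"
proof -
  have "gavg (C \<times> C) (ham 0 z) V = (\<Sum>c\<in>C. \<Sum>d\<in>C. \<Sum>a\<in>I. (gm (fst z) c * e a c) * (gm (snd z) d * e a d))"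
    unfolding gavg_ham_zero V_def sum_distrib_left by (simp add: mult_ac)
  also have "\<dots> = (\<Sum>a\<in>I. \<Sum>c\<in>C. \<Sum>d\<in>C. (gm (fst z) c * e a c) * (gm (snd z) d * e a d))"
    by (subst sum.swap, subst (2) sum.swap, intro sum.cong refl)
  finally show ?thesis unfolding mag_def sum_product .
qed

text \<open>Without coupling the pair average of \<open>V\<close> splits into products of
  magnetizations, so \<open>phi\<close> inherits the stability inequalities.\<close>

lemma phi_eq: "phi s = (\<Sum>a\<in>I. stab s I (mag a))"
proof -
  have i: "integrable (gauss2 I) (\<lambda>z. mag a (fst z) * mag a (mix S (fst z) (snd z)))" for a S
    using cavg_pairing_integrable(1)[OF finI mag_measurable mag_bound, of "mag a" a S]
      integrable_gauss_bounded[OF mag_measurable mag_bound] by blast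
  have "VE 0 = (\<lambda>S. \<Sum>a\<in>I. \<integral>x. mag a x * cavg I S (mag a) x \<partial>gauss I)"
    unfolding VE_def gavg_V_eq part_def
    by (rule ext) (simp add: i cavg_pairing[OF finI mag_measurable mag_bound mag_measurable mag_bound])
  then show ?thesis unfolding phi_def stab_def by (simp add: bern_sum)
qed

text \<open>Two samples given the same \<open>x\<close> come from independent resamplings of it, so
  their disorders have correlation \<open>r\<^sup>2\<close>.\<close>

lemma nu_pair_V:
  assumes r: "0 \<le> r" "r \<le> 1"
  shows "(\<integral>x. (\<Sum>c\<in>C. \<Sum>d\<in>C. nu r x c * nu r x d * V (c, d)) \<partial>gauss I) = phi (r\<^sup>2)"
proof -
  have sq: "integrable (gauss I) (\<lambda>x. (noise r I (mag a) x)\<^sup>2)" for a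
  proof (rule integrable_gauss_bounded)
    show "(\<lambda>x. (noise r I (mag a) x)\<^sup>2) \<in> borel_measurable (gauss I)"
      by (intro borel_measurable_power noise_measurable[OF finI mag_measurable mag_bound])
    show "\<bar>(noise r I (mag a) x)\<^sup>2\<bar> \<le> 1" for x
      using noise_bound[OF finI mag_measurable mag_bound r, of a x] by (simp add: abs_square_le_1)
  qed
  have "(\<integral>x. (\<Sum>c\<in>C. \<Sum>d\<in>C. nu r x c * nu r x d * V (c, d)) \<partial>gauss I)
     = (\<integral>x. (\<Sum>a\<in>I. (noise r I (mag a) x)\<^sup>2) \<partial>gauss I)"
  proof (intro Bochner_Integration.integral_cong refl)
    fix x assume x: "x \<in> space (gauss I)"
    have "(\<Sum>c\<in>C. \<Sum>d\<in>C. nu r x c * nu r x d * V (c, d))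
       = (\<Sum>c\<in>C. \<Sum>d\<in>C. \<Sum>a\<in>I. (nu r x c * e a c) * (nu r x d * e a d))"
      unfolding V_def sum_distrib_left by (simp add: mult_ac)
    also have "\<dots> = (\<Sum>a\<in>I. \<Sum>c\<in>C. \<Sum>d\<in>C. (nu r x c * e a c) * (nu r x d * e a d))"
      by (subst sum.swap, subst (2) sum.swap, intro sum.cong refl)
    finally show "(\<Sum>c\<in>C. \<Sum>d\<in>C. nu r x c * nu r x d * V (c, d)) = (\<Sum>a\<in>I. (noise r I (mag a) x)\<^sup>2)"
      unfolding noise_mag[OF x] power2_eq_square sum_product .
  qed
  also have "\<dots> = (\<Sum>a\<in>I. stab (r\<^sup>2) I (mag a))"
    using sq by (simp add: noise_sq[OF finI mag_measurable mag_bound])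
  finally show ?thesis unfolding phi_eq .
qed

lemma phi_nonneg: "0 \<le> s \<Longrightarrow> s \<le> 1 \<Longrightarrow> 0 \<le> phi s"
  unfolding phi_def bern_def VE_def
  by (intro sum_nonneg mult_nonneg_nonneg Bochner_Integration.integral_nonneg P.gavg_nonneg V_pos) auto

text \<open>Cauchy-Schwarz over the index \<open>a\<close>, followed by \<open>stab_sq_le\<close>
  for each magnetization.\<close>

lemma phi_sq_le:
  assumes r: "0 \<le> r" "r \<le> 1"
  shows "(phi r)\<^sup>2 \<le> card I * phi (r\<^sup>2)"
proof -
  have "(phi r)\<^sup>2 = (\<Sum>a\<in>I. stab r I (mag a) * 1)\<^sup>2" by (simp add: phi_eq)
  also have "\<dots> \<le> (\<Sum>a\<in>I. (stab r I (mag a))\<^sup>2) * (\<Sum>a\<in>I. 1\<^sup>2)" by (rule Cauchy_Schwarz_ineq_sum)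
  also have "\<dots> \<le> (\<Sum>a\<in>I. stab (r\<^sup>2) I (mag a)) * card I"
    using stab_sq_le[OF finI mag_measurable mag_bound r] order_trans[OF zero_le_power2 stab_sq_le[OF finI mag_measurable mag_bound r]]
    by (intro mult_mono sum_mono sum_nonneg) auto
  finally show ?thesis by (simp add: phi_eq mult.commute)
qed

text \<open>The squaring step iterated \<open>k\<close> times after normalization: a small stability
  at \<open>r ^ (2 ^ k)\<close> forces a small one at \<open>r\<close>.\<close>

lemma phi_power_le:
  assumes "0 \<le> r" "r \<le> 1"
  shows "(phi r / card I) ^ (2 ^ k) \<le> phi (r ^ (2 ^ k)) / card I"
  using assms
proof (induction k arbitrary: r)
  case (Suc k)
  have r2: "0 \<le> r\<^sup>2" "r\<^sup>2 \<le> 1" using Suc.prems by (auto simp: power_le_one)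
  have "(phi r / card I)\<^sup>2 \<le> phi (r\<^sup>2) / card I"
  proof (cases "card I = 0")
    case False
    then have "(phi r / card I)\<^sup>2 = (phi r)\<^sup>2 / (real (card I) * card I)" by (simp add: power_divide power2_eq_square)
    also have "\<dots> \<le> (card I * phi (r\<^sup>2)) / (real (card I) * card I)"
      using phi_sq_le[OF Suc.prems] by (intro divide_right_mono) auto
    finally show ?thesis using False by simp
  qed simp
  then have "((phi r / card I)\<^sup>2) ^ (2 ^ k) \<le> (phi (r\<^sup>2) / card I) ^ (2 ^ k)"
    by (intro power_mono) auto
  also have "\<dots> \<le> phi ((r\<^sup>2) ^ (2 ^ k)) / card I" by (rule Suc.IH[OF r2])
  finally show ?case by (simp add: power_mult[symmetric])
qed simp

definition top_field :: "('i \<Rightarrow> real) \<Rightarrow> real" where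
  "top_field x = Max (field x ` C)"

lemma top_field_ge: "c \<in> C \<Longrightarrow> field x c \<le> top_field x"
  unfolding top_field_def using finC by simp

lemma top_field_attained: "\<exists>c\<in>C. top_field x = field x c"
proof -
  have "Max (field x ` C) \<in> field x ` C" using finC neC by (intro Max_in) auto
  then show ?thesis unfolding top_field_def by (rule imageE) blast
qed

lemma top_field_measurable: "top_field \<in> borel_measurable (gauss I)"
  unfolding top_field_def[abs_def] using finC by (rule borel_measurable_Max) (rule field_measurable)

lemma field_integrable: "integrable (gauss I) (\<lambda>x. field x c)"
  unfolding field_def
  by (intro Bochner_Integration.integrable_sum integrable_mult_left integrable_gauss_component integrable_stdn_id)

lemma sum_abs_integrable: "integrable (gauss I) (\<lambda>x. \<Sum>a\<in>I. \<bar>x a\<bar>)"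
  by (intro Bochner_Integration.integrable_sum integrable_gauss_component integrable_stdn_abs)

lemma top_field_abs_le: "\<bar>top_field x\<bar> \<le> (\<Sum>a\<in>I. \<bar>x a\<bar>)"
  using top_field_attained[of x] abs_field_le by auto

lemma top_field_integrable: "integrable (gauss I) top_field"
  by (rule Bochner_Integration.integrable_bound[OF sum_abs_integrable top_field_measurable])
     (use top_field_abs_le in \<open>auto intro!: AE_I2 simp: order_trans[OF _ abs_ge_self]\<close>)

lemma field_exp:
  "integrable (gauss I) (\<lambda>x. exp (t * field x c))"
  "(\<integral>x. exp (t * field x c) \<partial>gauss I) \<le> exp (t\<^sup>2 * (\<Sum>a\<in>I. (e a c)\<^sup>2) / 2)"
proof -
  have eq: "t * field x c = (\<Sum>a\<in>I. x a * (t * e a c))" for x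
    by (simp add: field_def sum_distrib_left mult_ac)
  show "integrable (gauss I) (\<lambda>x. exp (t * field x c))"
    unfolding eq by (rule gauss_exp_linear(1)[OF finI])
  show "(\<integral>x. exp (t * field x c) \<partial>gauss I) \<le> exp (t\<^sup>2 * (\<Sum>a\<in>I. (e a c)\<^sup>2) / 2)"
    unfolding eq gauss_exp_linear(2)[OF finI]
    by (simp add: power_mult_distrib sum_distrib_left sum_divide_distrib)
qed

text \<open>The change of the field is Gaussian with variance at most
  \<open>2 * card (I - S)\<close>.\<close>

lemma resample_exp:
  "integrable (gauss2 I) (\<lambda>z. exp (t * (field (fst z) c - field (mix S (fst z) (snd z)) c)))"
  "(\<integral>z. exp (t * (field (fst z) c - field (mix S (fst z) (snd z)) c)) \<partial>gauss2 I) \<le> exp (t\<^sup>2 * card (I - S))"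
proof -
  let ?w = "\<lambda>a. if a \<in> S then 0 else t * e a c"
  have eq: "exp (t * (field (fst z) c - field (mix S (fst z) (snd z)) c))
     = exp (\<Sum>a\<in>I. fst z a * ?w a) * exp (\<Sum>a\<in>I. snd z a * (- ?w a))" for z
  proof -
    have "t * (field (fst z) c - field (mix S (fst z) (snd z)) c)
      = (\<Sum>a\<in>I. fst z a * ?w a) + (\<Sum>a\<in>I. snd z a * (- ?w a))"
      unfolding field_def sum_subtractf[symmetric] sum_distrib_left sum.distrib[symmetric]
      by (intro sum.cong refl) (auto simp: mix_def algebra_simps)
    then show ?thesis by (simp add: exp_add)
  qed
  note g = gauss_exp_linear[OF finI]
  show "integrable (gauss2 I) (\<lambda>z. exp (t * (field (fst z) c - field (mix S (fst z) (snd z)) c)))"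
    unfolding eq by (rule gauss2_prod(1)[OF g(1) g(1)])
  have "(\<Sum>a\<in>I. (?w a)\<^sup>2) \<le> (\<Sum>a\<in>I. if a \<in> I - S then t\<^sup>2 else 0)"
    using e_bound by (intro sum_mono) (auto simp: power_mult_distrib abs_square_le_1 mult_left_le)
  also have "\<dots> = (\<Sum>a\<in>I - S. t\<^sup>2)"
    using finI by (intro sum.mono_neutral_cong_right) auto
  also have "\<dots> = t\<^sup>2 * card (I - S)" by simp
  finally show "(\<integral>z. exp (t * (field (fst z) c - field (mix S (fst z) (snd z)) c)) \<partial>gauss2 I) \<le> exp (t\<^sup>2 * card (I - S))"
    unfolding eq unfolding gauss2_prod(2)[OF g(1) g(1)] unfolding g(2) mult_exp_exp
    by (simp add: sum_divide_distrib[symmetric])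
qed

text \<open>Passing from \<open>x\<close> to \<open>y\<close> costs the largest field change twice,
  once at the maximizer and once at the sampled point; in \<open>y\<close> the Gibbs measure is
  within \<open>ln (card C) / b\<close> of the maximum.\<close>

lemma gibbs_gap_pointwise:
  "(\<Sum>c\<in>C. (top_field x - field x c) * gm y c)
     \<le> ln (card C) / b + 2 * Max ((\<lambda>c. \<bar>field x c - field y c\<bar>) ` C)"
proof -
  let ?D = "Max ((\<lambda>c. \<bar>field x c - field y c\<bar>) ` C)"
  have D: "\<bar>field x c - field y c\<bar> \<le> ?D" if "c \<in> C" for c using that finC by simp
  obtain c0 where c0: "c0 \<in> C" "top_field x = field x c0" using top_field_attained[of x] by auto
  have "(\<Sum>c\<in>C. (top_field x - field x c) * gm y c) = gavg C (\<lambda>c. b * field y c) (\<lambda>c. top_field x - field x c)"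
    unfolding gavg_def by (simp add: mult.commute)
  also have "\<dots> \<le> gavg C (\<lambda>c. b * field y c) (\<lambda>c. (field y c0 + 2 * ?D) - field y c)"
    using D[OF c0(1)] c0(2) D by (intro gavg_mono) (fastforce simp: abs_le_iff)
  also have "\<dots> = field y c0 + 2 * ?D - gavg C (\<lambda>c. b * field y c) (field y)"
    by (simp add: gavg_diff)
  also have "\<dots> \<le> ln (card C) / b + 2 * ?D"
    using gavg_ge_Max[OF b_pos c0(1), of "field y"] by simp
  finally show ?thesis .
qed

text \<open>The sample is near optimal for the resampled disorder, and resampling changes all fields
  uniformly little. The parameter \<open>t\<close> of the exponential moment is left free and
  optimized later.\<close>

theorem gap_bound:
  fixes r t :: real
  assumes r: "0 \<le> r" "r \<le> 1" and t: "t > 0"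
  shows "integrable (gauss I) (\<lambda>x. \<Sum>c\<in>C. nu r x c * (top_field x - field x c))"
    and "(\<integral>x. (\<Sum>c\<in>C. nu r x c * (top_field x - field x c)) \<partial>gauss I)
      \<le> ln (card C) / b + 2 * ((ln (2 * card C) + t\<^sup>2 * ((1 - r) * card I)) / t)"
proof -
  interpret g2: prob_space "gauss2 I" by (rule prob_space_gauss2)
  let ?g = "\<lambda>c x. top_field x - field x c"
  have gi: "integrable (gauss I) (?g c)" for c
    by (intro Bochner_Integration.integrable_diff top_field_integrable field_integrable)
  note pr = cavg_pairing_integrable[OF finI gm_measurable gm_abs_le gi]
  have nu_eq: "(\<Sum>c\<in>C. nu r x c * ?g c x) = bern r I (\<lambda>S. \<Sum>c\<in>C. ?g c x * cavg I S (\<lambda>x. gm x c) x)" for x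
    unfolding bern_sum bern_cmult nu_def noise_def by (simp add: mult.commute)
  have i: "integrable (gauss I) (\<lambda>x. \<Sum>c\<in>C. ?g c x * cavg I S (\<lambda>x. gm x c) x)" for S
    by (intro Bochner_Integration.integrable_sum pr(3))
  show "integrable (gauss I) (\<lambda>x. \<Sum>c\<in>C. nu r x c * ?g c x)"
    unfolding nu_eq by (rule integral_bern(2)) (rule i)
  have Sbound: "(\<integral>x. (\<Sum>c\<in>C. ?g c x * cavg I S (\<lambda>x. gm x c) x) \<partial>gauss I)
     \<le> ln (card C) / b + 2 * ((ln (2 * card C) + t\<^sup>2 * card (I - S)) / t)" for S
  proof -
    let ?y = "\<lambda>z. mix S (fst z) (snd z)"
    let ?D = "\<lambda>z. Max ((\<lambda>c. \<bar>field (fst z) c - field (?y z) c\<bar>) ` C)"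
    have fm: "(\<lambda>z. field (fst z) c) \<in> borel_measurable (gauss2 I)"
       "(\<lambda>z. field (?y z) c) \<in> borel_measurable (gauss2 I)" for c
      by (rule measurable_compose[OF measurable_fst_gauss2 field_measurable],
          rule measurable_compose[OF measurable_mix field_measurable])
    have Dm: "?D \<in> borel_measurable (gauss2 I)"
      using finC by (rule borel_measurable_Max) (intro borel_measurable_abs borel_measurable_diff fm)
    have Dat: "\<exists>c\<in>C. ?D z = \<bar>field (fst z) c - field (?y z) c\<bar>" for z
    proof -
      have "?D z \<in> (\<lambda>c. \<bar>field (fst z) c - field (?y z) c\<bar>) ` C" using finC neC by (intro Max_in) auto
      then show ?thesis by (rule imageE) blast
    qed
    have Di: "integrable (gauss2 I) ?D"
    proof (rule Bochner_Integration.integrable_bound[OF _ Dm])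
      show "integrable (gauss2 I) (\<lambda>z. (\<Sum>a\<in>I. \<bar>fst z a\<bar>) + (\<Sum>a\<in>I. \<bar>?y z a\<bar>))"
        by (intro Bochner_Integration.integrable_add gauss2_fst(1)[OF sum_abs_integrable] gauss2_mix(1)[OF finI sum_abs_integrable])
      show "AE z in gauss2 I. norm (?D z) \<le> norm ((\<Sum>a\<in>I. \<bar>fst z a\<bar>) + (\<Sum>a\<in>I. \<bar>?y z a\<bar>))"
      proof (rule AE_I2)
        fix z
        obtain c where "c \<in> C" "?D z = \<bar>field (fst z) c - field (?y z) c\<bar>" using Dat by blast
        then show "norm (?D z) \<le> norm ((\<Sum>a\<in>I. \<bar>fst z a\<bar>) + (\<Sum>a\<in>I. \<bar>?y z a\<bar>))"
          using abs_field_le[of "fst z" c] abs_field_le[of "?y z" c] by simp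
      qed
    qed
    \<comment> \<open>Configurations are paired with a sign to dominate an absolute value, which
      doubles the index set.\<close>
    have ED: "(\<integral>z. ?D z \<partial>gauss2 I) \<le> (ln (card (C \<times> {1, -1 :: real})) + t\<^sup>2 * card (I - S)) / t"
    proof (rule integral_Max_le[where D = "\<lambda>k z. snd k * (field (fst z) (fst k) - field (?y z) (fst k))"])
      fix k assume k: "k \<in> C \<times> {1, -1 :: real}"
      have e: "t * (snd k * (field (fst z) (fst k) - field (?y z) (fst k)))
        = (t * snd k) * (field (fst z) (fst k) - field (?y z) (fst k))" for z by simp
      have sq: "(t * snd k)\<^sup>2 = t\<^sup>2" using k by (auto simp: power_mult_distrib)
      show "integrable (gauss2 I) (\<lambda>z. exp (t * (snd k * (field (fst z) (fst k) - field (?y z) (fst k)))))"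
        unfolding e by (rule resample_exp)
      show "(\<integral>z. exp (t * (snd k * (field (fst z) (fst k) - field (?y z) (fst k)))) \<partial>gauss2 I) \<le> exp (t\<^sup>2 * card (I - S))"
        unfolding e using resample_exp(2)[of "t * snd k" "fst k" S] unfolding sq .
    next
      fix z
      obtain c where c: "c \<in> C" "?D z = \<bar>field (fst z) c - field (?y z) c\<bar>" using Dat by blast
      show "\<exists>k\<in>C \<times> {1, - 1}. ?D z \<le> snd k * (field (fst z) (fst k) - field (?y z) (fst k))"
        using c by (intro bexI[of _ "(c, if field (fst z) c \<ge> field (?y z) c then 1 else -1)"]) auto
    qed (use finC neC t Di prob_space_gauss2 in auto)
    have "(\<integral>x. (\<Sum>c\<in>C. ?g c x * cavg I S (\<lambda>x. gm x c) x) \<partial>gauss I)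
       = (\<integral>z. (\<Sum>c\<in>C. ?g c (fst z) * gm (?y z) c) \<partial>gauss2 I)"
      using pr by simp
    also have "\<dots> \<le> (\<integral>z. ln (card C) / b + 2 * ?D z \<partial>gauss2 I)"
      by (intro integral_mono Bochner_Integration.integrable_sum pr(1) Bochner_Integration.integrable_add
          integrable_mult_right Di gibbs_gap_pointwise) auto
    also have "\<dots> = ln (card C) / b + 2 * (\<integral>z. ?D z \<partial>gauss2 I)"
      using Di by (simp add: g2.prob_space)
    also have "\<dots> \<le> ln (card C) / b + 2 * ((ln (2 * card C) + t\<^sup>2 * card (I - S)) / t)"
      using ED by (intro add_left_mono mult_left_mono) (simp_all add: card_cartesian_product mult.commute)
    finally show ?thesis .
  qed
  \<comment> \<open>The bound for fixed \<open>S\<close> is affine in \<open>card (I - S)\<close>,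
    whose mean is \<open>(1 - r) * card I\<close>.\<close>
  have "(\<integral>x. (\<Sum>c\<in>C. nu r x c * ?g c x) \<partial>gauss I)
     = bern r I (\<lambda>S. \<integral>x. (\<Sum>c\<in>C. ?g c x * cavg I S (\<lambda>x. gm x c) x) \<partial>gauss I)"
    unfolding nu_eq by (rule integral_bern(1)) (rule i)
  also have "\<dots> \<le> bern r I (\<lambda>S. (ln (card C) / b + 2 * (ln (2 * card C) / t)) + (2 * t) * real (card (I - S)))"
    using t by (intro bern_mono r order_trans[OF Sbound]) (simp add: field_simps power2_eq_square)
  also have "\<dots> = (ln (card C) / b + 2 * (ln (2 * card C) / t)) + (2 * t) * ((1 - r) * card I)"
    by (simp only: bern_add bern_cmult bern_const[OF finI] bern_card_compl[OF finI])
  also have "\<dots> = ln (card C) / b + 2 * ((ln (2 * card C) + t\<^sup>2 * ((1 - r) * card I)) / t)"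
    using t by (simp add: field_simps power2_eq_square)
  finally show "(\<integral>x. (\<Sum>c\<in>C. nu r x c * ?g c x) \<partial>gauss I)
      \<le> ln (card C) / b + 2 * ((ln (2 * card C) + t\<^sup>2 * ((1 - r) * card I)) / t)" .
qed

end

lemma sinh_le: "sinh u \<le> u * cosh u" if u: "0 \<le> u" for u :: real
proof -
  have "0 * cosh 0 - sinh 0 \<le> u * cosh u - sinh u"
  proof (rule DERIV_nonneg_imp_nondecreasing[OF u])
    fix x :: real assume "0 \<le> x" "x \<le> u"
    then show "\<exists>y. ((\<lambda>x. x * cosh x - sinh x) has_real_derivative y) (at x) \<and> 0 \<le> y"
      by (intro exI[of _ "x * sinh x"] conjI) (auto intro!: derivative_eq_intros)
  qed
  then show ?thesis by simp
qed

text \<open>A random sign is subgaussian: by \<open>sinh_le\<close>, \<open>cosh\<close> divided by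
  the Gaussian exponential decreases on the positive axis.\<close>

lemma cosh_le_exp: "cosh t \<le> exp (t\<^sup>2 / 2)" for t :: real
proof -
  have main: "cosh t \<le> exp (t\<^sup>2 / 2)" if t: "0 \<le> t" for t :: real
  proof -
    have "cosh t * exp (- t\<^sup>2 / 2) \<le> cosh 0 * exp (- 0\<^sup>2 / 2)"
    proof (rule DERIV_nonpos_imp_nonincreasing[OF t])
      fix x :: real assume x: "0 \<le> x" "x \<le> t"
      have "((\<lambda>x. cosh x * exp (- x\<^sup>2 / 2)) has_real_derivative (sinh x - x * cosh x) * exp (- x\<^sup>2 / 2)) (at x)"
        by (auto intro!: derivative_eq_intros simp: algebra_simps)
      moreover have "(sinh x - x * cosh x) * exp (- x\<^sup>2 / 2) \<le> 0"
        using sinh_le[OF x(1)] by (intro mult_nonpos_nonneg) auto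
      ultimately show "\<exists>y. ((\<lambda>x. cosh x * exp (- x\<^sup>2 / 2)) has_real_derivative y) (at x) \<and> y \<le> 0" by blast
    qed
    then show ?thesis by (simp add: exp_minus field_simps)
  qed
  show ?thesis
  proof (cases "0 \<le> t")
    case False
    then show ?thesis using main[of "- t"] by simp
  qed (rule main)
qed

subsection \<open>The hypercube\<close>

definition sites :: "nat \<Rightarrow> (nat \<times> nat) set" where
  "sites N = {1..N} \<times> {1..N}"

lemma finite_sites [simp]: "finite (sites N)"
  and card_sites [simp]: "card (sites N) = N * N"
  by (simp_all add: sites_def card_cartesian_product)

lemma mem_sites: "a \<in> sites N \<longleftrightarrow> fst a \<in> {1..N} \<and> snd a \<in> {1..N}"
  by (cases a) (simp add: sites_def)

lemma sites_mono: "n \<le> N \<Longrightarrow> sites n \<subseteq> sites N"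
  by (auto simp: sites_def)

lemma sum_sites: "(\<Sum>a\<in>sites n. f (fst a) (snd a)) = (\<Sum>i=1..n. \<Sum>j=1..n. f i j)"
  unfolding sites_def sum.cartesian_product by (simp add: case_prod_unfold)

text \<open>Couplings outside the subsystem get feature 0, but the index set remains
  \<open>sites N\<close>: the subsystem and the full system thus live on the same disorder and the
  same cube. The value 0 off the cube gives the bound and the sign conditions of
  \<open>chaos\<close> unconditionally.\<close>

definition spin :: "nat \<Rightarrow> nat \<Rightarrow> nat \<times> nat \<Rightarrow> (nat \<Rightarrow> real) \<Rightarrow> real" where
  "spin N n a \<sigma> = (if \<sigma> \<in> hypercube N \<and> a \<in> sites n then \<sigma> (fst a) * \<sigma> (snd a) else 0)"

lemma finite_hypercube: "finite (hypercube N)"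
  unfolding hypercube_def by (intro finite_PiE) auto

lemma card_hypercube: "card (hypercube N) = 2 ^ N"
  unfolding hypercube_def by (subst card_PiE) (auto simp: numeral_2_eq_2)

lemma hypercube_ne: "hypercube N \<noteq> {}"
  using card_hypercube[of N] by auto

lemma hypercube_cases: "\<sigma> \<in> hypercube N \<Longrightarrow> i \<in> {1..N} \<Longrightarrow> \<sigma> i = -1 \<or> \<sigma> i = 1"
  unfolding hypercube_def by (auto dest!: PiE_mem)

lemma hypercube_abs: "\<sigma> \<in> hypercube N \<Longrightarrow> i \<in> {1..N} \<Longrightarrow> \<bar>\<sigma> i\<bar> = 1"
  using hypercube_cases by fastforce

lemma hypercube_sq: "\<sigma> \<in> hypercube N \<Longrightarrow> i \<in> {1..N} \<Longrightarrow> \<sigma> i * \<sigma> i = 1"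
  using hypercube_cases by fastforce

lemma spin_bound: "n \<le> N \<Longrightarrow> \<bar>spin N n a \<sigma>\<bar> \<le> 1"
  unfolding spin_def by (auto simp: abs_mult hypercube_abs mem_sites)

lemma sum_spin:
  assumes "n \<le> N" "\<sigma> \<in> hypercube N" "\<tau> \<in> hypercube N"
  shows "(\<Sum>a\<in>sites N. spin N n a \<sigma> * spin N n a \<tau>) = (\<Sum>i=1..n. \<sigma> i * \<tau> i)\<^sup>2"
proof -
  have "(\<Sum>a\<in>sites N. spin N n a \<sigma> * spin N n a \<tau>)
     = (\<Sum>a\<in>sites n. (\<sigma> (fst a) * \<tau> (fst a)) * (\<sigma> (snd a) * \<tau> (snd a)))"
    using assms sites_mono[OF assms(1)] by (intro sum.mono_neutral_cong_right) (auto simp: spin_def mult_ac)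
  also have "\<dots> = (\<Sum>i=1..n. \<Sum>j=1..n. (\<sigma> i * \<tau> i) * (\<sigma> j * \<tau> j))"
    by (rule sum_sites)
  finally show ?thesis by (simp add: power2_eq_square sum_product)
qed

lemma spin_pair_nonneg: "n \<le> N \<Longrightarrow> 0 \<le> (\<Sum>a\<in>sites N. spin N n a \<sigma> * spin N n a \<tau>)"
proof (cases "\<sigma> \<in> hypercube N \<and> \<tau> \<in> hypercube N")
  case False
  then show ?thesis by (intro sum_nonneg) (auto simp: spin_def)
qed (auto simp: sum_spin)

text \<open>Linearization of the square in the exponent by an auxiliary Gaussian.\<close>

lemma hypercube_exp_sum:
  assumes n: "n \<le> N" "1 \<le> n" and \<tau>: "\<tau> \<in> hypercube N" and m: "0 \<le> m" "m * real n \<le> 1 / 4"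
  shows "(\<Sum>\<sigma>\<in>hypercube N. exp (m * (\<Sum>i=1..n. \<sigma> i * \<tau> i)\<^sup>2)) \<le> 2 ^ N * 2"
proof -
  define k where "k = sqrt (2 * m)"
  have k2: "k\<^sup>2 = 2 * m" using m by (simp add: k_def)
  let ?S = "\<lambda>\<sigma> :: nat \<Rightarrow> real. \<Sum>i=1..n. \<sigma> i * \<tau> i"
  have lin: "exp (m * (?S \<sigma>)\<^sup>2) = (\<integral>u. exp ((k * ?S \<sigma>) * u) \<partial>stdn)" for \<sigma>
    unfolding integral_stdn_exp by (simp add: power_mult_distrib k2)
  have prod: "(\<Sum>\<sigma>\<in>hypercube N. exp ((k * ?S \<sigma>) * u)) \<le> 2 ^ N * exp (u\<^sup>2 / 4)" for u
  proof -
    let ?f = "\<lambda>i s :: real. if i \<le> n then exp (k * u * \<tau> i * s) else 1"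
    have "(\<Sum>\<sigma>\<in>hypercube N. exp ((k * ?S \<sigma>) * u)) = (\<Sum>\<sigma>\<in>hypercube N. \<Prod>i\<in>{1..N}. ?f i (\<sigma> i))"
    proof (intro sum.cong refl)
      fix \<sigma> assume "\<sigma> \<in> hypercube N"
      have "(k * ?S \<sigma>) * u = (\<Sum>i=1..n. k * u * \<tau> i * \<sigma> i)"
        by (simp add: sum_distrib_left sum_distrib_right mult_ac)
      then have "exp ((k * ?S \<sigma>) * u) = (\<Prod>i=1..n. ?f i (\<sigma> i))"
        by (simp add: exp_sum)
      also have "\<dots> = (\<Prod>i\<in>{1..N}. ?f i (\<sigma> i))"
        using n by (intro prod.mono_neutral_left) auto
      finally show "exp ((k * ?S \<sigma>) * u) = (\<Prod>i\<in>{1..N}. ?f i (\<sigma> i))" .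
    qed
    \<comment> \<open>The sum over the cube factors over spins; each spin beyond \<open>n\<close>
      contributes just a factor 2.\<close>
    also have "\<dots> = (\<Prod>i\<in>{1..N}. \<Sum>s\<in>{-1, 1}. ?f i s)"
      unfolding hypercube_def by (rule prod_sum_PiE[symmetric]) auto
    also have "\<dots> \<le> (\<Prod>i\<in>{1..N}. 2 * (if i \<le> n then exp ((k * u)\<^sup>2 / 2) else 1))"
    proof (intro prod_mono conjI)
      fix i assume i: "i \<in> {1..N}"
      have "(k * u * \<tau> i)\<^sup>2 = (k * u)\<^sup>2" using hypercube_sq[OF \<tau> i] by (simp add: power_mult_distrib power2_eq_square)
      then show "(\<Sum>s\<in>{-1, 1}. ?f i s) \<le> 2 * (if i \<le> n then exp ((k * u)\<^sup>2 / 2) else 1)"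
        using cosh_le_exp[of "k * u * \<tau> i"] by (simp add: cosh_def)
      show "0 \<le> (\<Sum>s\<in>{-1, 1}. ?f i s)" by simp
    qed
    also have "\<dots> = 2 ^ N * (\<Prod>i\<in>{1..N}. if i \<le> n then exp ((k * u)\<^sup>2 / 2) else 1)"
      by (simp add: prod.distrib)
    also have "(\<Prod>i\<in>{1..N}. if i \<le> n then exp ((k * u)\<^sup>2 / 2) else 1) = (\<Prod>i\<in>{1..n}. exp ((k * u)\<^sup>2 / 2))"
      using n by (intro prod.mono_neutral_cong_right) auto
    also have "\<dots> = exp ((k * u)\<^sup>2 / 2) ^ n" by simp
    also have "\<dots> = exp (n * ((k * u)\<^sup>2 / 2))" by (rule exp_of_nat_mult[symmetric])
    also have "n * ((k * u)\<^sup>2 / 2) = (m * n) * u\<^sup>2" by (simp add: power_mult_distrib k2)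
    also have "exp ((m * n) * u\<^sup>2) \<le> exp (u\<^sup>2 / 4)"
      using m(2) mult_right_mono[of "m * n" "1 / 4" "u\<^sup>2"] by simp
    finally show ?thesis by simp
  qed
  have "(\<Sum>\<sigma>\<in>hypercube N. exp (m * (?S \<sigma>)\<^sup>2)) = (\<integral>u. (\<Sum>\<sigma>\<in>hypercube N. exp ((k * ?S \<sigma>) * u)) \<partial>stdn)"
    unfolding lin by (simp add: integrable_stdn_exp)
  also have "\<dots> \<le> (\<integral>u. 2 ^ N * exp (u\<^sup>2 / 4) \<partial>stdn)"
    by (intro integral_mono Bochner_Integration.integrable_sum integrable_stdn_exp integrable_mult_right
        integrable_stdn_exp_sq prod)
  also have "\<dots> = 2 ^ N * sqrt 2" by (simp add: integral_stdn_exp_sq)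
  also have "\<dots> \<le> 2 ^ N * 2" using sqrt2_less_2 by (intro mult_left_mono) auto
  finally show ?thesis .
qed

text \<open>By symmetry of the standard Gaussian, fixed sign changes of the couplings preserve their
  law.\<close>

lemma distr_gauss_signs:
  assumes I: "finite I" and w: "\<And>a. a \<in> I \<Longrightarrow> w a = -1 \<or> w a = (1::real)"
  shows "distr (gauss I) (gauss I) (\<lambda>x. \<lambda>a\<in>I. w a * x a) = gauss I"
proof -
  interpret P: product_sigma_finite "\<lambda>_. stdn" by (rule product_sigma_finite_stdn)
  have meas: "(\<lambda>x. \<lambda>a\<in>I. w a * x a) \<in> measurable (gauss I) (gauss I)"
    by (rule measurable_gaussI) (auto intro!: borel_measurable_times measurable_gauss_component)
  show ?thesis
    unfolding gauss_def
  proof (rule P.PiM_eqI[OF I])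
    fix A assume A: "\<And>a. a \<in> I \<Longrightarrow> A a \<in> sets stdn"
    let ?B = "\<lambda>a. (\<lambda>t. w a * t) -` A a"
    have B: "?B a \<in> sets stdn" "emeasure stdn (?B a) = emeasure stdn (A a)" if a: "a \<in> I" for a
    proof -
      have u: "uminus -` A a \<in> sets stdn" "emeasure stdn (uminus -` A a) = emeasure stdn (A a)"
      proof -
        have m: "uminus \<in> measurable stdn stdn" by (simp add: measurable_def[of stdn] measurable_sets_borel)
            (use measurable_sets[of "uminus :: real \<Rightarrow> real" borel borel] in auto)
        show "uminus -` A a \<in> sets stdn" using measurable_sets[OF m A[OF a]] by simp
        show "emeasure stdn (uminus -` A a) = emeasure stdn (A a)"
          using emeasure_distr[OF m A[OF a]] by (simp add: distr_stdn_uminus)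
      qed
      have "?B a = uminus -` A a \<or> ?B a = A a" using w[OF a] by auto
      then show "?B a \<in> sets stdn" "emeasure stdn (?B a) = emeasure stdn (A a)" using u A[OF a] by auto
    qed
    have "emeasure (distr (gauss I) (gauss I) (\<lambda>x. \<lambda>a\<in>I. w a * x a)) (Pi\<^sub>E I A)
      = emeasure (gauss I) ((\<lambda>x. \<lambda>a\<in>I. w a * x a) -` Pi\<^sub>E I A \<inter> space (gauss I))"
      using A I by (intro emeasure_distr meas) (auto simp: gauss_def intro!: sets_PiM_I_finite)
    also have "(\<lambda>x. \<lambda>a\<in>I. w a * x a) -` Pi\<^sub>E I A \<inter> space (gauss I) = Pi\<^sub>E I ?B"
      by (auto simp: space_gauss PiE_def Pi_def extensional_def)
    also have "emeasure (gauss I) (Pi\<^sub>E I ?B) = (\<Prod>a\<in>I. emeasure stdn (?B a))"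
      unfolding gauss_def using B I by (intro P.emeasure_PiM) auto
    also have "\<dots> = (\<Prod>a\<in>I. emeasure stdn (A a))" using B by (intro prod.cong) auto
    finally show "emeasure (distr (Pi\<^sub>M I (\<lambda>_. stdn)) (Pi\<^sub>M I (\<lambda>_. stdn)) (\<lambda>x. \<lambda>a\<in>I. w a * x a)) (Pi\<^sub>E I A) = (\<Prod>a\<in>I. emeasure stdn (A a))"
      by (simp only: gauss_def)
  qed simp
qed

section \<open>The spin system: gauge symmetry, chaos bound and overlaps\<close>

locale sk =
  fixes N n :: nat and b :: real
  assumes nN: "n \<le> N" and n1: "1 \<le> n" and b0: "b > 0"
begin

sublocale chaos "hypercube N" "sites N" "spin N n" b
  by unfold_locales (use nN b0 in \<open>auto simp: finite_hypercube hypercube_ne spin_bound spin_pair_nonneg\<close>)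

abbreviation "HC \<equiv> hypercube N"

lemma V_eq: "\<sigma> \<in> HC \<Longrightarrow> \<tau> \<in> HC \<Longrightarrow> V (\<sigma>, \<tau>) = (\<Sum>i=1..n. \<sigma> i * \<tau> i)\<^sup>2"
  unfolding V_def using sum_spin[OF nN] by simp

definition twist :: "(nat \<Rightarrow> real) \<Rightarrow> (nat \<Rightarrow> real) \<Rightarrow> nat \<Rightarrow> real" where
  "twist \<eta> \<sigma> = (\<lambda>i\<in>{1..N}. \<eta> i * \<sigma> i)"

lemma twist_in: "\<eta> \<in> HC \<Longrightarrow> \<sigma> \<in> HC \<Longrightarrow> twist \<eta> \<sigma> \<in> HC"
  using hypercube_cases[of \<eta> N] hypercube_cases[of \<sigma> N]
  unfolding twist_def by (fastforce simp: hypercube_def)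

lemma twist_twist: "\<eta> \<in> HC \<Longrightarrow> \<sigma> \<in> HC \<Longrightarrow> twist \<eta> (twist \<eta> \<sigma>) = \<sigma>"
proof (rule ext)
  fix i assume h: "\<eta> \<in> HC" "\<sigma> \<in> HC"
  have "\<eta> i * (\<eta> i * \<sigma> i) = \<sigma> i" if "i \<in> {1..N}"
    using hypercube_sq[OF h(1) that] by (simp add: mult.assoc[symmetric])
  moreover have "\<sigma> i = undefined" if "i \<notin> {1..N}"
    using h(2) that by (auto simp: hypercube_def)
  ultimately show "twist \<eta> (twist \<eta> \<sigma>) i = \<sigma> i" by (auto simp: twist_def)
qed

text \<open>Changing the sign of coupling \<open>(i, j)\<close> by
  \<open>\<eta> i * \<eta> j\<close> has the same effect as multiplying the configuration by
  \<open>\<eta>\<close>.\<close>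

lemma field_twist:
  assumes "\<eta> \<in> HC" "\<sigma> \<in> HC"
  shows "field (\<lambda>a\<in>sites N. (\<eta> (fst a) * \<eta> (snd a)) * x a) \<sigma> = field x (twist \<eta> \<sigma>)"
  unfolding field_def
  using assms twist_in[OF assms] nN
  by (intro sum.cong refl) (auto simp: spin_def twist_def mem_sites)

text \<open>Gauge invariance: flipping couplings along \<open>\<eta>\<close> moves any configuration to any other.\<close>

lemma gibbs_uniform:
  assumes \<sigma>: "\<sigma> \<in> HC"
  shows "(\<integral>x. gm x \<sigma> \<partial>gauss (sites N)) = 1 / card HC"
proof -
  interpret g: prob_space "gauss (sites N)" by (rule prob_space_gauss)
  let ?E = "\<lambda>\<sigma>. \<integral>x. gm x \<sigma> \<partial>gauss (sites N)"
  have eq: "?E \<tau> = ?E \<sigma>" if \<tau>: "\<tau> \<in> HC" for \<tau>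
  proof -
    \<comment> \<open>Since signs square to 1, the product of the two configurations carries one to
      the other.\<close>
    define \<eta> where "\<eta> = twist \<sigma> \<tau>"
    have \<eta>: "\<eta> \<in> HC" unfolding \<eta>_def by (rule twist_in[OF \<sigma> \<tau>])
    have tw: "twist \<eta> \<sigma> = \<tau>"
    proof -
      have "twist \<eta> \<sigma> = twist \<sigma> \<eta>" by (simp add: twist_def mult.commute)
      then show ?thesis unfolding \<eta>_def by (simp add: twist_twist[OF \<sigma> \<tau>])
    qed
    let ?T = "\<lambda>x. \<lambda>a\<in>sites N. (\<eta> (fst a) * \<eta> (snd a)) * x a"
    have Tm: "?T \<in> measurable (gauss (sites N)) (gauss (sites N))"
      by (rule measurable_gaussI) (auto intro!: borel_measurable_times measurable_gauss_component)
    have T: "distr (gauss (sites N)) (gauss (sites N)) ?T = gauss (sites N)"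
    proof (rule distr_gauss_signs)
      fix a assume "a \<in> sites N"
      then show "\<eta> (fst a) * \<eta> (snd a) = - 1 \<or> \<eta> (fst a) * \<eta> (snd a) = 1"
        using hypercube_cases[OF \<eta>, of "fst a"] hypercube_cases[OF \<eta>, of "snd a"] by (auto simp: mem_sites)
    qed simp
    have gT: "gm (?T x) \<sigma> = gm x \<tau>" for x
    proof -
      have bij: "bij_betw (twist \<eta>) HC HC"
        by (rule bij_betw_byWitness[where f' = "twist \<eta>"]) (auto simp: twist_twist twist_in \<eta>)
      have "(\<Sum>c\<in>HC. exp (b * field (?T x) c)) = (\<Sum>c\<in>HC. exp (b * field x (twist \<eta> c)))"
        by (intro sum.cong refl) (simp only: field_twist[OF \<eta>])
      also have "\<dots> = (\<Sum>c\<in>HC. exp (b * field x c))"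
        by (rule sum.reindex_bij_betw[OF bij])
      finally show ?thesis unfolding gibbs_def field_twist[OF \<eta> \<sigma>] tw by simp
    qed
    have "?E \<sigma> = (\<integral>x. gm x \<sigma> \<partial>distr (gauss (sites N)) (gauss (sites N)) ?T)" unfolding T ..
    also have "\<dots> = (\<integral>x. gm (?T x) \<sigma> \<partial>gauss (sites N))"
      by (rule integral_distr[OF Tm gm_measurable])
    finally show ?thesis unfolding gT ..
  qed
  have "(\<Sum>\<tau>\<in>HC. ?E \<tau>) = (\<integral>x. (\<Sum>\<tau>\<in>HC. gm x \<tau>) \<partial>gauss (sites N))"
    by (simp add: gm_integrable)
  also have "\<dots> = 1" by (simp add: gibbs_sum g.prob_space)
  finally have "(\<Sum>\<tau>\<in>HC. ?E \<sigma>) = 1" using eq by simp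
  then show ?thesis using finC neC by (simp add: field_simps)
qed

text \<open>By gauge invariance \<open>chaos_bound\<close> applies, and the second moment of two
  uniform configurations is bounded with \<open>U = 2\<close> as long as the total strength times
  \<open>n\<close> is at most 1/4.\<close>

lemma phi_small:
  assumes s: "0 \<le> s" "s \<le> 1" and l: "0 \<le> l" "(l + b\<^sup>2 * s) * n \<le> 1 / 4"
  shows "l * phi s \<le> 1 + 108 * (real N)\<^sup>2 * b ^ 3"
proof -
  have "(\<Sum>c\<in>HC. \<Sum>d\<in>HC. exp ((l + b\<^sup>2 * s) * V (c, d))) \<le> (\<Sum>d\<in>HC. 2 ^ N * 2)"
  proof (subst sum.swap, intro sum_mono)
    fix d assume d: "d \<in> HC"
    have "(\<Sum>c\<in>HC. exp ((l + b\<^sup>2 * s) * V (c, d))) = (\<Sum>c\<in>HC. exp ((l + b\<^sup>2 * s) * (\<Sum>i=1..n. c i * d i)\<^sup>2))"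
      using d by (intro sum.cong refl) (simp add: V_eq)
    also have "\<dots> \<le> 2 ^ N * 2"
      using s l by (intro hypercube_exp_sum nN n1 d) auto
    finally show "(\<Sum>c\<in>HC. exp ((l + b\<^sup>2 * s) * V (c, d))) \<le> 2 ^ N * 2" .
  qed
  then have "(\<Sum>c\<in>HC. \<Sum>d\<in>HC. exp ((l + b\<^sup>2 * s) * V (c, d))) / (real (card HC))\<^sup>2 \<le> 2"
    by (simp add: card_hypercube power2_eq_square field_simps)
  from chaos_bound[OF s l(1) gibbs_uniform this]
  have "l * phi s \<le> ln 2 + 108 * card (sites N) * b ^ 3" by simp
  moreover have "ln 2 \<le> (1::real)" using ln_le_minus_one[of 2] by simp
  ultimately show ?thesis by (simp add: power2_eq_square)
qed

lemma gm_upd: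
  assumes "a \<notin> sites n"
  shows "gm (x(a := t)) c = gm x c"
proof -
  have "field (x(a := t)) c = field x c" for c
    unfolding field_def using assms by (intro sum.cong refl) (auto simp: spin_def)
  then show ?thesis by (simp add: gibbs_def)
qed

text \<open>The sampling measure is independent of the couplings outside the subsystem, which is
  what \<open>outside_energy\<close> exploits.\<close>

lemma nu_upd:
  assumes "a \<notin> sites n"
  shows "nu r (x(a := t)) c = nu r x c"
proof -
  have "gm (mix S (x(a := t)) y) c = gm (mix S x y) c" for S y
  proof (cases "a \<in> S")
    case True
    then have "mix S (x(a := t)) y = (mix S x y)(a := t)" by (auto simp: mix_def)
    then show ?thesis by (simp add: gm_upd[OF assms])
  next
    case False
    then have "mix S (x(a := t)) y = mix S x y" by (auto simp: mix_def)
    then show ?thesis by simp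
  qed
  then show ?thesis by (simp add: nu_def noise_def cavg_def)
qed

definition flip :: "nat \<Rightarrow> (nat \<Rightarrow> real) \<Rightarrow> nat \<Rightarrow> real" where
  "flip i \<sigma> = \<sigma>(i := - \<sigma> i)"

lemma flip_flip: "flip i (flip i \<sigma>) = \<sigma>"
  by (simp add: flip_def)

lemma flip_in: "i \<in> {1..N} \<Longrightarrow> \<sigma> \<in> HC \<Longrightarrow> flip i \<sigma> \<in> HC"
  using hypercube_cases[of \<sigma> N i] unfolding flip_def by (auto simp: hypercube_def PiE_def Pi_def extensional_def)

lemma nu_flip:
  assumes i: "n < i" "i \<le> N" and \<sigma>: "\<sigma> \<in> HC"
  shows "nu r x (flip i \<sigma>) = nu r x \<sigma>"
proof -
  have "field x (flip i \<sigma>) = field x \<sigma>" for x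
    unfolding field_def using i \<sigma> flip_in[of i \<sigma>] n1
    by (intro sum.cong refl) (auto simp: spin_def flip_def mem_sites)
  then show ?thesis by (simp add: nu_def gibbs_def)
qed

text \<open>Flipping spin \<open>i\<close> preserves the sampling measure and changes the sign of
  the summand.\<close>

lemma nu_outside_corr:
  assumes i: "n < i" "i \<le> N" and j: "j \<le> N" "1 \<le> j" "i \<noteq> j"
  shows "(\<Sum>\<sigma>\<in>HC. nu r x \<sigma> * (\<sigma> i * \<sigma> j)) = 0"
proof -
  have i': "i \<in> {1..N}" using i by simp
  have bij: "bij_betw (flip i) HC HC"
    by (rule bij_betw_byWitness[where f' = "flip i"]) (auto simp: flip_in[OF i'] flip_flip)
  have "(\<Sum>\<sigma>\<in>HC. nu r x \<sigma> * (\<sigma> i * \<sigma> j)) = (\<Sum>\<sigma>\<in>HC. nu r x (flip i \<sigma>) * (flip i \<sigma> i * flip i \<sigma> j))"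
    by (rule sum.reindex_bij_betw[OF bij, symmetric])
  also have "\<dots> = (\<Sum>\<sigma>\<in>HC. - (nu r x \<sigma> * (\<sigma> i * \<sigma> j)))"
    using j by (intro sum.cong refl) (simp add: nu_flip[OF i], simp add: flip_def)
  finally show ?thesis by (simp add: sum_negf)
qed

text \<open>The spins beyond \<open>n\<close> have the identity as second moment matrix; the
  expected squared overlap of two samples there is the sum of its squared entries.\<close>

lemma outside_overlap:
  assumes x: "x \<in> space (gauss (sites N))"
  shows "(\<Sum>\<sigma>\<in>HC. \<Sum>\<tau>\<in>HC. nu r x \<sigma> * nu r x \<tau> * (\<Sum>i=n+1..N. \<sigma> i * \<tau> i)\<^sup>2) = real (N - n)"
proof -
  let ?O = "{n+1..N}"
  have "(\<Sum>\<sigma>\<in>HC. \<Sum>\<tau>\<in>HC. nu r x \<sigma> * nu r x \<tau> * (\<Sum>i\<in>?O. \<sigma> i * \<tau> i)\<^sup>2)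
     = (\<Sum>\<sigma>\<in>HC. \<Sum>\<tau>\<in>HC. \<Sum>k\<in>?O\<times>?O. (nu r x \<sigma> * (\<sigma> (fst k) * \<sigma> (snd k))) * (nu r x \<tau> * (\<tau> (fst k) * \<tau> (snd k))))"
  proof (intro sum.cong refl)
    fix \<sigma> \<tau> :: "nat \<Rightarrow> real"
    have "(\<Sum>i\<in>?O. \<sigma> i * \<tau> i)\<^sup>2 = (\<Sum>k\<in>?O\<times>?O. (\<sigma> (fst k) * \<tau> (fst k)) * (\<sigma> (snd k) * \<tau> (snd k)))"
      unfolding power2_eq_square sum_product sum.cartesian_product by (simp add: case_prod_unfold)
    then show "nu r x \<sigma> * nu r x \<tau> * (\<Sum>i\<in>?O. \<sigma> i * \<tau> i)\<^sup>2
       = (\<Sum>k\<in>?O\<times>?O. (nu r x \<sigma> * (\<sigma> (fst k) * \<sigma> (snd k))) * (nu r x \<tau> * (\<tau> (fst k) * \<tau> (snd k))))"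
      by (simp add: sum_distrib_left mult_ac)
  qed
  also have "\<dots> = (\<Sum>k\<in>?O\<times>?O. \<Sum>\<sigma>\<in>HC. \<Sum>\<tau>\<in>HC. (nu r x \<sigma> * (\<sigma> (fst k) * \<sigma> (snd k))) * (nu r x \<tau> * (\<tau> (fst k) * \<tau> (snd k))))"
    by (subst sum.swap, subst (2) sum.swap, intro sum.cong refl)
  also have "\<dots> = (\<Sum>k\<in>?O\<times>?O. (\<Sum>\<sigma>\<in>HC. nu r x \<sigma> * (\<sigma> (fst k) * \<sigma> (snd k))) * (\<Sum>\<tau>\<in>HC. nu r x \<tau> * (\<tau> (fst k) * \<tau> (snd k))))"
    unfolding sum_product ..
  also have "\<dots> = (\<Sum>k\<in>?O\<times>?O. if fst k = snd k then 1 else 0)"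
  proof (intro sum.cong refl)
    fix k assume k: "k \<in> ?O \<times> ?O"
    have "(\<Sum>\<sigma>\<in>HC. nu r x \<sigma> * (\<sigma> (fst k) * \<sigma> (snd k))) = (if fst k = snd k then 1 else 0)"
    proof (cases "fst k = snd k")
      case True
      have "(\<Sum>\<sigma>\<in>HC. nu r x \<sigma> * (\<sigma> (fst k) * \<sigma> (snd k))) = (\<Sum>\<sigma>\<in>HC. nu r x \<sigma>)"
        using True k by (intro sum.cong refl) (auto simp: hypercube_sq)
      then show ?thesis using True by (simp add: nu_sum[OF x])
    next
      case False
      then show ?thesis using k n1 by (auto intro!: nu_outside_corr)
    qed
    then show "(\<Sum>\<sigma>\<in>HC. nu r x \<sigma> * (\<sigma> (fst k) * \<sigma> (snd k))) * (\<Sum>\<tau>\<in>HC. nu r x \<tau> * (\<tau> (fst k) * \<tau> (snd k)))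
       = (if fst k = snd k then 1 else 0)" by simp
  qed
  also have "\<dots> = (\<Sum>i\<in>?O. \<Sum>j\<in>?O. if i = j then 1 else 0)"
    by (subst sum.cartesian_product) (simp add: case_prod_unfold)
  also have "\<dots> = real (N - n)" by simp
  finally show ?thesis .
qed

text \<open>The overlap splits into the spins of the subsystem, controlled by \<open>phi\<close>,
  and the uniform spins beyond it; the square of the sum costs a factor 2.\<close>

theorem overlap_bound:
  assumes r: "0 \<le> r" "r \<le> 1"
  shows "(\<integral>x. (\<Sum>\<sigma>\<in>HC. \<Sum>\<tau>\<in>HC. nu r x \<sigma> * nu r x \<tau> * (overlap N \<sigma> \<tau>)\<^sup>2) \<partial>gauss (sites N))
     \<le> 2 * (phi (r\<^sup>2) / (real N)\<^sup>2) + 2 / N"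
proof -
  interpret g: prob_space "gauss (sites N)" by (rule prob_space_gauss)
  have N: "real N > 0" using nN n1 by simp
  have ib: "integrable (gauss (sites N)) (\<lambda>x. \<Sum>\<sigma>\<in>HC. \<Sum>\<tau>\<in>HC. nu r x \<sigma> * nu r x \<tau> * f \<sigma> \<tau>)" for f
  proof (intro Bochner_Integration.integrable_sum integrable_mult_left)
    fix \<sigma> \<tau> assume h: "\<sigma> \<in> HC" "\<tau> \<in> HC"
    show "integrable (gauss (sites N)) (\<lambda>x. nu r x \<sigma> * nu r x \<tau>)"
    proof (rule integrable_bounded_prob[OF prob_space_gauss])
      show "(\<lambda>x. nu r x \<sigma> * nu r x \<tau>) \<in> borel_measurable (gauss (sites N))"
        by (intro borel_measurable_times nu_measurable h)
      show "\<bar>nu r x \<sigma> * nu r x \<tau>\<bar> \<le> 1" if "x \<in> space (gauss (sites N))" for x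
        using nu_le_1[OF that _ r] nu_nonneg[OF r] h by (simp add: abs_mult mult_le_one)
    qed
  qed
  have "(\<integral>x. (\<Sum>\<sigma>\<in>HC. \<Sum>\<tau>\<in>HC. nu r x \<sigma> * nu r x \<tau> * (overlap N \<sigma> \<tau>)\<^sup>2) \<partial>gauss (sites N))
    \<le> (\<integral>x. (2 / (real N)\<^sup>2) * (\<Sum>\<sigma>\<in>HC. \<Sum>\<tau>\<in>HC. nu r x \<sigma> * nu r x \<tau> * V (\<sigma>, \<tau>)) + 2 / N \<partial>gauss (sites N))"
  proof (intro integral_mono ib Bochner_Integration.integrable_add integrable_mult_right)
    fix x assume x: "x \<in> space (gauss (sites N))"
    have "(\<Sum>\<sigma>\<in>HC. \<Sum>\<tau>\<in>HC. nu r x \<sigma> * nu r x \<tau> * (overlap N \<sigma> \<tau>)\<^sup>2)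
      \<le> (\<Sum>\<sigma>\<in>HC. \<Sum>\<tau>\<in>HC. nu r x \<sigma> * nu r x \<tau> * ((2 / (real N)\<^sup>2) * V (\<sigma>, \<tau>) + (2 / (real N)\<^sup>2) * (\<Sum>i=n+1..N. \<sigma> i * \<tau> i)\<^sup>2))"
    proof (intro sum_mono mult_left_mono mult_nonneg_nonneg nu_nonneg r)
      fix \<sigma> \<tau> assume h: "\<sigma> \<in> HC" "\<tau> \<in> HC"
      let ?A = "\<Sum>i=1..n. \<sigma> i * \<tau> i" and ?B = "\<Sum>i=n+1..N. \<sigma> i * \<tau> i"
      have "(\<Sum>i=1..N. \<sigma> i * \<tau> i) = ?A + ?B"
      proof -
        have "{1..N} = {1..n} \<union> {n+1..N}" using nN by auto
        then show ?thesis by (simp add: sum.union_disjoint)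
      qed
      then have "(overlap N \<sigma> \<tau>)\<^sup>2 = (?A + ?B)\<^sup>2 / (real N)\<^sup>2"
        by (simp add: overlap_def power_divide power_mult_distrib)
      also have "\<dots> \<le> (2 * ?A\<^sup>2 + 2 * ?B\<^sup>2) / (real N)\<^sup>2"
      proof (intro divide_right_mono)
        have "0 \<le> (?A - ?B)\<^sup>2" by simp
        then show "(?A + ?B)\<^sup>2 \<le> 2 * ?A\<^sup>2 + 2 * ?B\<^sup>2" by (simp add: power2_eq_square algebra_simps)
      qed simp
      finally show "(overlap N \<sigma> \<tau>)\<^sup>2 \<le> (2 / (real N)\<^sup>2) * V (\<sigma>, \<tau>) + (2 / (real N)\<^sup>2) * ?B\<^sup>2"
        by (simp add: V_eq h add_divide_distrib)
    qed
    also have "\<dots> = (2 / (real N)\<^sup>2) * (\<Sum>\<sigma>\<in>HC. \<Sum>\<tau>\<in>HC. nu r x \<sigma> * nu r x \<tau> * V (\<sigma>, \<tau>))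
        + (2 / (real N)\<^sup>2) * (\<Sum>\<sigma>\<in>HC. \<Sum>\<tau>\<in>HC. nu r x \<sigma> * nu r x \<tau> * (\<Sum>i=n+1..N. \<sigma> i * \<tau> i)\<^sup>2)"
      by (simp only: sum_distrib_left sum.distrib[symmetric]) (simp add: algebra_simps)
    also have "\<dots> \<le> (2 / (real N)\<^sup>2) * (\<Sum>\<sigma>\<in>HC. \<Sum>\<tau>\<in>HC. nu r x \<sigma> * nu r x \<tau> * V (\<sigma>, \<tau>)) + 2 / N"
    proof (intro add_left_mono)
      have "(2 / (real N)\<^sup>2) * real (N - n) \<le> (2 / (real N)\<^sup>2) * N" by (intro mult_left_mono) auto
      then show "(2 / (real N)\<^sup>2) * (\<Sum>\<sigma>\<in>HC. \<Sum>\<tau>\<in>HC. nu r x \<sigma> * nu r x \<tau> * (\<Sum>i=n+1..N. \<sigma> i * \<tau> i)\<^sup>2) \<le> 2 / N"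
        unfolding outside_overlap[OF x] using N by (simp add: power2_eq_square)
    qed
    finally show "(\<Sum>\<sigma>\<in>HC. \<Sum>\<tau>\<in>HC. nu r x \<sigma> * nu r x \<tau> * (overlap N \<sigma> \<tau>)\<^sup>2)
      \<le> (2 / (real N)\<^sup>2) * (\<Sum>\<sigma>\<in>HC. \<Sum>\<tau>\<in>HC. nu r x \<sigma> * nu r x \<tau> * V (\<sigma>, \<tau>)) + 2 / N" .
  qed simp
  also have "\<dots> = 2 * (phi (r\<^sup>2) / (real N)\<^sup>2) + 2 / N"
    using ib nu_pair_V[OF r] by (simp add: g.prob_space)
  finally show ?thesis .
qed

end

subsection \<open>The expected maximum\<close>

text \<open>The field of \<open>chaos\<close> restated without the inverse temperature, so that
  several \<open>n\<close> and \<open>b\<close> can be compared outside the locale.\<close>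

definition ener :: "nat \<Rightarrow> nat \<Rightarrow> (nat \<times> nat \<Rightarrow> real) \<Rightarrow> (nat \<Rightarrow> real) \<Rightarrow> real" where
  "ener N n x \<sigma> = (\<Sum>a\<in>sites N. x a * spin N n a \<sigma>)"

definition top_ener :: "nat \<Rightarrow> nat \<Rightarrow> (nat \<times> nat \<Rightarrow> real) \<Rightarrow> real" where
  "top_ener N n x = Max (ener N n x ` hypercube N)"

definition mean_top :: "nat \<Rightarrow> nat \<Rightarrow> real" where
  "mean_top N n = (\<integral>x. top_ener N n x \<partial>gauss (sites N))"

lemma chaos_spin: "n \<le> N \<Longrightarrow> b > 0 \<Longrightarrow> chaos (hypercube N) (sites N) (spin N n) b"
  by unfold_locales (auto simp: finite_hypercube hypercube_ne spin_bound spin_pair_nonneg)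

lemma field_eq_ener:
  assumes "n \<le> N" "(b::real) > 0"
  shows "chaos.field (sites N) (spin N n) = ener N n"
  by (simp add: chaos.field_def[OF chaos_spin[OF assms]] ener_def fun_eq_iff)

lemma top_field_eq_top_ener:
  assumes "n \<le> N" "(b::real) > 0"
  shows "chaos.top_field (hypercube N) (sites N) (spin N n) = top_ener N n"
  by (simp add: chaos.top_field_def[OF chaos_spin[OF assms]] field_eq_ener[OF assms] top_ener_def fun_eq_iff)

context
  fixes N n :: nat
  assumes nN: "n \<le> N"
begin

interpretation chaos "hypercube N" "sites N" "spin N n" 1
  by (rule chaos_spin[OF nN zero_less_one])

lemmas ener_unfold = top_field_eq_top_ener[OF nN zero_less_one] field_eq_ener[OF nN zero_less_one]
lemmas top_ener_integrable = top_field_integrable[unfolded ener_unfold]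
lemmas top_ener_measurable = top_field_measurable[unfolded ener_unfold]
lemmas top_ener_attained = top_field_attained[unfolded ener_unfold]
lemmas top_ener_ge = top_field_ge[unfolded ener_unfold]
lemmas ener_exp = field_exp[unfolded ener_unfold]
lemmas ener_measurable = field_measurable[unfolded ener_unfold]

end

text \<open>The maximal inequality over all \<open>2 ^ N\<close> configurations with variance
  \<open>(real n)\<^sup>2\<close>. Linearity in \<open>n\<close> later forces a subsystem of large
  energy to contain a positive fraction of the spins.\<close>

lemma mean_top_upper:
  assumes n: "1 \<le> n" "n \<le> N"
  shows "mean_top N n \<le> 2 * n * sqrt N"
proof -
  \<comment> \<open>Makes the variance term comparable to the entropy of the cube, both of order
    \<open>N\<close>.\<close>
  define t where "t = sqrt N / n"
  have t: "t > 0" using n by (simp add: t_def)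
  have "(\<integral>x. top_ener N n x \<partial>gauss (sites N)) \<le> (ln (card (hypercube N)) + t\<^sup>2 * (real n)\<^sup>2 / 2) / t"
  proof (rule integral_Max_le[where D = "\<lambda>\<sigma> x. ener N n x \<sigma>"])
    fix \<sigma> assume \<sigma>: "\<sigma> \<in> hypercube N"
    show "integrable (gauss (sites N)) (\<lambda>x. exp (t * ener N n x \<sigma>))" by (rule ener_exp(1)[OF n(2)])
    have "(\<Sum>a\<in>sites N. (spin N n a \<sigma>)\<^sup>2) = (real n)\<^sup>2"
      using sum_spin[OF n(2) \<sigma> \<sigma>] n(2) hypercube_sq[OF \<sigma>] by (simp add: power2_eq_square)
    then show "(\<integral>x. exp (t * ener N n x \<sigma>) \<partial>gauss (sites N)) \<le> exp (t\<^sup>2 * (real n)\<^sup>2 / 2)"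
      using ener_exp(2)[OF n(2), of t \<sigma>] by simp
  qed (use n t top_ener_integrable[OF n(2)] top_ener_attained[OF n(2)] in
       \<open>auto simp: prob_space_gauss finite_hypercube hypercube_ne intro: eq_refl\<close>)
  also have "\<dots> \<le> (N + N / 2) / t"
  proof (rule divide_right_mono, rule add_mono)
    have "ln (card (hypercube N)) = N * ln 2" by (simp add: card_hypercube ln_realpow)
    also have "\<dots> \<le> real N * 1" using ln_le_minus_one[of 2] by (intro mult_left_mono) auto
    finally show "ln (card (hypercube N)) \<le> N" by simp
    show "t\<^sup>2 * (real n)\<^sup>2 / 2 \<le> N / 2" using n by (simp add: t_def power_divide)
  qed (use t in auto)
  also have "\<dots> = (3 / 2) * (n * sqrt N)"
    using n by (simp add: t_def field_simps)
  also have "\<dots> \<le> 2 * (n * sqrt N)" by (intro mult_right_mono) auto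
  finally show ?thesis by (simp add: mean_top_def)
qed

lemma ener_eq_sum: "\<sigma> \<in> hypercube N \<Longrightarrow> n \<le> N \<Longrightarrow> ener N n x \<sigma> = (\<Sum>a\<in>sites n. x a * (\<sigma> (fst a) * \<sigma> (snd a)))"
  unfolding ener_def using sites_mono[of n N]
  by (intro sum.mono_neutral_cong_right) (auto simp: spin_def)

text \<open>One more spin brings \<open>2 * n + 1\<close> new couplings, each of absolute mean at
  most 1. This is small against the scale N^(3/2) of the maximum.\<close>

lemma mean_top_step:
  assumes n: "Suc n \<le> N"
  shows "mean_top N (Suc n) \<le> mean_top N n + 3 * N"
proof -
  let ?A = "sites (Suc n) - sites n"
  have sub: "sites n \<subseteq> sites (Suc n)" "sites (Suc n) \<subseteq> sites N" using n by (auto intro!: sites_mono)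
  have "card ?A = Suc n * Suc n - n * n"
    using sub by (subst card_Diff_subset) auto
  then have cA: "real (card ?A) \<le> 3 * N" using n by (simp add: of_nat_diff)
  have i: "integrable (gauss (sites N)) (\<lambda>x. \<Sum>a\<in>?A. \<bar>x a\<bar>)"
    using sub by (intro Bochner_Integration.integrable_sum integrable_gauss_component integrable_stdn_abs) auto
  have pt: "top_ener N (Suc n) x \<le> top_ener N n x + (\<Sum>a\<in>?A. \<bar>x a\<bar>)" for x
  proof -
    obtain \<sigma> where \<sigma>: "\<sigma> \<in> hypercube N" "top_ener N (Suc n) x = ener N (Suc n) x \<sigma>"
      using top_ener_attained[OF n, of x] by auto
    have "ener N (Suc n) x \<sigma> = ener N n x \<sigma> + (\<Sum>a\<in>?A. x a * (\<sigma> (fst a) * \<sigma> (snd a)))"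
      using \<sigma>(1) n sub by (simp add: ener_eq_sum sum.subset_diff[of "sites n" "sites (Suc n)"])
    also have "(\<Sum>a\<in>?A. x a * (\<sigma> (fst a) * \<sigma> (snd a))) \<le> (\<Sum>a\<in>?A. \<bar>x a\<bar>)"
    proof (rule sum_mono)
      fix a assume "a \<in> ?A"
      then have "\<bar>\<sigma> (fst a) * \<sigma> (snd a)\<bar> = 1"
        using n \<sigma>(1) by (auto simp: mem_sites abs_mult hypercube_abs)
      then have "\<bar>x a * (\<sigma> (fst a) * \<sigma> (snd a))\<bar> = \<bar>x a\<bar>" by (simp add: abs_mult)
      then show "x a * (\<sigma> (fst a) * \<sigma> (snd a)) \<le> \<bar>x a\<bar>" by linarith
    qed
    finally show ?thesis using \<sigma> top_ener_ge[of n N \<sigma> x] n by simp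
  qed
  have "mean_top N (Suc n) \<le> (\<integral>x. top_ener N n x + (\<Sum>a\<in>?A. \<bar>x a\<bar>) \<partial>gauss (sites N))"
    unfolding mean_top_def using n
    by (intro integral_mono top_ener_integrable Bochner_Integration.integrable_add i pt) auto
  also have "\<dots> = mean_top N n + (\<Sum>a\<in>?A. \<integral>x. \<bar>x a\<bar> \<partial>gauss (sites N))"
    unfolding mean_top_def using n i sub
    by (subst Bochner_Integration.integral_add)
       (auto intro!: top_ener_integrable Bochner_Integration.integral_sum integrable_gauss_component integrable_stdn_abs)
  also have "(\<Sum>a\<in>?A. \<integral>x. \<bar>x a\<bar> \<partial>gauss (sites N)) \<le> (\<Sum>a\<in>?A. 1)"
  proof (rule sum_mono)
    fix a assume "a \<in> ?A"
    then have "a \<in> sites N" using sub by auto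
    then show "(\<integral>x. \<bar>x a\<bar> \<partial>gauss (sites N)) \<le> 1"
      using integral_gauss_component[of a "sites N" "\<lambda>u. \<bar>u\<bar>"] integral_stdn_abs by simp
  qed
  finally show ?thesis using cA by simp
qed

text \<open>Integrating out the coordinates one at a time, each contributes at most the variance of one
  standard Gaussian.\<close>

lemma gauss_Lipschitz_variance:
  fixes f :: "('i \<Rightarrow> real) \<Rightarrow> real"
  assumes "finite I" "f \<in> borel_measurable (gauss I)"
    "\<And>x a s t. a \<in> I \<Longrightarrow> \<bar>f (x(a := s)) - f (x(a := t))\<bar> \<le> \<bar>s - t\<bar>"
  shows "integrable (gauss I) f \<and> integrable (gauss I) (\<lambda>x. (f x)\<^sup>2)
    \<and> (\<integral>x. (f x)\<^sup>2 \<partial>gauss I) \<le> (\<integral>x. f x \<partial>gauss I)\<^sup>2 + card I"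
  using assms
proof (induction I arbitrary: f rule: finite_induct)
  case empty
  interpret g: prob_space "gauss ({} :: 'i set)" by (rule prob_space_gauss)
  have sp: "space (gauss ({} :: 'i set)) = {\<lambda>_. undefined}" by (simp add: space_gauss)
  have c: "f x = f (\<lambda>_. undefined)" if "x \<in> space (gauss {})" for x using that sp by simp
  have "integrable (gauss {}) f"
    by (subst Bochner_Integration.integrable_cong[OF refl c]) auto
  moreover have "integrable (gauss {}) (\<lambda>x. (f x)\<^sup>2)"
    by (subst Bochner_Integration.integrable_cong[OF refl, of _ _ "\<lambda>_. (f (\<lambda>_. undefined))\<^sup>2"]) (auto simp: c)
  moreover have "(\<integral>x. f x \<partial>gauss {}) = f (\<lambda>_. undefined)"
    by (subst Bochner_Integration.integral_cong[OF refl c]) (auto simp: g.prob_space)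
  moreover have "(\<integral>x. (f x)\<^sup>2 \<partial>gauss {}) = (f (\<lambda>_. undefined))\<^sup>2"
    by (subst Bochner_Integration.integral_cong[OF refl, of _ _ "\<lambda>_. (f (\<lambda>_. undefined))\<^sup>2"]) (auto simp: c g.prob_space)
  ultimately show ?case by simp
next
  case (insert a J)
  interpret P: product_sigma_finite "\<lambda>_::'i. stdn" by (rule product_sigma_finite_stdn)
  interpret gJ: prob_space "gauss J" by (rule prob_space_gauss)
  interpret gI: prob_space "gauss (insert a J)" by (rule prob_space_gauss)
  note fm = insert.prems(1) and lip = insert.prems(2)
  let ?I = "insert a J"
  let ?z = "\<lambda>i. if i \<in> ?I then 0 else undefined :: real"
  \<comment> \<open>Switching coordinates to 0 one at a time gives linear growth, hence both moments
    exist.\<close>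
  have growth: "\<bar>f x\<bar> \<le> \<bar>f ?z\<bar> + (\<Sum>i\<in>?I. \<bar>x i\<bar>)" if x: "x \<in> space (gauss ?I)" for x
  proof -
    have "\<bar>f (\<lambda>i. if i \<in> A then 0 else x i) - f x\<bar> \<le> (\<Sum>i\<in>A. \<bar>x i\<bar>)" if "finite A" "A \<subseteq> ?I" for A
      using that
    proof (induction A rule: finite_induct)
      case (insert i A)
      let ?y = "\<lambda>i. if i \<in> A then 0 else x i"
      have eq1: "(\<lambda>k. if k \<in> insert i A then 0 else x k) = ?y(i := 0)" by auto
      have eq2: "?y(i := x i) = ?y" using insert.hyps by auto
      have "i \<in> ?I" using insert.prems by simp
      from lip[OF this, of ?y 0 "x i"]
      have "\<bar>f (\<lambda>k. if k \<in> insert i A then 0 else x k) - f ?y\<bar> \<le> \<bar>0 - x i\<bar>"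
        unfolding eq1 eq2 .
      moreover have "\<bar>f ?y - f x\<bar> \<le> (\<Sum>i\<in>A. \<bar>x i\<bar>)" using insert by simp
      ultimately show ?case using insert.hyps by simp
    qed simp
    from this[of ?I] insert.hyps
    have "\<bar>f (\<lambda>i. if i \<in> ?I then 0 else x i) - f x\<bar> \<le> (\<Sum>i\<in>?I. \<bar>x i\<bar>)" by simp
    moreover have "(\<lambda>i. if i \<in> ?I then 0 else x i) = ?z"
      using x by (auto simp: space_gauss PiE_def extensional_def fun_eq_iff)
    ultimately show ?thesis by simp
  qed
  have i1: "integrable (gauss ?I) (\<lambda>x. \<bar>f ?z\<bar> + (\<Sum>i\<in>?I. \<bar>x i\<bar>))"
    by (intro Bochner_Integration.integrable_add Bochner_Integration.integrable_sum integrable_gauss_component integrable_stdn_abs) auto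
  have if1: "integrable (gauss ?I) f"
    by (rule Bochner_Integration.integrable_bound[OF i1 fm]) (use growth in \<open>auto intro!: AE_I2 simp: sum_nonneg\<close>)
  have i2: "integrable (gauss ?I) (\<lambda>x. 2 * (f ?z)\<^sup>2 + 2 * (card ?I * (\<Sum>i\<in>?I. (x i)\<^sup>2)))"
    by (intro Bochner_Integration.integrable_add integrable_mult_right Bochner_Integration.integrable_sum
       integrable_gauss_component integrable_stdn_power) auto
  have if2: "integrable (gauss ?I) (\<lambda>x. (f x)\<^sup>2)"
  proof (rule Bochner_Integration.integrable_bound[OF i2])
    show "(\<lambda>x. (f x)\<^sup>2) \<in> borel_measurable (gauss ?I)" by (rule borel_measurable_power[OF fm])
    show "AE x in gauss ?I. norm ((f x)\<^sup>2) \<le> norm (2 * (f ?z)\<^sup>2 + 2 * (card ?I * (\<Sum>i\<in>?I. (x i)\<^sup>2)))"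
    proof (rule AE_I2)
      fix x assume x: "x \<in> space (gauss ?I)"
      let ?s = "\<Sum>i\<in>?I. \<bar>x i\<bar>"
      have "(f x)\<^sup>2 \<le> (\<bar>f ?z\<bar> + ?s)\<^sup>2" using growth[OF x] by (intro power2_le_iff_abs_le[THEN iffD2]) (auto simp: sum_nonneg)
      also have "\<dots> \<le> 2 * (f ?z)\<^sup>2 + 2 * ?s\<^sup>2"
      proof -
        have "0 \<le> (\<bar>f ?z\<bar> - ?s)\<^sup>2" by simp
        then show ?thesis by (simp add: power2_eq_square algebra_simps)
      qed
      also have "?s\<^sup>2 \<le> card ?I * (\<Sum>i\<in>?I. (x i)\<^sup>2)"
        using Cauchy_Schwarz_ineq_sum[of "\<lambda>i. \<bar>x i\<bar>" "\<lambda>_. 1" ?I] by (simp add: mult.commute)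
      finally show "norm ((f x)\<^sup>2) \<le> norm (2 * (f ?z)\<^sup>2 + 2 * (card ?I * (\<Sum>i\<in>?I. (x i)\<^sup>2)))" by simp
    qed
  qed
  have la: "\<bar>f (x(a := s)) - f (x(a := t))\<bar> \<le> \<bar>s - t\<bar>" for x s t
    by (rule lip) simp
  have la0: "\<bar>f (x(a := t)) - f (x(a := 0))\<bar> \<le> \<bar>t\<bar>" for x t
    using la[of x t 0] unfolding diff_0_right .
  define g where "g x = (\<integral>t. f (x(a := t)) \<partial>stdn)" for x
  have fi: "integrable stdn (\<lambda>t. f (x(a := t)))" "integrable stdn (\<lambda>t. (f (x(a := t)))\<^sup>2)" for x
  proof -
    \<comment> \<open>Continuity gives measurable sections at every \<open>x\<close>, inside the
      space or not; the induction hypothesis asks for the Lipschitz bound on \<open>g\<close> at all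
      points.\<close>
    have "1-lipschitz_on UNIV (\<lambda>t. f (x(a := t)))"
    proof (rule lipschitz_onI)
      show "dist (f (x(a := s))) (f (x(a := t))) \<le> 1 * dist s t" for s t
        unfolding dist_real_def mult_1 by (rule la)
    qed simp
    then have "continuous_on UNIV (\<lambda>t. f (x(a := t)))" by (rule lipschitz_on_continuous_on)
    then have m: "(\<lambda>t. f (x(a := t))) \<in> borel_measurable stdn"
      unfolding borel_measurable_stdn by (rule borel_measurable_continuous_onI)
    have b: "\<bar>f (x(a := t))\<bar> \<le> \<bar>f (x(a := 0))\<bar> + \<bar>t\<bar>" for t using la0[of x t] by linarith
    have "integrable stdn (\<lambda>t. \<bar>f (x(a := 0))\<bar> + \<bar>t\<bar>)"
      by (intro Bochner_Integration.integrable_add integrable_stdn_abs) simp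
    then show "integrable stdn (\<lambda>t. f (x(a := t)))"
      by (rule Bochner_Integration.integrable_bound[OF _ m]) (use b in \<open>auto intro!: AE_I2\<close>)
    have "integrable stdn (\<lambda>t. 2 * (f (x(a := 0)))\<^sup>2 + 2 * t\<^sup>2)"
      by (intro Bochner_Integration.integrable_add integrable_mult_right integrable_stdn_power) simp
    then show "integrable stdn (\<lambda>t. (f (x(a := t)))\<^sup>2)"
    proof (rule Bochner_Integration.integrable_bound[OF _ borel_measurable_power[OF m]])
      show "AE t in stdn. norm ((f (x(a := t)))\<^sup>2) \<le> norm (2 * (f (x(a := 0)))\<^sup>2 + 2 * t\<^sup>2)"
      proof (rule AE_I2)
        fix t
        have "(f (x(a := t)))\<^sup>2 \<le> (\<bar>f (x(a := 0))\<bar> + \<bar>t\<bar>)\<^sup>2" using b by (intro power2_le_iff_abs_le[THEN iffD2]) auto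
        also have "\<dots> \<le> 2 * (f (x(a := 0)))\<^sup>2 + 2 * t\<^sup>2"
        proof -
          have "0 \<le> (\<bar>f (x(a := 0))\<bar> - \<bar>t\<bar>)\<^sup>2" by simp
          then show ?thesis by (simp add: power2_eq_square algebra_simps)
        qed
        finally show "norm ((f (x(a := t)))\<^sup>2) \<le> norm (2 * (f (x(a := 0)))\<^sup>2 + 2 * t\<^sup>2)" by simp
      qed
    qed
  qed
  \<comment> \<open>The variance in one coordinate is at most the second moment about the value at
    0, which the Lipschitz bound compares with the variance of \<open>t\<close>.\<close>
  have var1: "(\<integral>t. (f (x(a := t)))\<^sup>2 \<partial>stdn) \<le> (g x)\<^sup>2 + 1" for x
  proof -
    let ?c = "f (x(a := 0))"
    have p1: "measure stdn UNIV = 1" using stdn.prob_space by simp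
    have "(\<integral>t. (f (x(a := t)) - ?c)\<^sup>2 \<partial>stdn) \<le> (\<integral>t. t\<^sup>2 \<partial>stdn)"
    proof (rule integral_mono)
      show "integrable stdn (\<lambda>t. (f (x(a := t)) - ?c)\<^sup>2)"
        unfolding power2_diff using fi[of x] by (intro Bochner_Integration.integrable_diff Bochner_Integration.integrable_add) auto
      show "(f (x(a := t)) - ?c)\<^sup>2 \<le> t\<^sup>2" for t using la0[of x t] by (simp only: abs_le_square_iff)
    qed (rule integrable_stdn_power)
    moreover have "(\<integral>t. (f (x(a := t)) - ?c)\<^sup>2 \<partial>stdn) = (\<integral>t. (f (x(a := t)))\<^sup>2 \<partial>stdn) + ?c\<^sup>2 - 2 * g x * ?c"
      unfolding power2_diff g_def using fi[of x] p1
      by (subst Bochner_Integration.integral_diff Bochner_Integration.integral_add; (intro Bochner_Integration.integrable_add)?; simp)+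
    moreover have "0 \<le> (g x - ?c)\<^sup>2" by simp
    ultimately show ?thesis by (simp add: integral_stdn_sq power2_diff)
  qed
  have gm: "g \<in> borel_measurable (gauss J)"
  proof -
    have "(\<lambda>(x, t). x(a := t)) \<in> measurable (gauss J \<Otimes>\<^sub>M stdn) (gauss ?I)"
      unfolding gauss_def by (rule measurable_add_dim)
    from measurable_compose[OF this fm]
    have "(\<lambda>(x, t). f (x(a := t))) \<in> borel_measurable (gauss J \<Otimes>\<^sub>M stdn)" by (simp only: case_prod_unfold)
    then show ?thesis unfolding g_def[abs_def] by (rule stdn.borel_measurable_lebesgue_integral)
  qed
  have glip: "\<bar>g (x(j := s)) - g (x(j := t))\<bar> \<le> \<bar>s - t\<bar>" if j: "j \<in> J" for x j s t
  proof -
    have ja: "j \<noteq> a" using j insert.hyps by auto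
    have "g (x(j := s)) - g (x(j := t)) = (\<integral>u. f (x(j := s, a := u)) - f (x(j := t, a := u)) \<partial>stdn)"
      unfolding g_def using fi by simp
    also have "\<bar>\<dots>\<bar> \<le> (\<integral>u. \<bar>s - t\<bar> \<partial>stdn)"
    proof (intro order_trans[OF integral_abs_bound] integral_mono)
      show "\<bar>f (x(j := s, a := u)) - f (x(j := t, a := u))\<bar> \<le> \<bar>s - t\<bar>" for u
        unfolding fun_upd_twist[OF ja] by (rule lip) (use j in simp)
    qed (use fi in auto)
    finally show ?thesis using stdn.prob_space by simp
  qed
  from insert.IH[OF gm glip]
  have ig: "integrable (gauss J) g" "integrable (gauss J) (\<lambda>x. (g x)\<^sup>2)"
    and vg: "(\<integral>x. (g x)\<^sup>2 \<partial>gauss J) \<le> (\<integral>x. g x \<partial>gauss J)\<^sup>2 + card J" by auto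
  have Eg: "(\<integral>x. f x \<partial>gauss ?I) = (\<integral>x. g x \<partial>gauss J)"
    unfolding g_def using P.product_integral_insert[OF insert.hyps, of f] if1 by (simp only: gauss_def)
  have "(\<integral>x. (f x)\<^sup>2 \<partial>gauss ?I) = (\<integral>x. (\<integral>t. (f (x(a := t)))\<^sup>2 \<partial>stdn) \<partial>gauss J)"
    using P.product_integral_insert[OF insert.hyps, of "\<lambda>x. (f x)\<^sup>2"] if2 by (simp only: gauss_def)
  also have "\<dots> \<le> (\<integral>x. (g x)\<^sup>2 + 1 \<partial>gauss J)"
  proof (rule integral_mono)
    show "integrable (gauss J) (\<lambda>x. \<integral>t. (f (x(a := t)))\<^sup>2 \<partial>stdn)"
    proof (rule Bochner_Integration.integrable_bound[where f = "\<lambda>x. (g x)\<^sup>2 + 1"])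
      show "integrable (gauss J) (\<lambda>x. (g x)\<^sup>2 + 1)" using ig by simp
      have "(\<lambda>(x, t). x(a := t)) \<in> measurable (gauss J \<Otimes>\<^sub>M stdn) (gauss ?I)"
        unfolding gauss_def by (rule measurable_add_dim)
      from measurable_compose[OF this borel_measurable_power[OF fm, of 2]]
      have "(\<lambda>(x, t). (f (x(a := t)))\<^sup>2) \<in> borel_measurable (gauss J \<Otimes>\<^sub>M stdn)" by (simp only: case_prod_unfold)
      then show "(\<lambda>x. \<integral>t. (f (x(a := t)))\<^sup>2 \<partial>stdn) \<in> borel_measurable (gauss J)"
        by (rule stdn.borel_measurable_lebesgue_integral)
      show "AE x in gauss J. norm (\<integral>t. (f (x(a := t)))\<^sup>2 \<partial>stdn) \<le> norm ((g x)\<^sup>2 + 1)"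
        using var1 by (intro AE_I2) simp
    qed
  qed (use ig var1 in auto)
  also have "\<dots> = (\<integral>x. (g x)\<^sup>2 \<partial>gauss J) + 1" using ig by (simp add: gJ.prob_space)
  also have "\<dots> \<le> (\<integral>x. f x \<partial>gauss ?I)\<^sup>2 + card ?I" using vg insert.hyps by (simp add: Eg)
  finally show ?case using if1 if2 by blast
qed

lemma top_ener_Lipschitz:
  assumes "n \<le> N" "a \<in> sites N"
  shows "\<bar>top_ener N n (x(a := s)) - top_ener N n (x(a := t))\<bar> \<le> \<bar>s - t\<bar>"
proof -
  have e: "ener N n (x(a := s)) \<sigma> \<le> ener N n (x(a := t)) \<sigma> + \<bar>s - t\<bar>" for s t \<sigma>
  proof -
    have "ener N n (x(a := u)) \<sigma> = u * spin N n a \<sigma> + (\<Sum>k\<in>sites N - {a}. x k * spin N n k \<sigma>)" for u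
      unfolding ener_def using assms by (subst sum.remove[of "sites N" a]) auto
    then have "ener N n (x(a := s)) \<sigma> - ener N n (x(a := t)) \<sigma> = (s - t) * spin N n a \<sigma>" by (simp add: algebra_simps)
    also have "\<dots> \<le> \<bar>(s - t) * spin N n a \<sigma>\<bar>" by (rule abs_ge_self)
    also have "\<dots> \<le> \<bar>s - t\<bar> * 1"
      unfolding abs_mult using spin_bound[OF assms(1), of a \<sigma>] by (intro mult_left_mono) auto
    finally show ?thesis by simp
  qed
  have "top_ener N n (x(a := s)) \<le> top_ener N n (x(a := t)) + \<bar>s - t\<bar>" for s t
  proof -
    obtain \<sigma> where "\<sigma> \<in> hypercube N" "top_ener N n (x(a := s)) = ener N n (x(a := s)) \<sigma>"
      using top_ener_attained[OF assms(1)] by blast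
    then show ?thesis using e[of s \<sigma> t] top_ener_ge[OF assms(1), of \<sigma> "x(a := t)"] by simp
  qed
  from this[of s t] this[of t s] show ?thesis by linarith
qed

text \<open>The maximum is 1-Lipschitz in each of the \<open>N * N\<close> couplings, so its
  variance is at most \<open>N * N\<close>, giving fluctuations far below the scale N^(3/2).\<close>

lemma top_ener_deviation:
  assumes n: "n \<le> N" and N: "1 \<le> N"
  shows "(\<integral>x. \<bar>top_ener N n x - mean_top N n\<bar> \<partial>gauss (sites N)) \<le> N"
proof -
  interpret g: prob_space "gauss (sites N)" by (rule prob_space_gauss)
  let ?f = "top_ener N n" and ?m = "mean_top N n"
  note L = gauss_Lipschitz_variance[OF finite_sites top_ener_measurable[OF n] top_ener_Lipschitz[OF n]]
  have sq: "integrable (gauss (sites N)) (\<lambda>x. (?f x - ?m)\<^sup>2)"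
    unfolding power2_diff using L by (intro Bochner_Integration.integrable_diff Bochner_Integration.integrable_add) auto
  have "(\<integral>x. (?f x - ?m)\<^sup>2 \<partial>gauss (sites N)) = (\<integral>x. (?f x)\<^sup>2 \<partial>gauss (sites N)) - ?m\<^sup>2"
    unfolding power2_diff using L
    by (simp add: g.prob_space mean_top_def[symmetric] power2_eq_square)
  then have v: "(\<integral>x. (?f x - ?m)\<^sup>2 \<partial>gauss (sites N)) \<le> N * N"
    using L by (simp add: mean_top_def)
  have "(\<integral>x. \<bar>?f x - ?m\<bar> \<partial>gauss (sites N)) \<le> (\<integral>x. N / 2 + (1 / (2 * N)) * (?f x - ?m)\<^sup>2 \<partial>gauss (sites N))"
  proof (rule integral_mono)
    fix x
    let ?y = "\<bar>?f x - ?m\<bar>"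
    have "0 \<le> (?y - N)\<^sup>2" by simp
    then have "2 * N * ?y \<le> N * N + ?y\<^sup>2" by (simp add: power2_eq_square algebra_simps)
    then show "?y \<le> N / 2 + (1 / (2 * N)) * (?f x - ?m)\<^sup>2"
      using N by (simp add: field_simps power2_eq_square)
  qed (use L sq in auto)
  also have "\<dots> = N / 2 + (1 / (2 * N)) * (\<integral>x. (?f x - ?m)\<^sup>2 \<partial>gauss (sites N))"
    using sq by (simp add: g.prob_space)
  also have "\<dots> \<le> N / 2 + (1 / (2 * N)) * (N * N)"
    using v by (intro add_left_mono mult_left_mono) auto
  finally show ?thesis using N by simp
qed

text \<open>A test function for bounding a Gaussian absolute mean from below by exponential moments
  alone: it lies below a multiple of the absolute value, yet its mean at a standard Gaussian,
  \<open>12 * exp (1 / 2) - exp 2 - 11\<close>, is at least 1.\<close>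

lemma cosh_combination_le: "12 * cosh u - cosh (2 * u) - 11 \<le> 40 * \<bar>u\<bar>" for u :: real
proof -
  have pos: "12 * cosh u - cosh (2 * u) - 11 \<le> 40 * u" if u: "0 \<le> u" for u :: real
  proof -
    let ?c = "cosh u"
    have c1: "1 \<le> ?c" by (rule cosh_real_ge_1)
    \<comment> \<open>As a quadratic in \<open>cosh u\<close> it is nonpositive from 5 on; below 5
      the two factors are at most \<open>5 * u\<close> and 8, whence 40.\<close>
    have eq: "12 * ?c - cosh (2 * u) - 11 = (?c - 1) * (10 - 2 * ?c)"
      unfolding cosh_double_cosh by (simp add: power2_eq_square algebra_simps)
    show ?thesis
    proof (cases "?c \<ge> 5")
      case True
      then have "(?c - 1) * (10 - 2 * ?c) \<le> 0" using c1 by (intro mult_nonneg_nonpos) auto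
      then show ?thesis using u eq by simp
    next
      case False
      have "?c - 1 \<le> sinh u"
        using u by (simp add: cosh_def sinh_def field_simps)
      also have "sinh u \<le> u * ?c" by (rule sinh_le[OF u])
      also have "\<dots> \<le> u * 5" using u False by (intro mult_left_mono) auto
      finally have "(?c - 1) * (10 - 2 * ?c) \<le> (u * 5) * 8"
        using c1 u False by (intro mult_mono) auto
      then show ?thesis using eq by simp
    qed
  qed
  show ?thesis using pos[of "\<bar>u\<bar>"] by (cases "0 \<le> u") auto
qed

text \<open>The test function is applied to the sum scaled to variance 1 by
  \<open>t\<close>.\<close>

lemma gauss_abs_sum_lower:
  assumes I: "finite I" and A: "A \<subseteq> I" "A \<noteq> {}"
  shows "sqrt (card A) / 40 \<le> (\<integral>x. \<bar>\<Sum>a\<in>A. x a\<bar> \<partial>gauss I)"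
proof -
  interpret g: prob_space "gauss I" by (rule prob_space_gauss)
  define t where "t = 1 / sqrt (card A)"
  have fA: "finite A" using A I finite_subset by auto
  then have cA: "card A > 0" using A by (simp add: card_gt_0_iff)
  then have t: "t > 0" "t\<^sup>2 * card A = 1" by (simp_all add: t_def power_divide)
  let ?B = "\<lambda>x. \<Sum>a\<in>A. x a"
  have e: "integrable (gauss I) (\<lambda>x. exp (s * ?B x)) \<and> (\<integral>x. exp (s * ?B x) \<partial>gauss I) = exp (s\<^sup>2 * card A / 2)" for s
  proof -
    have eq: "s * ?B x = (\<Sum>a\<in>I. x a * (if a \<in> A then s else 0))" for x
      unfolding sum_distrib_left using A I by (intro sum.mono_neutral_cong_left) auto
    have "(\<Sum>a\<in>I. (if a \<in> A then s else 0)\<^sup>2 / 2) = (\<Sum>a\<in>A. s\<^sup>2 / 2)"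
      using A I by (intro sum.mono_neutral_cong_right) auto
    then show ?thesis unfolding eq using gauss_exp_linear[OF I, of "\<lambda>a. if a \<in> A then s else 0"] by simp
  qed
  have ci: "integrable (gauss I) (\<lambda>x. cosh (s * ?B x))" and ce: "(\<integral>x. cosh (s * ?B x) \<partial>gauss I) = exp (s\<^sup>2 * card A / 2)" for s
    using e[of s] e[of "- s"] by (simp_all add: cosh_def)
  have Bi: "integrable (gauss I) (\<lambda>x. \<bar>?B x\<bar>)"
    using A by (intro integrable_abs Bochner_Integration.integrable_sum integrable_gauss_component integrable_stdn_id) auto
  have "(\<integral>x. 12 * cosh (t * ?B x) - cosh ((2 * t) * ?B x) - 11 \<partial>gauss I) \<le> (\<integral>x. 40 * (t * \<bar>?B x\<bar>) \<partial>gauss I)"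
  proof (rule integral_mono)
    fix x show "12 * cosh (t * ?B x) - cosh ((2 * t) * ?B x) - 11 \<le> 40 * (t * \<bar>?B x\<bar>)"
      using cosh_combination_le[of "t * ?B x"] t by (simp add: abs_mult mult.assoc)
  qed (use ci Bi in auto)
  moreover have "(\<integral>x. 12 * cosh (t * ?B x) - cosh ((2 * t) * ?B x) - 11 \<partial>gauss I) = 12 * exp (1 / 2) - exp 2 - 11"
    using ci by (simp add: ce g.prob_space power_mult_distrib t(2) t(2)[unfolded mult.commute[of _ "real _"]])
  moreover have "1 \<le> 12 * exp (1 / 2) - exp 2 - (11 :: real)"
  proof -
    have "1 + 1 / 2 + (1 / 2)\<^sup>2 / 2 \<le> exp (1 / 2 :: real)" by (rule exp_lower_Taylor_quadratic) simp
    moreover have "exp 2 = exp 1 * exp (1 :: real)" by (simp add: mult_exp_exp)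
    moreover have "exp 1 * exp 1 \<le> 272 / 100 * (272 / 100 :: real)"
      using e_less_272 by (intro mult_mono) auto
    ultimately show ?thesis by (simp add: power2_eq_square)
  qed
  ultimately have "1 \<le> 40 * (t * (\<integral>x. \<bar>?B x\<bar> \<partial>gauss I))" using Bi by simp
  then show ?thesis using cA by (simp add: t_def field_simps)
qed

text \<open>Fix the first half of the spins to be \<open>1\<close> and align each spin of the second half
  with its local field; the remaining interactions have mean zero.\<close>

lemma mean_top_lower:
  assumes N: "2 \<le> N"
  shows "real N * sqrt N / 160 \<le> mean_top N N"
proof -
  define h where "h = N div 2"
  have h: "1 \<le> h" "h < N" "2 * h \<le> N" "N \<le> 2 * h + 1" using N by (auto simp: h_def)
  define K where "K = {h+1..N}"
  \<comment> \<open>The couplings of spin \<open>k\<close> of the second half with the first half,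
    in both orders; \<open>IN\<close> collects the couplings within one half.\<close>
  define A where "A k = {1..h} \<times> {k} \<union> {k} \<times> {1..h}" for k :: nat
  define IN where "IN = {1..h} \<times> {1..h} \<union> K \<times> K"
  define B where "B k x = (\<Sum>a\<in>A k. x a)" for k and x :: "nat \<times> nat \<Rightarrow> real"
  define y where "y x i = (if i \<le> h \<or> 0 \<le> B i x then 1 else - 1 :: real)" for x i
  define \<sigma> where "\<sigma> x = (\<lambda>i\<in>{1..N}. y x i)" for x
  let ?w = "\<lambda>a x. y x (fst a) * y x (snd a)"
  have finA: "finite (A k)" for k by (simp add: A_def)
  have cardA: "card (A k) = 2 * h" if "k \<in> K" for k
    using that by (subst A_def, subst card_Un_disjoint) (auto simp: K_def card_cartesian_product)
  have Asub: "A k \<subseteq> sites N" if "k \<in> K" for k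
    using that h by (auto simp: A_def K_def sites_def)
  have INsub: "IN \<subseteq> sites N" using h by (auto simp: IN_def K_def sites_def)
  have part: "sites N = IN \<union> (\<Union>k\<in>K. A k)"
  proof (intro equalityI subsetI)
    fix p assume "p \<in> sites N"
    then obtain a c where p: "p = (a, c)" "a \<in> {1..N}" "c \<in> {1..N}" by (auto simp: sites_def)
    consider "p \<in> IN" | "a \<le> h" "c \<in> K" | "a \<in> K" "c \<le> h"
      using p by (cases "a \<le> h"; cases "c \<le> h") (auto simp: IN_def K_def)
    then show "p \<in> IN \<union> (\<Union>k\<in>K. A k)"
    proof cases
      case 2
      then have "p \<in> A c" using p by (auto simp: A_def)
      then show ?thesis using 2 by blast
    next
      case 3
      then have "p \<in> A a" using p by (auto simp: A_def)
      then show ?thesis using 3 by blast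
    qed blast
  qed (use Asub INsub in auto)
  have disj: "IN \<inter> (\<Union>k\<in>K. A k) = {}" by (auto simp: IN_def K_def A_def)
  have disjA: "A k \<inter> A l = {}" if "k \<in> K" "l \<in> K" "k \<noteq> l" for k l using that by (auto simp: A_def K_def)
  have \<sigma>: "\<sigma> x \<in> hypercube N" for x by (auto simp: \<sigma>_def hypercube_def y_def)
  have energy: "ener N N x (\<sigma> x) = (\<Sum>a\<in>IN. x a * ?w a x) + (\<Sum>k\<in>K. \<bar>B k x\<bar>)" for x
  proof -
    have "ener N N x (\<sigma> x) = (\<Sum>a\<in>sites N. x a * ?w a x)"
      unfolding ener_eq_sum[OF \<sigma> order_refl] by (intro sum.cong refl) (auto simp: \<sigma>_def mem_sites)
    also have "\<dots> = (\<Sum>a\<in>IN. x a * ?w a x) + (\<Sum>a\<in>(\<Union>k\<in>K. A k). x a * ?w a x)"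
      unfolding part using disj finA INsub finite_subset[OF INsub] by (intro sum.union_disjoint) (auto simp: K_def)
    also have "(\<Sum>a\<in>(\<Union>k\<in>K. A k). x a * ?w a x) = (\<Sum>k\<in>K. \<Sum>a\<in>A k. x a * ?w a x)"
      using finA disjA by (intro sum.UNION_disjoint) (auto simp: K_def)
    also have "\<dots> = (\<Sum>k\<in>K. \<bar>B k x\<bar>)"
    proof (intro sum.cong refl)
      fix k assume k: "k \<in> K"
      have "(\<Sum>a\<in>A k. x a * ?w a x) = (\<Sum>a\<in>A k. x a * y x k)"
        by (intro sum.cong refl) (auto simp: A_def y_def)
      also have "\<dots> = B k x * y x k" by (simp add: B_def sum_distrib_right)
      also have "\<dots> = \<bar>B k x\<bar>" using k by (auto simp: y_def K_def)
      finally show "(\<Sum>a\<in>A k. x a * ?w a x) = \<bar>B k x\<bar>" .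
    qed
    finally show ?thesis .
  qed
  have Bm: "B k \<in> borel_measurable (gauss (sites N))" if "k \<in> K" for k
    unfolding B_def[abs_def] using Asub[OF that] by (intro borel_measurable_sum measurable_gauss_component) auto
  have ym: "(\<lambda>x. y x i) \<in> borel_measurable (gauss (sites N))" if "i \<in> {1..N}" for i
  proof (cases "i \<le> h")
    case False
    then have [measurable]: "B i \<in> borel_measurable (gauss (sites N))" using that by (intro Bm) (simp add: K_def)
    have "(\<lambda>x. y x i) = (\<lambda>x. if 0 \<le> B i x then 1 else - 1)" using False by (simp add: y_def fun_eq_iff)
    then show ?thesis by simp
  qed (simp add: y_def)
  \<comment> \<open>The chosen signs depend only on couplings between the halves, so a coupling in
    \<open>IN\<close> is independent of its weight.\<close>
  have zero: "integrable (gauss (sites N)) (\<lambda>x. x a * ?w a x) \<and> (\<integral>x. x a * ?w a x \<partial>gauss (sites N)) = 0"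
    if a: "a \<in> IN" for a
  proof -
    have as: "a \<in> sites N" using a INsub by auto
    have wi: "integrable (gauss (sites N)) (?w a)"
    proof (rule integrable_gauss_bounded[of _ _ 1])
      show "?w a \<in> borel_measurable (gauss (sites N))"
        using as by (intro borel_measurable_times ym) (auto simp: mem_sites)
    qed (auto simp: y_def)
    have inv: "?w a (x(a := t)) = ?w a x" for x t
    proof -
      have "B k (x(a := t)) = B k x" if "k \<in> K" for k
        unfolding B_def using a that disj by (intro sum.cong refl) auto
      then have "y (x(a := t)) i = y x i" if "i \<in> {1..N}" for i
        using that by (auto simp: y_def K_def)
      then show ?thesis using as by (simp add: mem_sites)
    qed
    show ?thesis
      using gauss_isolate[OF finite_sites as integrable_stdn_id wi inv] by (simp add: integral_stdn_id)
  qed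
  have Bi: "integrable (gauss (sites N)) (\<lambda>x. \<bar>B k x\<bar>)" if "k \<in> K" for k
    unfolding B_def using Asub[OF that]
    by (intro integrable_abs Bochner_Integration.integrable_sum integrable_gauss_component integrable_stdn_id) auto
  \<comment> \<open>The second half has at least \<open>N / 2\<close> spins and
    \<open>sqrt N\<close> is at most twice \<open>sqrt (2 * h)\<close>, so 160 is 4 times the 40 of
    \<open>gauss_abs_sum_lower\<close>.\<close>
  have "real N * sqrt N / 160 \<le> card K * (sqrt (2 * h) / 40)"
  proof -
    have "sqrt N \<le> sqrt (4 * real h)" using h by (intro real_sqrt_le_mono) linarith
    also have "\<dots> = sqrt 2 * sqrt (2 * h)" by (simp add: real_sqrt_mult[symmetric])
    also have "\<dots> \<le> 2 * sqrt (2 * h)" using sqrt2_less_2 by (intro mult_right_mono) auto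
    finally have "sqrt N \<le> 2 * sqrt (2 * h)" .
    moreover have "real N \<le> 2 * card K" using h by (simp add: K_def)
    ultimately have "real N * sqrt N \<le> (2 * card K) * (2 * sqrt (2 * h))" by (intro mult_mono) auto
    then show ?thesis by simp
  qed
  also have "\<dots> = (\<Sum>k\<in>K. sqrt (card (A k)) / 40)" by (simp add: cardA)
  also have "\<dots> \<le> (\<Sum>k\<in>K. \<integral>x. \<bar>B k x\<bar> \<partial>gauss (sites N))"
  proof (rule sum_mono)
    fix k assume k: "k \<in> K"
    have "A k \<noteq> {}" using h by (auto simp: A_def)
    then show "sqrt (card (A k)) / 40 \<le> (\<integral>x. \<bar>B k x\<bar> \<partial>gauss (sites N))"
      unfolding B_def by (intro gauss_abs_sum_lower Asub k) simp
  qed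
  also have "\<dots> = (\<integral>x. ener N N x (\<sigma> x) \<partial>gauss (sites N))"
    unfolding energy using zero Bi
    by (subst Bochner_Integration.integral_add) (auto simp: Bochner_Integration.integral_sum)
  also have "\<dots> \<le> mean_top N N"
    unfolding mean_top_def
  proof (rule integral_mono)
    show "integrable (gauss (sites N)) (\<lambda>x. ener N N x (\<sigma> x))"
      unfolding energy using zero Bi by auto
    show "ener N N x (\<sigma> x) \<le> top_ener N N x" for x by (intro top_ener_ge \<sigma>) simp
  qed (rule top_ener_integrable, simp)
  finally show ?thesis .
qed

section \<open>Selecting a separated set from a probability measure\<close>

lemma sum_UN_le:
  fixes f :: "'a \<Rightarrow> real"
  assumes "finite A" "\<And>c. c \<in> A \<Longrightarrow> finite (G c)" "\<And>c d. c \<in> A \<Longrightarrow> d \<in> G c \<Longrightarrow> 0 \<le> f d"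
  shows "sum f (\<Union>c\<in>A. G c) \<le> (\<Sum>c\<in>A. sum f (G c))"
  using assms
proof (induction A rule: finite_induct)
  case (insert c A)
  let ?U = "\<Union>c\<in>A. G c"
  have "sum f (G c \<union> ?U) + sum f (G c \<inter> ?U) = sum f (G c) + sum f ?U"
    using insert by (intro sum.union_inter) auto
  moreover have "0 \<le> sum f (G c \<inter> ?U)" using insert.prems by (intro sum_nonneg) auto
  moreover have "sum f ?U \<le> (\<Sum>c\<in>A. sum f (G c))" using insert by auto
  ultimately show ?case using insert.hyps by simp
qed simp

text \<open>Greedy selection: discard the bad points and the points related to a large mass, then pick
  successively points unrelated to those already chosen.\<close>

lemma greedy_selection:
  fixes \<nu> :: "'c \<Rightarrow> real" and R :: "'c \<Rightarrow> 'c \<Rightarrow> bool"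
  assumes C: "finite C" and \<nu>: "\<And>c. c \<in> C \<Longrightarrow> 0 \<le> \<nu> c" "(\<Sum>c\<in>C. \<nu> c) = 1"
    and refl: "\<And>c. c \<in> C \<Longrightarrow> R c c" and m: "1 \<le> m"
    and small: "(\<Sum>c\<in>{c\<in>C. D c}. \<nu> c) + 2 * real m * (\<Sum>c\<in>C. \<Sum>d\<in>{d\<in>C. R c d}. \<nu> c * \<nu> d) < 1 / 2"
    and sym: "\<And>c d. R c d \<Longrightarrow> R d c"
  shows "\<exists>A\<subseteq>C. card A = m \<and> (\<forall>c\<in>A. \<not> D c) \<and> (\<forall>c\<in>A. \<forall>d\<in>A. c \<noteq> d \<longrightarrow> \<not> R c d)"
proof -
  define w where "w c = (\<Sum>d\<in>{d\<in>C. R c d}. \<nu> d)" for c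
  \<comment> \<open>The points related to mass at least \<open>1 / (2 * m)\<close>; Markov's
    inequality bounds their mass by the pair sum in \<open>small\<close>.\<close>
  define E where "E = {c\<in>C. 1 / (2 * m) \<le> w c}"
  have w0: "0 \<le> w c" for c unfolding w_def by (intro sum_nonneg \<nu>(1)) auto
  have mass: "0 \<le> sum \<nu> B" if "B \<subseteq> C" for B using that by (intro sum_nonneg \<nu>(1)) auto
  have E: "sum \<nu> E \<le> 2 * real m * (\<Sum>c\<in>C. \<Sum>d\<in>{d\<in>C. R c d}. \<nu> c * \<nu> d)"
  proof -
    have "sum \<nu> E \<le> (\<Sum>c\<in>E. 2 * m * (\<nu> c * w c))"
    proof (rule sum_mono)
      fix c assume c: "c \<in> E"
      then have "1 \<le> 2 * m * w c" using m by (simp add: E_def field_simps)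
      then have "\<nu> c * 1 \<le> \<nu> c * (2 * m * w c)" using c by (intro mult_left_mono \<nu>(1)) (auto simp: E_def)
      then show "\<nu> c \<le> 2 * m * (\<nu> c * w c)" by (simp add: mult_ac)
    qed
    also have "\<dots> \<le> (\<Sum>c\<in>C. 2 * m * (\<nu> c * w c))"
      using C w0 \<nu>(1) by (intro sum_mono2) (auto simp: E_def)
    finally show ?thesis by (simp add: w_def sum_distrib_left mult_ac)
  qed
  have "\<exists>A\<subseteq>C. card A = k \<and> (\<forall>c\<in>A. \<not> D c \<and> c \<notin> E) \<and> (\<forall>c\<in>A. \<forall>d\<in>A. c \<noteq> d \<longrightarrow> \<not> R c d)"
    if "k \<le> m" for k
    using that
  proof (induction k)
    case (Suc k)
    then obtain A where A: "A \<subseteq> C" "card A = k" "\<And>c. c \<in> A \<Longrightarrow> \<not> D c \<and> c \<notin> E"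
      "\<And>c d. c \<in> A \<Longrightarrow> d \<in> A \<Longrightarrow> c \<noteq> d \<Longrightarrow> \<not> R c d" by auto
    have finA: "finite A" using A(1) C finite_subset by auto
    \<comment> \<open>The forbidden points: the first two sets have mass below 1/2, and the at most
      \<open>m\<close> neighborhoods of points outside \<open>E\<close> add at most 1/2.\<close>
    let ?X = "{c\<in>C. D c} \<union> E \<union> (\<Union>c\<in>A. {d\<in>C. R c d})"
    have X: "?X \<subseteq> C" by (auto simp: E_def)
    have "sum \<nu> ?X < 1"
    proof -
      have fin: "finite {c\<in>C. D c}" "finite E" "finite (\<Union>c\<in>A. {d\<in>C. R c d})"
        using C finA by (auto simp: E_def)
      have "sum \<nu> ?X \<le> sum \<nu> ({c\<in>C. D c} \<union> E) + sum \<nu> (\<Union>c\<in>A. {d\<in>C. R c d})"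
        using fin mass by (subst sum.union_inter[symmetric]) (auto intro!: sum_nonneg \<nu>(1))
      also have "sum \<nu> ({c\<in>C. D c} \<union> E) \<le> sum \<nu> {c\<in>C. D c} + sum \<nu> E"
        using fin mass by (subst sum.union_inter[symmetric]) (auto intro!: sum_nonneg \<nu>(1) simp: E_def)
      also have "sum \<nu> (\<Union>c\<in>A. {d\<in>C. R c d}) \<le> (\<Sum>c\<in>A. w c)"
        unfolding w_def using finA C \<nu>(1) by (intro sum_UN_le) auto
      also have "(\<Sum>c\<in>A. w c) \<le> (\<Sum>c\<in>A. 1 / (2 * m))"
        using A by (intro sum_mono) (force simp: E_def)
      also have "\<dots> = real k / (2 * m)" by (simp add: A(2))
      also have "\<dots> \<le> 1 / 2" using Suc.prems m by (simp add: field_simps)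
      finally show ?thesis using small E by linarith
    qed
    then have "?X \<noteq> C" using \<nu>(2) by auto
    then obtain c where c: "c \<in> C" "c \<notin> ?X" using X by blast
    have cA: "c \<notin> A" using c refl by auto
    show ?case
    proof (intro exI[of _ "insert c A"] conjI)
      show "insert c A \<subseteq> C" using c A by auto
      show "card (insert c A) = Suc k" using cA finA A by simp
      show "\<forall>d\<in>insert c A. \<not> D d \<and> d \<notin> E" using c A by auto
      show "\<forall>d\<in>insert c A. \<forall>d'\<in>insert c A. d \<noteq> d' \<longrightarrow> \<not> R d d'"
      proof (intro ballI impI)
        fix d d' assume d: "d \<in> insert c A" "d' \<in> insert c A" "d \<noteq> d'"
        have new: "\<not> R a c" if "a \<in> A" for a using c that by auto
        consider "d = c" "d' \<in> A" | "d \<in> A" "d' = c" | "d \<in> A" "d' \<in> A" using d by auto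
        then show "\<not> R d d'"
        proof cases
          case 1
          then show ?thesis using new[of d'] sym[of d d'] by auto
        next
          case 2
          then show ?thesis using new[of d] by simp
        next
          case 3
          then show ?thesis using A(4) d(3) by simp
        qed
      qed
    qed
  qed auto
  from this[of m] show ?thesis by auto
qed

section \<open>Energy of the couplings outside the subsystem\<close>

context sk begin

text \<open>The outer couplings are centered and independent of the sampling measure, so in the
  second moment only the diagonal survives: at most \<open>N * N\<close>. The first moment then
  follows from the inequality between arithmetic and geometric means.\<close>

theorem outside_energy:
  assumes r: "0 \<le> r" "r \<le> 1"
  shows "integrable (gauss (sites N)) (\<lambda>x. \<Sum>\<sigma>\<in>HC. nu r x \<sigma> * \<bar>ener N N x \<sigma> - ener N n x \<sigma>\<bar>)"
    and "(\<integral>x. (\<Sum>\<sigma>\<in>HC. nu r x \<sigma> * \<bar>ener N N x \<sigma> - ener N n x \<sigma>\<bar>) \<partial>gauss (sites N)) \<le> N"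
proof -
  interpret g: prob_space "gauss (sites N)" by (rule prob_space_gauss)
  let ?O = "sites N - sites n"
  have N: "real N > 0" using nN n1 by simp
  have Y: "ener N N x \<sigma> - ener N n x \<sigma> = (\<Sum>a\<in>?O. x a * (\<sigma> (fst a) * \<sigma> (snd a)))" if "\<sigma> \<in> HC" for x \<sigma>
    using that nN sites_mono[OF nN] by (simp add: ener_eq_sum sum.subset_diff[of "sites n" "sites N"])
  have nui: "integrable (gauss (sites N)) (\<lambda>x. nu r x \<sigma>)" if "\<sigma> \<in> HC" for \<sigma>
    using that nu_le_1[OF _ that r] nu_nonneg[OF r]
    by (intro integrable_bounded_prob[OF prob_space_gauss nu_measurable, of _ _ 1]) auto
  have xx: "integrable (gauss (sites N)) (\<lambda>x. x a * (x a' * nu r x \<sigma>))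
      \<and> (\<integral>x. x a * (x a' * nu r x \<sigma>) \<partial>gauss (sites N)) = (if a = a' then \<integral>x. nu r x \<sigma> \<partial>gauss (sites N) else 0)"
    if \<sigma>: "\<sigma> \<in> HC" and a: "a \<in> ?O" "a' \<in> ?O" for a a' \<sigma>
  proof (cases "a = a'")
    case True
    have eq: "x a * (x a' * nu r x \<sigma>) = (x a)\<^sup>2 * nu r x \<sigma>" for x using True by (simp add: power2_eq_square)
    have "integrable (gauss (sites N)) (\<lambda>x. (x a)\<^sup>2 * nu r x \<sigma>) \<and>
       (\<integral>x. (x a)\<^sup>2 * nu r x \<sigma> \<partial>gauss (sites N)) = (\<integral>u. u\<^sup>2 \<partial>stdn) * (\<integral>x. nu r x \<sigma> \<partial>gauss (sites N))"
      using a by (intro conjI gauss_isolate[OF finite_sites _ integrable_stdn_power nui[OF \<sigma>]]) (auto intro!: nu_upd)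
    then show ?thesis unfolding eq using True by (simp add: integral_stdn_sq)
  next
    case False
    have i: "integrable (gauss (sites N)) (\<lambda>x. x a' * nu r x \<sigma>)"
      using a by (intro gauss_isolate(1)[OF finite_sites _ integrable_stdn_id nui[OF \<sigma>]]) (auto intro!: nu_upd)
    have inv: "(x(a := t)) a' * nu r (x(a := t)) \<sigma> = x a' * nu r x \<sigma>" for x t
    proof -
      have "a \<notin> sites n" using a by simp
      from nu_upd[OF this] show ?thesis using False by simp
    qed
    have "integrable (gauss (sites N)) (\<lambda>x. x a * (x a' * nu r x \<sigma>)) \<and>
       (\<integral>x. x a * (x a' * nu r x \<sigma>) \<partial>gauss (sites N)) = (\<integral>u. u \<partial>stdn) * (\<integral>x. x a' * nu r x \<sigma> \<partial>gauss (sites N))"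
      using a by (intro conjI gauss_isolate[OF finite_sites _ integrable_stdn_id i inv]) auto
    then show ?thesis using False by (simp add: integral_stdn_id)
  qed
  have expand: "nu r x \<sigma> * (ener N N x \<sigma> - ener N n x \<sigma>)\<^sup>2
      = (\<Sum>a\<in>?O. \<Sum>a'\<in>?O. ((\<sigma> (fst a) * \<sigma> (snd a)) * (\<sigma> (fst a') * \<sigma> (snd a'))) * (x a * (x a' * nu r x \<sigma>)))"
    if "\<sigma> \<in> HC" for x \<sigma>
    unfolding Y[OF that] power2_eq_square sum_product unfolding sum_distrib_left by (simp add: mult_ac)
  have sqi: "integrable (gauss (sites N)) (\<lambda>x. nu r x \<sigma> * (ener N N x \<sigma> - ener N n x \<sigma>)\<^sup>2)" if "\<sigma> \<in> HC" for \<sigma>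
    unfolding expand[OF that] using xx[OF that]
    by (intro Bochner_Integration.integrable_sum integrable_mult_right) auto
  have sqe: "(\<integral>x. nu r x \<sigma> * (ener N N x \<sigma> - ener N n x \<sigma>)\<^sup>2 \<partial>gauss (sites N))
     = card ?O * (\<integral>x. nu r x \<sigma> \<partial>gauss (sites N))" if \<sigma>: "\<sigma> \<in> HC" for \<sigma>
  proof -
    have "(\<integral>x. nu r x \<sigma> * (ener N N x \<sigma> - ener N n x \<sigma>)\<^sup>2 \<partial>gauss (sites N))
      = (\<Sum>a\<in>?O. \<Sum>a'\<in>?O. ((\<sigma> (fst a) * \<sigma> (snd a)) * (\<sigma> (fst a') * \<sigma> (snd a')))
           * (if a = a' then \<integral>x. nu r x \<sigma> \<partial>gauss (sites N) else 0))"
      unfolding expand[OF \<sigma>]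
      by (subst Bochner_Integration.integral_sum, (use xx[OF \<sigma>] in \<open>intro Bochner_Integration.integrable_sum integrable_mult_right, simp\<close>),
          intro sum.cong refl, subst Bochner_Integration.integral_sum) (auto simp: xx[OF \<sigma>])
    also have "\<dots> = (\<Sum>a\<in>?O. ((\<sigma> (fst a) * \<sigma> (snd a)) * (\<sigma> (fst a) * \<sigma> (snd a))) * (\<integral>x. nu r x \<sigma> \<partial>gauss (sites N)))"
    proof (intro sum.cong refl)
      fix a assume a: "a \<in> ?O"
      have "(\<Sum>a'\<in>?O. ((\<sigma> (fst a) * \<sigma> (snd a)) * (\<sigma> (fst a') * \<sigma> (snd a'))) * (if a = a' then \<integral>x. nu r x \<sigma> \<partial>gauss (sites N) else 0))
        = (\<Sum>a'\<in>{a}. ((\<sigma> (fst a) * \<sigma> (snd a)) * (\<sigma> (fst a') * \<sigma> (snd a'))) * (\<integral>x. nu r x \<sigma> \<partial>gauss (sites N)))"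
        using a by (intro sum.mono_neutral_cong_right) auto
      then show "(\<Sum>a'\<in>?O. ((\<sigma> (fst a) * \<sigma> (snd a)) * (\<sigma> (fst a') * \<sigma> (snd a'))) * (if a = a' then \<integral>x. nu r x \<sigma> \<partial>gauss (sites N) else 0))
        = ((\<sigma> (fst a) * \<sigma> (snd a)) * (\<sigma> (fst a) * \<sigma> (snd a))) * (\<integral>x. nu r x \<sigma> \<partial>gauss (sites N))" by simp
    qed
    also have "\<dots> = (\<Sum>a\<in>?O. \<integral>x. nu r x \<sigma> \<partial>gauss (sites N))"
    proof (intro sum.cong refl)
      fix a assume "a \<in> ?O"
      then have "\<sigma> (fst a) * \<sigma> (fst a) = 1" "\<sigma> (snd a) * \<sigma> (snd a) = 1"
        by (auto intro!: hypercube_sq[OF \<sigma>] simp: mem_sites)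
      then have "(\<sigma> (fst a) * \<sigma> (snd a)) * (\<sigma> (fst a) * \<sigma> (snd a)) = 1"
        by (metis mult.left_commute mult.commute mult_1)
      then show "((\<sigma> (fst a) * \<sigma> (snd a)) * (\<sigma> (fst a) * \<sigma> (snd a))) * (\<integral>x. nu r x \<sigma> \<partial>gauss (sites N)) = (\<integral>x. nu r x \<sigma> \<partial>gauss (sites N))"
        by simp
    qed
    finally show ?thesis by simp
  qed
  let ?Y = "\<lambda>x \<sigma>. ener N N x \<sigma> - ener N n x \<sigma>"
  let ?q = "\<lambda>x \<sigma>. N / 2 * nu r x \<sigma> + 1 / (2 * N) * (nu r x \<sigma> * (?Y x \<sigma>)\<^sup>2)"
  have pt: "nu r x \<sigma> * \<bar>?Y x \<sigma>\<bar> \<le> ?q x \<sigma>" for x \<sigma>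
  proof -
    let ?y = "\<bar>?Y x \<sigma>\<bar>"
    have "0 \<le> (?y - N)\<^sup>2" by simp
    then have "2 * N * ?y \<le> N * N + (?Y x \<sigma>)\<^sup>2" by (simp add: power2_eq_square algebra_simps)
    then have "?y \<le> N / 2 + 1 / (2 * N) * (?Y x \<sigma>)\<^sup>2" using N by (simp add: field_simps)
    then have "nu r x \<sigma> * ?y \<le> nu r x \<sigma> * (N / 2 + 1 / (2 * N) * (?Y x \<sigma>)\<^sup>2)"
      by (intro mult_left_mono nu_nonneg r)
    then show ?thesis by (simp add: algebra_simps)
  qed
  have qi: "integrable (gauss (sites N)) (\<lambda>x. ?q x \<sigma>)" if "\<sigma> \<in> HC" for \<sigma>
    using nui[OF that] sqi[OF that] by simp
  have ai: "integrable (gauss (sites N)) (\<lambda>x. nu r x \<sigma> * \<bar>?Y x \<sigma>\<bar>)" if "\<sigma> \<in> HC" for \<sigma>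
  proof (rule Bochner_Integration.integrable_bound[OF qi[OF that]])
    show "(\<lambda>x. nu r x \<sigma> * \<bar>?Y x \<sigma>\<bar>) \<in> borel_measurable (gauss (sites N))"
      using nN by (intro borel_measurable_times borel_measurable_abs borel_measurable_diff nu_measurable that ener_measurable) auto
    show "AE x in gauss (sites N). norm (nu r x \<sigma> * \<bar>?Y x \<sigma>\<bar>) \<le> norm (?q x \<sigma>)"
    proof (rule AE_I2)
      fix x
      have "0 \<le> nu r x \<sigma> * \<bar>?Y x \<sigma>\<bar>" by (intro mult_nonneg_nonneg nu_nonneg r) simp
      then show "norm (nu r x \<sigma> * \<bar>?Y x \<sigma>\<bar>) \<le> norm (?q x \<sigma>)" using pt[of x \<sigma>] by simp
    qed
  qed
  show "integrable (gauss (sites N)) (\<lambda>x. \<Sum>\<sigma>\<in>HC. nu r x \<sigma> * \<bar>?Y x \<sigma>\<bar>)"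
    using ai by (intro Bochner_Integration.integrable_sum)
  have tot: "(\<Sum>\<sigma>\<in>HC. \<integral>x. nu r x \<sigma> \<partial>gauss (sites N)) = 1"
  proof -
    have "(\<Sum>\<sigma>\<in>HC. \<integral>x. nu r x \<sigma> \<partial>gauss (sites N)) = (\<integral>x. (\<Sum>\<sigma>\<in>HC. nu r x \<sigma>) \<partial>gauss (sites N))"
      using nui by (simp add: Bochner_Integration.integral_sum)
    also have "\<dots> = (\<integral>x. 1 \<partial>gauss (sites N))" by (intro Bochner_Integration.integral_cong refl nu_sum)
    finally show ?thesis by (simp add: g.prob_space)
  qed
  have "(\<integral>x. (\<Sum>\<sigma>\<in>HC. nu r x \<sigma> * \<bar>?Y x \<sigma>\<bar>) \<partial>gauss (sites N)) \<le> (\<integral>x. (\<Sum>\<sigma>\<in>HC. ?q x \<sigma>) \<partial>gauss (sites N))"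
    using ai qi pt by (intro integral_mono Bochner_Integration.integrable_sum sum_mono) auto
  also have "\<dots> = (\<Sum>\<sigma>\<in>HC. (N / 2 + 1 / (2 * N) * card ?O) * (\<integral>x. nu r x \<sigma> \<partial>gauss (sites N)))"
    using qi nui sqi by (simp add: Bochner_Integration.integral_sum sqe algebra_simps)
  also have "\<dots> = N / 2 + 1 / (2 * N) * card ?O"
    unfolding sum_distrib_left[symmetric] tot by simp
  also have "\<dots> \<le> N / 2 + 1 / (2 * N) * (N * N)"
  proof (intro add_left_mono mult_left_mono)
    have "card ?O \<le> card (sites N)" by (intro card_mono) auto
    then show "real (card ?O) \<le> N * N" by (metis card_sites of_nat_le_iff)
  qed simp
  finally show "(\<integral>x. (\<Sum>\<sigma>\<in>HC. nu r x \<sigma> * \<bar>?Y x \<sigma>\<bar>) \<partial>gauss (sites N)) \<le> N" using N by simp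
qed

end

text \<open>Asking for a fixed cardinality leaves finitely many candidate sets, each with overlap
  conditions free of the disorder; this makes the event measurable.\<close>

definition good :: "nat \<Rightarrow> real \<Rightarrow> real \<Rightarrow> real \<Rightarrow> nat \<Rightarrow> (nat \<times> nat \<Rightarrow> real) \<Rightarrow> bool" where
  "good N \<alpha> \<delta> \<epsilon> m x \<longleftrightarrow> (\<exists>A\<subseteq>hypercube N. card A = m \<and>
     (\<forall>\<sigma>\<in>A. \<forall>\<tau>\<in>A. \<sigma> \<noteq> \<tau> \<longrightarrow> (overlap N \<sigma> \<tau>)\<^sup>2 \<le> \<epsilon>) \<and>
     (\<forall>\<sigma>\<in>A. \<bar>ener N N x \<sigma> - \<alpha> * top_ener N N x\<bar> \<le> \<delta> * \<bar>top_ener N N x\<bar>))"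

lemma good_measurable: "{x \<in> space (gauss (sites N)). good N \<alpha> \<delta> \<epsilon> m x} \<in> sets (gauss (sites N))"
proof -
  let ?As = "{A. A \<subseteq> hypercube N \<and> card A = m \<and> (\<forall>\<sigma>\<in>A. \<forall>\<tau>\<in>A. \<sigma> \<noteq> \<tau> \<longrightarrow> (overlap N \<sigma> \<tau>)\<^sup>2 \<le> \<epsilon>)}"
  have fin: "finite ?As" by (rule finite_subset[of _ "Pow (hypercube N)"]) (auto simp: finite_hypercube)
  have [measurable]: "top_ener N N \<in> borel_measurable (gauss (sites N))" by (rule top_ener_measurable) simp
  have [measurable]: "(\<lambda>x. ener N N x \<sigma>) \<in> borel_measurable (gauss (sites N))" for \<sigma> by (rule ener_measurable) simp
  have "{x \<in> space (gauss (sites N)). good N \<alpha> \<delta> \<epsilon> m x}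
     = {x \<in> space (gauss (sites N)). \<exists>A\<in>?As. \<forall>\<sigma>\<in>A. \<bar>ener N N x \<sigma> - \<alpha> * top_ener N N x\<bar> \<le> \<delta> * \<bar>top_ener N N x\<bar>}"
    by (auto simp: good_def)
  also have "\<dots> \<in> sets (gauss (sites N))"
  proof (intro sets.sets_Collect_finite_Ex sets.sets_Collect_finite_All fin)
    fix A assume "A \<in> ?As"
    then show "finite A" using finite_hypercube finite_subset by auto
    fix \<sigma> show "{x \<in> space (gauss (sites N)). \<bar>ener N N x \<sigma> - \<alpha> * top_ener N N x\<bar> \<le> \<delta> * \<bar>top_ener N N x\<bar>} \<in> sets (gauss (sites N))"
      by measurable
  qed
  finally show ?thesis .
qed

lemma overlap_self: "\<sigma> \<in> hypercube N \<Longrightarrow> 1 \<le> N \<Longrightarrow> overlap N \<sigma> \<sigma> = 1"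
  by (simp add: overlap_def hypercube_sq)

lemma overlap_commute: "overlap N \<sigma> \<tau> = overlap N \<tau> \<sigma>"
  by (simp add: overlap_def mult.commute)

section \<open>The failure probability\<close>

context sk begin

text \<open>Failure of the greedy selection forces one of three errors to be large. Writing this as
  one linear inequality reduces the failure probability to three expectations. The constants come
  from the case where the maximum is at least \<open>T / 2\<close>, so that a bad point misses by
  more than \<open>\<delta> * T / 2\<close>.\<close>

lemma good_criterion:
  assumes x: "x \<in> space (gauss (sites N))" and r: "0 \<le> r" "r \<le> 1"
    and \<delta>: "0 < \<delta>" and \<epsilon>: "0 < \<epsilon>" "\<epsilon> < 1" and m: "1 \<le> m" and T: "0 < T"
    and bad: "\<not> good N \<alpha> \<delta> \<epsilon> m x"
  shows "1 \<le> (2 / T) * \<bar>top_ener N N x - T\<bar>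
      + (4 / (\<delta> * T)) * (\<Sum>\<sigma>\<in>HC. nu r x \<sigma> * \<bar>ener N N x \<sigma> - \<alpha> * top_ener N N x\<bar>)
      + (4 * m / \<epsilon>) * (\<Sum>\<sigma>\<in>HC. \<Sum>\<tau>\<in>HC. nu r x \<sigma> * nu r x \<tau> * (overlap N \<sigma> \<tau>)\<^sup>2)"
    (is "1 \<le> ?a + ?c * ?e + ?d * ?o")
proof -
  have nn: "0 \<le> nu r x \<sigma>" for \<sigma> by (rule nu_nonneg[OF r])
  have e0: "0 \<le> ?e" and o0: "0 \<le> ?o" by (intro sum_nonneg mult_nonneg_nonneg nn; simp)+
  have a0: "0 \<le> ?a" using T by simp
  have c0: "0 \<le> ?c" "0 \<le> ?d" using \<delta> T \<epsilon> by auto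
  show ?thesis
  proof (cases "\<bar>top_ener N N x - T\<bar> \<le> T / 2")
    case False
    then have "1 \<le> ?a" using T by (simp add: field_simps)
    then show ?thesis using e0 o0 c0 mult_nonneg_nonneg[of ?c ?e] mult_nonneg_nonneg[of ?d ?o] by linarith
  next
    case True
    then have M: "T / 2 \<le> top_ener N N x" unfolding abs_le_iff by linarith
    let ?M = "top_ener N N x"
    let ?D = "\<lambda>\<sigma>. \<not> \<bar>ener N N x \<sigma> - \<alpha> * ?M\<bar> \<le> \<delta> * \<bar>?M\<bar>"
    let ?R = "\<lambda>\<sigma> \<tau>. \<not> (overlap N \<sigma> \<tau>)\<^sup>2 \<le> \<epsilon>"
    let ?p = "\<Sum>\<sigma>\<in>{\<sigma>\<in>HC. ?D \<sigma>}. nu r x \<sigma>"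
    let ?q = "\<Sum>\<sigma>\<in>HC. \<Sum>\<tau>\<in>{\<tau>\<in>HC. ?R \<sigma> \<tau>}. nu r x \<sigma> * nu r x \<tau>"
    have p: "(\<delta> * T / 2) * ?p \<le> ?e"
    proof -
      have "(\<delta> * T / 2) * ?p = (\<Sum>\<sigma>\<in>{\<sigma>\<in>HC. ?D \<sigma>}. nu r x \<sigma> * (\<delta> * T / 2))"
        by (simp add: sum_distrib_left mult.commute)
      also have "\<dots> \<le> (\<Sum>\<sigma>\<in>{\<sigma>\<in>HC. ?D \<sigma>}. nu r x \<sigma> * \<bar>ener N N x \<sigma> - \<alpha> * ?M\<bar>)"
      proof (intro sum_mono mult_left_mono nn)
        fix \<sigma> assume "\<sigma> \<in> {\<sigma>\<in>HC. ?D \<sigma>}"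
        moreover have "\<delta> * T / 2 \<le> \<delta> * \<bar>?M\<bar>" using mult_left_mono[of "T / 2" "\<bar>?M\<bar>" \<delta>] M \<delta> by simp
        ultimately show "\<delta> * T / 2 \<le> \<bar>ener N N x \<sigma> - \<alpha> * ?M\<bar>" by simp
      qed
      also have "\<dots> \<le> ?e" using finC nn by (intro sum_mono2) auto
      finally show ?thesis .
    qed
    have q: "\<epsilon> * ?q \<le> ?o"
    proof -
      have "\<epsilon> * ?q = (\<Sum>\<sigma>\<in>HC. \<Sum>\<tau>\<in>{\<tau>\<in>HC. ?R \<sigma> \<tau>}. nu r x \<sigma> * nu r x \<tau> * \<epsilon>)"
        by (simp add: sum_distrib_left mult_ac)
      also have "\<dots> \<le> (\<Sum>\<sigma>\<in>HC. \<Sum>\<tau>\<in>{\<tau>\<in>HC. ?R \<sigma> \<tau>}. nu r x \<sigma> * nu r x \<tau> * (overlap N \<sigma> \<tau>)\<^sup>2)"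
        by (intro sum_mono mult_left_mono mult_nonneg_nonneg nn) auto
      also have "\<dots> \<le> ?o" using finC nn by (intro sum_mono sum_mono2) auto
      finally show ?thesis .
    qed
    \<comment> \<open>Otherwise the greedy selection would produce the set that \<open>bad\<close>
      excludes.\<close>
    have "\<not> ?p + 2 * real m * ?q < 1 / 2"
    proof
      assume small: "?p + 2 * real m * ?q < 1 / 2"
      have "\<exists>A\<subseteq>HC. card A = m \<and> (\<forall>\<sigma>\<in>A. \<not> ?D \<sigma>) \<and> (\<forall>\<sigma>\<in>A. \<forall>\<tau>\<in>A. \<sigma> \<noteq> \<tau> \<longrightarrow> \<not> ?R \<sigma> \<tau>)"
      proof (rule greedy_selection[of HC "nu r x" ?R m ?D, OF finC nn nu_sum[OF x] _ m small])
        show "?R \<sigma> \<sigma>" if "\<sigma> \<in> HC" for \<sigma> using overlap_self[OF that] nN n1 \<epsilon> by simp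
        show "?R \<tau> \<sigma>" if "?R \<sigma> \<tau>" for \<sigma> \<tau> using that by (simp add: overlap_commute)
      qed
      then show False using bad unfolding good_def by auto
    qed
    then have "1 \<le> 2 * ?p + 4 * m * ?q" by simp
    moreover have "2 * ?p \<le> ?c * ?e"
      using mult_left_mono[OF p, of ?c] \<delta> T by (simp add: field_simps)
    moreover have "4 * m * ?q \<le> ?d * ?o"
      using mult_left_mono[OF q, of ?d] \<epsilon> by (simp add: field_simps)
    ultimately show ?thesis using a0 by linarith
  qed
qed

text \<open>Expectation of the linear bound in \<open>good_criterion\<close> at
  \<open>T = mean_top N N\<close>, with all error terms estimated separately.\<close>

theorem prob_not_good:
  fixes r t \<alpha> \<delta> \<epsilon> :: real
  assumes r: "0 \<le> r" "r \<le> 1" and \<alpha>: "0 \<le> \<alpha>" "\<alpha> \<le> 1"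
    and \<delta>: "0 < \<delta>" and \<epsilon>: "0 < \<epsilon>" "\<epsilon> < 1" and m: "1 \<le> m" and T: "0 < mean_top N N" and t: "0 < t"
  shows "measure (gauss (sites N)) {x \<in> space (gauss (sites N)). \<not> good N \<alpha> \<delta> \<epsilon> m x}
    \<le> 2 * real N / mean_top N N
      + (4 / (\<delta> * mean_top N N)) * (N / b + 2 * ((real N + 1 + t\<^sup>2 * ((1 - r) * (real N)\<^sup>2)) / t)
          + 3 * real N + \<bar>mean_top N n - \<alpha> * mean_top N N\<bar>)
      + (4 * real m / \<epsilon>) * (2 * (phi (r\<^sup>2) / (real N)\<^sup>2) + 2 / N)"
proof -
  interpret g: prob_space "gauss (sites N)" by (rule prob_space_gauss)
  let ?G = "gauss (sites N)" and ?T = "mean_top N N" and ?k = "\<bar>mean_top N n - \<alpha> * mean_top N N\<bar>"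
  note fe = field_eq_ener[OF nN b0] and te = top_field_eq_top_ener[OF nN b0]
  have N1: "1 \<le> N" using nN n1 by simp
  let ?e1 = "\<lambda>x. \<Sum>\<sigma>\<in>HC. nu r x \<sigma> * (top_ener N n x - ener N n x \<sigma>)"
  let ?e2 = "\<lambda>x. \<Sum>\<sigma>\<in>HC. nu r x \<sigma> * \<bar>ener N N x \<sigma> - ener N n x \<sigma>\<bar>"
  let ?d1 = "\<lambda>x. \<bar>top_ener N n x - mean_top N n\<bar>" and ?d2 = "\<lambda>x. \<bar>top_ener N N x - ?T\<bar>"
  let ?o = "\<lambda>x. \<Sum>\<sigma>\<in>HC. \<Sum>\<tau>\<in>HC. nu r x \<sigma> * nu r x \<tau> * (overlap N \<sigma> \<tau>)\<^sup>2"
  let ?Q = "\<lambda>x. (2 / ?T) * ?d2 x + (4 / (\<delta> * ?T)) * (?e1 x + ?e2 x + ?d1 x + ?d2 x + ?k) + (4 * m / \<epsilon>) * ?o x"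
  have i1: "integrable ?G ?e1" and E1: "(\<integral>x. ?e1 x \<partial>?G) \<le> N / b + 2 * ((N + 1 + t\<^sup>2 * ((1 - r) * (real N)\<^sup>2)) / t)"
  proof -
    note gb = gap_bound[OF r t, unfolded fe te]
    show "integrable ?G ?e1" by (rule gb(1))
    have l1: "ln (real (card HC)) \<le> N"
    proof -
      have "ln (real (card HC)) = N * ln 2" by (simp add: card_hypercube ln_realpow)
      also have "\<dots> \<le> real N * 1" using ln_le_minus_one[of 2] by (intro mult_left_mono) auto
      finally show ?thesis by simp
    qed
    have l2: "ln (real (2 * card HC)) \<le> N + 1"
    proof -
      have "ln (real (2 * card HC)) = ln 2 + ln (real (card HC))" by (simp add: card_hypercube ln_mult)
      then show ?thesis using l1 ln_le_minus_one[of 2] by simp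
    qed
    have "(\<integral>x. ?e1 x \<partial>?G) \<le> ln (real (card HC)) / b + 2 * ((ln (real (2 * card HC)) + t\<^sup>2 * ((1 - r) * real (card (sites N)))) / t)"
      by (rule gb(2))
    also have "\<dots> \<le> N / b + 2 * ((N + 1 + t\<^sup>2 * ((1 - r) * real (card (sites N)))) / t)"
      using l1 l2 b0 t r by (intro add_mono mult_left_mono divide_right_mono) auto
    finally show "(\<integral>x. ?e1 x \<partial>?G) \<le> N / b + 2 * ((N + 1 + t\<^sup>2 * ((1 - r) * (real N)\<^sup>2)) / t)"
      by (simp add: power2_eq_square)
  qed
  have i2: "integrable ?G ?e2" and E2: "(\<integral>x. ?e2 x \<partial>?G) \<le> N" using outside_energy[OF r] by auto
  have id1: "integrable ?G ?d1" and D1: "(\<integral>x. ?d1 x \<partial>?G) \<le> N"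
    using top_ener_integrable[OF nN] top_ener_deviation[OF nN N1] by auto
  have id2: "integrable ?G ?d2" and D2: "(\<integral>x. ?d2 x \<partial>?G) \<le> N"
    using top_ener_integrable[OF order_refl] top_ener_deviation[OF order_refl N1] by auto
  have io: "integrable ?G ?o"
  proof (intro Bochner_Integration.integrable_sum integrable_mult_left)
    fix \<sigma> \<tau> assume h: "\<sigma> \<in> HC" "\<tau> \<in> HC"
    show "integrable ?G (\<lambda>x. nu r x \<sigma> * nu r x \<tau>)"
    proof (rule integrable_bounded_prob[OF prob_space_gauss])
      show "(\<lambda>x. nu r x \<sigma> * nu r x \<tau>) \<in> borel_measurable ?G" by (intro borel_measurable_times nu_measurable h)
      show "\<bar>nu r x \<sigma> * nu r x \<tau>\<bar> \<le> 1" if "x \<in> space ?G" for x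
        using nu_le_1[OF that _ r] nu_nonneg[OF r] h by (simp add: abs_mult mult_le_one)
    qed
  qed
  have iQ: "integrable ?G ?Q"
    by (intro Bochner_Integration.integrable_add integrable_mult_right i1 i2 id1 id2 io) simp
  let ?B = "{x \<in> space ?G. \<not> good N \<alpha> \<delta> \<epsilon> m x}"
  have B: "?B \<in> sets ?G"
  proof -
    have "?B = space ?G - {x \<in> space ?G. good N \<alpha> \<delta> \<epsilon> m x}" by auto
    then show ?thesis using good_measurable by auto
  qed
  have Q0: "0 \<le> ?Q x" if "x \<in> space ?G" for x
    using T \<delta> \<epsilon> nu_nonneg[OF r] top_ener_ge[OF nN]
    by (intro add_nonneg_nonneg mult_nonneg_nonneg sum_nonneg divide_nonneg_nonneg) auto
  have ind: "indicator ?B x \<le> ?Q x" if x: "x \<in> space ?G" for x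
  proof (cases "good N \<alpha> \<delta> \<epsilon> m x")
    case True
    then show ?thesis using Q0[OF x] by simp
  next
    case False
    \<comment> \<open>The energy error is split into the gap inside the subsystem, the outer
      couplings, the fluctuations of the two maxima, and the mismatch of their means.\<close>
    have "(\<Sum>\<sigma>\<in>HC. nu r x \<sigma> * \<bar>ener N N x \<sigma> - \<alpha> * top_ener N N x\<bar>)
       \<le> (\<Sum>\<sigma>\<in>HC. nu r x \<sigma> * (top_ener N n x - ener N n x \<sigma>) + nu r x \<sigma> * \<bar>ener N N x \<sigma> - ener N n x \<sigma>\<bar>
            + nu r x \<sigma> * (?d1 x + ?d2 x + ?k))"
    proof (rule sum_mono)
      fix \<sigma> assume "\<sigma> \<in> HC"
      then have g0: "ener N n x \<sigma> \<le> top_ener N n x" by (rule top_ener_ge[OF nN])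
      have "\<alpha> * ?d2 x \<le> 1 * ?d2 x" using \<alpha> by (intro mult_right_mono) auto
      then have "\<bar>\<alpha> * (?T - top_ener N N x)\<bar> \<le> ?d2 x" using \<alpha> by (simp add: abs_mult abs_minus_commute)
      then have "\<bar>ener N N x \<sigma> - \<alpha> * top_ener N N x\<bar>
        \<le> (top_ener N n x - ener N n x \<sigma>) + \<bar>ener N N x \<sigma> - ener N n x \<sigma>\<bar> + (?d1 x + ?d2 x + ?k)"
        using g0 unfolding right_diff_distrib by linarith
      then have "nu r x \<sigma> * \<bar>ener N N x \<sigma> - \<alpha> * top_ener N N x\<bar>
        \<le> nu r x \<sigma> * ((top_ener N n x - ener N n x \<sigma>) + \<bar>ener N N x \<sigma> - ener N n x \<sigma>\<bar> + (?d1 x + ?d2 x + ?k))"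
        by (intro mult_left_mono nu_nonneg r)
      then show "nu r x \<sigma> * \<bar>ener N N x \<sigma> - \<alpha> * top_ener N N x\<bar>
        \<le> nu r x \<sigma> * (top_ener N n x - ener N n x \<sigma>) + nu r x \<sigma> * \<bar>ener N N x \<sigma> - ener N n x \<sigma>\<bar>
            + nu r x \<sigma> * (?d1 x + ?d2 x + ?k)" by (simp only: distrib_left)
    qed
    also have "\<dots> = ?e1 x + ?e2 x + (?d1 x + ?d2 x + ?k)"
      unfolding sum.distrib sum_distrib_right[symmetric] nu_sum[OF x] by simp
    finally have "(4 / (\<delta> * ?T)) * (\<Sum>\<sigma>\<in>HC. nu r x \<sigma> * \<bar>ener N N x \<sigma> - \<alpha> * top_ener N N x\<bar>)
      \<le> (4 / (\<delta> * ?T)) * (?e1 x + ?e2 x + ?d1 x + ?d2 x + ?k)"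
      using \<delta> T by (intro mult_left_mono) auto
    then show ?thesis
      using good_criterion[OF x r \<delta> \<epsilon> m T False] False x by simp
  qed
  have "measure ?G ?B = (\<integral>x. indicator ?B x \<partial>?G)" using B by simp
  also have "\<dots> \<le> (\<integral>x. ?Q x \<partial>?G)"
    using B ind by (intro integral_mono iQ) (auto simp: g.emeasure_eq_measure)
  also have "\<dots> = (2 / ?T) * (\<integral>x. ?d2 x \<partial>?G)
     + (4 / (\<delta> * ?T)) * ((\<integral>x. ?e1 x \<partial>?G) + (\<integral>x. ?e2 x \<partial>?G) + (\<integral>x. ?d1 x \<partial>?G) + (\<integral>x. ?d2 x \<partial>?G) + ?k)
     + (4 * m / \<epsilon>) * (\<integral>x. ?o x \<partial>?G)"
  proof -
    have kc: "has_bochner_integral ?G (\<lambda>_. ?k) ?k" by (simp add: has_bochner_integral_iff g.prob_space)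
    have "has_bochner_integral ?G ?Q ((2 / ?T) * (\<integral>x. ?d2 x \<partial>?G)
     + (4 / (\<delta> * ?T)) * ((\<integral>x. ?e1 x \<partial>?G) + (\<integral>x. ?e2 x \<partial>?G) + (\<integral>x. ?d1 x \<partial>?G) + (\<integral>x. ?d2 x \<partial>?G) + ?k)
     + (4 * m / \<epsilon>) * (\<integral>x. ?o x \<partial>?G))"
      by (intro has_bochner_integral_add has_bochner_integral_mult_right has_bochner_integral_integrable
          i1 i2 id1 id2 io kc)
    then show ?thesis by (rule has_bochner_integral_integral_eq)
  qed
  also have "\<dots> \<le> (2 / ?T) * N
     + (4 / (\<delta> * ?T)) * ((N / b + 2 * ((N + 1 + t\<^sup>2 * ((1 - r) * (real N)\<^sup>2)) / t)) + N + N + N + ?k)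
     + (4 * m / \<epsilon>) * (2 * (phi (r\<^sup>2) / (real N)\<^sup>2) + 2 / N)"
    using T \<delta> \<epsilon> overlap_bound[OF r] E1 E2 D1 D2
    by (intro add_mono mult_left_mono order_refl) auto
  finally show ?thesis by (simp add: add_ac)
qed

end

lemma mean_top_zero: "mean_top N 0 = 0"
proof -
  have "ener N 0 x = (\<lambda>_. 0)" for x by (simp add: ener_def spin_def sites_def fun_eq_iff)
  then have "top_ener N 0 x = 0" for x using hypercube_ne[of N] by (simp add: top_ener_def image_constant_conv)
  then show ?thesis by (simp add: mean_top_def)
qed

text \<open>Discrete intermediate values: the energy level \<open>\<alpha> M\<close> is the ground state energy of a smaller system.\<close>

lemma subsystem_exists:
  assumes N: "2 \<le> N" and \<alpha>: "0 < \<alpha>" "\<alpha> \<le> 1"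
  obtains n where "1 \<le> n" "n \<le> N" "\<alpha> / 320 * N \<le> n"
    "\<bar>mean_top N n - \<alpha> * mean_top N N\<bar> \<le> 3 * N"
proof -
  let ?T = "mean_top N N"
  have low: "real N * sqrt N / 160 \<le> ?T" by (rule mean_top_lower[OF N])
  then have T: "0 < ?T" using N by (intro less_le_trans[OF _ low]) simp
  \<comment> \<open>The predecessor of the least such \<open>n\<close> is below the level, so the
    overshoot is at most one increment.\<close>
  define n where "n = (LEAST n. \<alpha> * ?T \<le> mean_top N n)"
  have ex: "\<alpha> * ?T \<le> mean_top N N" using \<alpha> T by (simp add: mult_left_le_one_le)
  have n: "\<alpha> * ?T \<le> mean_top N n" unfolding n_def by (rule LeastI[of _ N]) (rule ex)
  have nN: "n \<le> N" unfolding n_def by (rule Least_le) (rule ex)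
  have n1: "1 \<le> n"
  proof (rule ccontr)
    assume "\<not> 1 \<le> n"
    then have "n = 0" by simp
    have "\<alpha> * ?T \<le> 0" using n unfolding \<open>n = 0\<close> mean_top_zero .
    then show False using mult_pos_pos[OF \<alpha>(1) T] by linarith
  qed
  then obtain p where p: "n = Suc p" by (cases n) auto
  have "\<not> \<alpha> * ?T \<le> mean_top N p" using not_less_Least[of p "\<lambda>n. \<alpha> * ?T \<le> mean_top N n"] p n_def by simp
  then have up: "mean_top N n \<le> \<alpha> * ?T + 3 * N" using mean_top_step[of p N] p nN by simp
  \<comment> \<open>The lower bound for the full system meets the upper bound for the subsystem,
    which shows that \<open>n\<close> is proportional to \<open>N\<close>.\<close>
  have "\<alpha> * (real N * sqrt N / 160) \<le> \<alpha> * ?T" using low \<alpha> by (intro mult_left_mono) auto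
  also have "\<dots> \<le> 2 * n * sqrt N" using n mean_top_upper[OF n1 nN] by linarith
  finally have "(\<alpha> / 160 * N) * sqrt N \<le> (2 * n) * sqrt N" by (simp add: mult_ac)
  then have "\<alpha> / 160 * N \<le> 2 * n" using N by simp
  then show ?thesis using that[OF n1 nN] n up by simp
qed

section \<open>Choice of parameters and asymptotics\<close>

lemma dyadic_between:
  fixes x :: real assumes "1 \<le> x" obtains k :: nat where "x \<le> 2 ^ k" "2 ^ k \<le> 2 * x"
proof -
  define k where "k = (LEAST k::nat. x \<le> 2 ^ k)"
  obtain j :: nat where "x < 2 ^ j" using real_arch_pow[of 2 x] by auto
  then have "x \<le> 2 ^ j" by simp
  then have k: "x \<le> 2 ^ k" unfolding k_def by (rule LeastI[of "\<lambda>k. x \<le> 2 ^ k" j])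
  have "2 ^ k \<le> 2 * x"
  proof (cases k)
    case (Suc p)
    then have "\<not> x \<le> 2 ^ p" using not_less_Least[of p "\<lambda>k. x \<le> 2 ^ k"] k_def by simp
    then show ?thesis using Suc by simp
  qed (use assms in simp)
  with k show ?thesis by (rule that)
qed

context sk begin

text \<open>The parameter \<open>r\<close> is defined so that \<open>k\<close> squarings of
  \<open>r\<^sup>2\<close> end at \<open>s\<close>, where \<open>phi_small\<close> applies;
  \<open>phi_power_le\<close> carries the bound back at the cost of a root of order
  \<open>2 ^ k\<close>.\<close>

lemma psi_bound:
  assumes s: "0 < s" "b\<^sup>2 * n * s \<le> 1 / 8" "s < 1" and P: "8 * n / (real N)\<^sup>2 + 864 * n * b ^ 3 \<le> P" "P \<le> 1"
    and K: "2 ^ k \<le> (K::real)"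
  defines "r \<equiv> s powr (1 / 2 ^ Suc k)"
  shows "phi (r\<^sup>2) / (real N)\<^sup>2 \<le> P powr (1 / K)"
proof -
  have N: "real N > 0" and n: "real n > 0" using nN n1 by auto
  have P0: "0 < P" using n N b0 by (intro less_le_trans[OF _ P(1)] add_pos_pos) auto
  have r2: "r\<^sup>2 = s powr (1 / 2 ^ k)"
    using s by (simp add: r_def power2_eq_square powr_add[symmetric])
  have r2b: "0 \<le> r\<^sup>2" "r\<^sup>2 \<le> 1" unfolding r2 using s by (auto intro: powr_le1)
  have rs: "(r\<^sup>2) ^ (2 ^ k) = s"
  proof -
    have "(r\<^sup>2) ^ (2 ^ k) = (s powr (1 / 2 ^ k)) powr real (2 ^ k)"
      unfolding r2 using s by (subst powr_realpow) auto
    also have "\<dots> = s" using s by (simp add: powr_powr)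
    finally show ?thesis .
  qed
  let ?p = "phi (r\<^sup>2) / (real N)\<^sup>2"
  have p0: "0 \<le> ?p" using phi_nonneg[OF r2b] by simp
  \<comment> \<open>The strength \<open>1 / (8 * n)\<close> uses half of the allowed 1/4; the other
    half is consumed by the interpolation.\<close>
  have "1 / (8 * real n) * phi s \<le> 1 + 108 * (real N)\<^sup>2 * b ^ 3"
  proof (rule phi_small)
    have "(1 / (8 * real n) + b\<^sup>2 * s) * n = 1 / 8 + b\<^sup>2 * n * s" using n by (simp add: field_simps)
    then show "(1 / (8 * real n) + b\<^sup>2 * s) * n \<le> 1 / 4" using s by simp
  qed (use s n in auto)
  then have "phi s \<le> 8 * n * (1 + 108 * (real N)\<^sup>2 * b ^ 3)" using n by (simp add: field_simps)
  then have "phi s / (real N)\<^sup>2 \<le> 8 * n * (1 + 108 * (real N)\<^sup>2 * b ^ 3) / (real N)\<^sup>2"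
    by (intro divide_right_mono) auto
  also have "\<dots> = 8 * n / (real N)\<^sup>2 + 864 * n * b ^ 3" using N by (simp add: field_simps)
  finally have "phi s / (real N)\<^sup>2 \<le> P" using P by simp
  moreover have "?p ^ (2 ^ k) \<le> phi s / (real N)\<^sup>2"
    using phi_power_le[OF r2b, of k] unfolding rs by (simp add: power2_eq_square)
  ultimately have pk: "?p ^ (2 ^ k) \<le> P" by linarith
  show ?thesis
  proof (cases "?p = 0")
    case False
    then have pp: "0 < ?p" using p0 by (metis order_le_imp_less_or_eq)
    have "(?p ^ (2 ^ k)) powr (1 / 2 ^ k) = ?p powr 1"
      unfolding powr_realpow[OF pp, symmetric] powr_powr by simp
    then have "?p = (?p ^ (2 ^ k)) powr (1 / 2 ^ k)" using p0 powr_one_gt_zero_iff[of ?p] by (metis (no_types))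
    also have "\<dots> \<le> P powr (1 / 2 ^ k)" using pk pp by (intro powr_mono2) auto
    also have "\<dots> \<le> P powr (1 / K)"
    proof (rule powr_mono')
      have "0 < K" by (rule less_le_trans[OF _ K]) simp
      then show "1 / K \<le> 1 / 2 ^ k" using K by (intro divide_left_mono) auto
    qed (use P0 P in auto)
    finally show ?thesis .
  next
    case True
    show ?thesis unfolding True by simp
  qed
qed

end

text \<open>The bound of \<open>prob_not_good\<close> after all substitutions, over real
  \<open>N\<close> for asymptotic analysis. The numbers 320 and 640 are 2 and 4 times the 160 of
  \<open>mean_top_lower\<close>, and \<open>c\<close> bounds \<open>n / N\<close> from
  below.\<close>

definition err :: "real \<Rightarrow> real \<Rightarrow> real" where
  "err c N = 320 / sqrt N
     + (640 / ln N powr (-1/8)) * (ln N powr (-3/8) + 6 * sqrt (ln (8 * ln N powr (3/4)) / (2 * ln N powr (3/4))) + 6 / sqrt N)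
     + (4 * (ln N powr (1/8) + 1) / exp (- (ln N powr (1/8)))) *
       (2 * (8 / N + 864 * ln N powr (9/8) / sqrt (c * N)) powr (1 / (2 * ln N powr (3/4))) + 2 / N)"

text \<open>The first term decays like a power of \<open>N\<close>; the second is of order
  \<open>ln N powr (-1/4)\<close> up to an iterated logarithm; in the third, the decay exp(-(ln
  N)^(1/4) / 4) beats the factor exp((ln N)^(1/8)).\<close>

lemma err_small:
  assumes c: "c > 0"
  shows "\<forall>\<^sub>F N in at_top. err c N \<le> 2 * ln N powr (-1/12)"
proof -
  have "((\<lambda>N. 320 / sqrt N * ln N powr (1/12)) \<longlongrightarrow> 0) at_top" by real_asymp
  moreover have "((\<lambda>N. (640 / ln N powr (-1/8)) * (ln N powr (-3/8) + 6 * sqrt (ln (8 * ln N powr (3/4)) / (2 * ln N powr (3/4))) + 6 / sqrt N) * ln N powr (1/12)) \<longlongrightarrow> 0) at_top"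
    by real_asymp
  moreover have "((\<lambda>N. (4 * (ln N powr (1/8) + 1) / exp (- (ln N powr (1/8)))) *
       (2 * (8 / N + 864 * ln N powr (9/8) / sqrt (c * N)) powr (1 / (2 * ln N powr (3/4))) + 2 / N) * ln N powr (1/12)) \<longlongrightarrow> 0) at_top"
    using c by real_asymp
  ultimately have "((\<lambda>N. err c N * ln N powr (1/12)) \<longlongrightarrow> 0 + 0 + 0) at_top"
    unfolding err_def distrib_right by (intro tendsto_add)
  then have "\<forall>\<^sub>F N in at_top. err c N * ln N powr (1/12) < 2"
    by (rule order_tendstoD) simp
  moreover have "\<forall>\<^sub>F N in at_top. (1::real) < ln N" by real_asymp
  ultimately show ?thesis
  proof eventually_elim
    case (elim N)
    then have "ln N powr (-1/12) * ln N powr (1/12) = 1" by (simp add: powr_add[symmetric])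
    then show ?case
      using elim mult_right_mono[of "err c N * ln N powr (1/12)" 2 "ln N powr (-1/12)"]
      by (simp add: mult_ac)
  qed
qed

lemma prob_not_good_eventually:
  assumes \<alpha>: "0 < \<alpha>" "\<alpha> \<le> 1"
  shows "\<forall>\<^sub>F N in sequentially. measure (gauss (sites N))
     {x \<in> space (gauss (sites N)). \<not> good N \<alpha> (\<delta>_seq N) (\<epsilon>_seq N) (nat \<lceil>r_seq N\<rceil>) x} \<le> 2 * \<gamma>_seq 1 N"
proof -
  define c where "c = \<alpha> / 320"
  have c: "0 < c" using \<alpha> by (simp add: c_def)
  have ev1: "\<forall>\<^sub>F N in at_top. (8 / N + 864 * ln N powr (9/8) / sqrt (c * N)) \<le> (1::real)"
  proof -
    have "((\<lambda>N::real. 8 / N + 864 * ln N powr (9/8) / sqrt (c * N)) \<longlongrightarrow> 0) at_top" using c by real_asymp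
    from order_tendstoD(2)[OF this, of 1] show ?thesis by (auto elim: eventually_mono)
  qed
  have ev2: "\<forall>\<^sub>F N in at_top. (1::real) < ln N \<and> 2 \<le> N" by (intro eventually_conj) real_asymp+
  have "\<forall>\<^sub>F N in sequentially. err c (real N) \<le> 2 * ln (real N) powr (-1/12)
      \<and> 8 / real N + 864 * ln (real N) powr (9/8) / sqrt (c * real N) \<le> 1 \<and> 1 < ln (real N) \<and> 2 \<le> real N"
    using eventually_compose_filterlim[OF eventually_conj[OF err_small[OF c] eventually_conj[OF ev1 ev2]] filterlim_real_sequentially] .
  then show ?thesis
  proof eventually_elim
    case (elim N)
    define L where "L = ln (real N)"
    have L: "1 < L" and N2: "2 \<le> N" using elim by (auto simp: L_def)
    have N0: "0 < real N" using N2 by simp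
    obtain n where n: "1 \<le> n" "n \<le> N" "c * N \<le> n" "\<bar>mean_top N n - \<alpha> * mean_top N N\<bar> \<le> 3 * real N"
      by (rule subsystem_exists[OF N2 \<alpha>, folded c_def])
    have n0: "0 < real n" using n by simp
    \<comment> \<open>The inverse temperature is large enough to make the energy loss small and
      small enough to keep the cubic remainder negligible.\<close>
    define \<beta> where "\<beta> = L powr (3/8)"
    define b where "b = \<beta> / sqrt n"
    define K where "K = 2 * L powr (3/4)"
    define s where "s = 1 / (8 * \<beta>\<^sup>2)"
    have \<beta>: "1 < \<beta>" using L by (simp add: \<beta>_def)
    have b0: "0 < b" using \<beta> n0 by (simp add: b_def)
    have L34: "1 \<le> L powr (3/4)" using L by (intro ge_one_powr_ge_zero) auto
    \<comment> \<open>The number \<open>2 ^ k\<close> must be large to bring \<open>r\<close> near 1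
      but may not exceed \<open>K\<close>, lest the root destroy the bound.\<close>
    obtain k :: nat where k: "L powr (3/4) \<le> 2 ^ k" "2 ^ k \<le> K"
      using dyadic_between[OF L34] unfolding K_def by blast
    define r where "r = s powr (1 / 2 ^ Suc k)"
    have \<beta>2: "\<beta>\<^sup>2 = L powr (3/4)" by (simp add: \<beta>_def power2_eq_square powr_add[symmetric])
    have b8: "1 < 8 * \<beta>\<^sup>2" using L34 \<beta>2 by linarith
    have s: "0 < s" "s < 1"
      unfolding s_def using b8 divide_less_eq_1_pos[of "8 * \<beta>\<^sup>2" 1] by (intro divide_pos_pos, linarith+)
    have r: "0 \<le> r" "r < 1"
      unfolding r_def using powr_less_mono2[of "1 / 2 ^ Suc k" s 1] s by auto
    interpret sk N n b by unfold_locales (use n b0 in auto)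
    let ?T = "mean_top N N"
    have low: "real N * sqrt N / 160 \<le> ?T" by (rule mean_top_lower[OF N2])
    then have T: "0 < ?T" using N0 by (intro less_le_trans[OF _ low]) simp
    define P where "P = 8 / real N + 864 * L powr (9/8) / sqrt (c * real N)"
    have psi: "phi (r\<^sup>2) / (real N)\<^sup>2 \<le> P powr (1 / K)"
      unfolding r_def
    proof (rule psi_bound[OF s(1) _ s(2) _ _ k(2)])
      have "b\<^sup>2 * n = \<beta>\<^sup>2" using n0 by (simp add: b_def power_divide)
      then show "b\<^sup>2 * n * s \<le> 1 / 8" using \<beta> by (simp add: s_def)
      show "P \<le> 1" using elim by (simp add: P_def L_def)
      have "8 * n / (real N)\<^sup>2 \<le> 8 * N / (real N)\<^sup>2" using n by (intro divide_right_mono) auto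
      also have "\<dots> = 8 / N" using N0 by (simp add: power2_eq_square)
      finally have "8 * n / (real N)\<^sup>2 \<le> 8 / N" .
      moreover have "864 * n * b ^ 3 \<le> 864 * L powr (9/8) / sqrt (c * real N)"
      proof -
        have "\<beta> ^ 3 = L powr (9/8)" using L by (simp add: \<beta>_def powr_power)
        moreover have "n * b ^ 3 = \<beta> ^ 3 / sqrt n"
        proof -
          have "n * b ^ 3 = (sqrt n * sqrt n) * \<beta> ^ 3 / (sqrt n * sqrt n * sqrt n)"
            using n0 by (simp add: b_def power_divide power3_eq_cube)
          also have "\<dots> = \<beta> ^ 3 / sqrt n" using n0 by (simp del: real_sqrt_mult_self)
          finally show ?thesis .
        qed
        moreover have "L powr (9/8) / sqrt n \<le> L powr (9/8) / sqrt (c * real N)"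
          using n(3) n0 c N0 by (intro divide_left_mono mult_pos_pos) auto
        ultimately show ?thesis by simp
      qed
      ultimately show "8 * n / (real N)\<^sup>2 + 864 * n * b ^ 3 \<le> P" by (simp add: P_def)
    qed
    \<comment> \<open>Makes the two terms of the resampling cost equal, up to constants;
      \<open>r < 1\<close> keeps it well defined.\<close>
    define t where "t = 1 / sqrt ((1 - r) * N)"
    have t: "0 < t" using r N0 by (simp add: t_def)
    let ?\<delta> = "\<delta>_seq N" and ?\<epsilon> = "\<epsilon>_seq N" and ?m = "nat \<lceil>r_seq N\<rceil>"
    have \<delta>: "0 < ?\<delta>" "?\<delta> = L powr (-1/8)" using L by (auto simp: \<delta>_seq_def L_def)
    have \<epsilon>: "0 < ?\<epsilon>" "?\<epsilon> < 1" "?\<epsilon> = exp (- (L powr (1/8)))" using L by (auto simp: \<epsilon>_seq_def L_def)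
    have rs: "0 < r_seq N" "r_seq N = L powr (1/8)" using L by (auto simp: r_seq_def L_def)
    have m: "1 \<le> ?m" "real ?m \<le> L powr (1/8) + 1" using rs by linarith+
    have gap1: "N / b \<le> real N * sqrt N * L powr (-3/8)"
    proof -
      have "N / b = real N * sqrt n / \<beta>" by (simp add: b_def)
      also have "\<dots> \<le> real N * sqrt N / \<beta>" using n \<beta> by (intro divide_right_mono mult_left_mono) auto
      finally show ?thesis by (simp add: \<beta>_def powr_minus_divide)
    qed
    \<comment> \<open>Here \<open>r\<close> is the exponential of
      \<open>- ln (8 * \<beta>\<^sup>2) / 2 ^ Suc k\<close>, so \<open>1 - r\<close> is at most that
      exponent in modulus.\<close>
    have onemr: "1 - r \<le> ln (8 * L powr (3/4)) / K"
    proof -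
      have "r = exp (- (ln (8 * \<beta>\<^sup>2) / 2 ^ Suc k))"
        using s \<beta> by (simp add: r_def s_def powr_def ln_div)
      then have "1 - r \<le> ln (8 * \<beta>\<^sup>2) / 2 ^ Suc k" using exp_ge_add_one_self[of "- (ln (8 * \<beta>\<^sup>2) / 2 ^ Suc k)"] by linarith
      also have "\<dots> \<le> ln (8 * \<beta>\<^sup>2) / K"
        using k L L34 unfolding \<beta>2 by (intro divide_left_mono) (auto simp: K_def)
      finally show ?thesis unfolding \<beta>2 .
    qed
    have gap2: "2 * ((real N + 1 + t\<^sup>2 * ((1 - r) * (real N)\<^sup>2)) / t) \<le> real N * sqrt N * (6 * sqrt (ln (8 * L powr (3/4)) / K))"
    proof -
      have t2: "t\<^sup>2 * ((1 - r) * (real N)\<^sup>2) = N"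
        using r N0 by (simp add: t_def power_divide power2_eq_square)
      have "2 * ((real N + 1 + t\<^sup>2 * ((1 - r) * (real N)\<^sup>2)) / t) = (4 * real N + 2) * sqrt ((1 - r) * N)"
        unfolding t2 by (simp add: t_def algebra_simps)
      also have "\<dots> \<le> (6 * real N) * sqrt ((1 - r) * N)" using N2 r by (intro mult_right_mono) auto
      also have "\<dots> = real N * sqrt N * (6 * sqrt (1 - r))" by (simp add: real_sqrt_mult)
      also have "\<dots> \<le> real N * sqrt N * (6 * sqrt (ln (8 * L powr (3/4)) / K))"
        using onemr by (intro mult_left_mono) auto
      finally show ?thesis .
    qed
    have "measure (gauss (sites N)) {x \<in> space (gauss (sites N)). \<not> good N \<alpha> ?\<delta> ?\<epsilon> ?m x}
      \<le> 2 * real N / ?T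
      + (4 / (?\<delta> * ?T)) * (N / b + 2 * ((real N + 1 + t\<^sup>2 * ((1 - r) * (real N)\<^sup>2)) / t)
          + 3 * real N + \<bar>mean_top N n - \<alpha> * ?T\<bar>)
      + (4 * real ?m / ?\<epsilon>) * (2 * (phi (r\<^sup>2) / (real N)\<^sup>2) + 2 / N)"
      by (rule prob_not_good) (use r \<alpha> \<delta> \<epsilon> m T t in auto)
    also have "\<dots> \<le> 2 * real N / (real N * sqrt N / 160)
      + (4 / (?\<delta> * (real N * sqrt N / 160))) * (real N * sqrt N * L powr (-3/8)
          + real N * sqrt N * (6 * sqrt (ln (8 * L powr (3/4)) / K)) + 3 * real N + 3 * real N)
      + (4 * (L powr (1/8) + 1) / ?\<epsilon>) * (2 * P powr (1 / K) + 2 / N)"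
    proof -
      have t1: "2 * real N / ?T \<le> 2 * real N / (real N * sqrt N / 160)"
        using low T N0 by (intro divide_left_mono) auto
      have c1: "4 / (?\<delta> * ?T) \<le> 4 / (?\<delta> * (real N * sqrt N / 160))"
        using low T N0 \<delta> by (intro divide_left_mono mult_left_mono mult_pos_pos) auto
      have c2: "4 * real ?m / ?\<epsilon> \<le> 4 * (L powr (1/8) + 1) / ?\<epsilon>"
        using m \<epsilon> by (intro divide_right_mono) auto
      have x1: "N / b + 2 * ((real N + 1 + t\<^sup>2 * ((1 - r) * (real N)\<^sup>2)) / t) + 3 * real N + \<bar>mean_top N n - \<alpha> * ?T\<bar>
         \<le> real N * sqrt N * L powr (-3/8) + real N * sqrt N * (6 * sqrt (ln (8 * L powr (3/4)) / K)) + 3 * real N + 3 * real N"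
        by (rule add_mono[OF add_mono[OF add_mono[OF gap1 gap2] order_refl] n(4)])
      have x2: "2 * (phi (r\<^sup>2) / (real N)\<^sup>2) + 2 / N \<le> 2 * P powr (1 / K) + 2 / N" using psi by simp
      have y1: "0 \<le> N / b + 2 * ((real N + 1 + t\<^sup>2 * ((1 - r) * (real N)\<^sup>2)) / t) + 3 * real N + \<bar>mean_top N n - \<alpha> * ?T\<bar>"
        using b0 t r by (intro add_nonneg_nonneg mult_nonneg_nonneg divide_nonneg_nonneg) auto
      have "0 \<le> r\<^sup>2" "r\<^sup>2 \<le> 1" using r by (auto simp: power_le_one)
      then have y2: "0 \<le> 2 * (phi (r\<^sup>2) / (real N)\<^sup>2) + 2 / N" using phi_nonneg by simp
      have z1: "0 \<le> 4 / (?\<delta> * (real N * sqrt N / 160))" using \<delta>(1) by simp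
      have z2: "0 \<le> 4 * (L powr (1/8) + 1) / ?\<epsilon>" using \<epsilon>(1) by simp
      show ?thesis
        by (rule add_mono[OF add_mono[OF t1 mult_mono[OF c1 x1 z1 y1]] mult_mono[OF c2 x2 z2 y2]])
    qed
    also have "\<dots> = err c (real N)"
    proof -
      have a: "2 * real N / (real N * sqrt N / 160) = 320 / sqrt N" using N0 by simp
      have "real N / (real N * sqrt N) = 1 / sqrt N" using N0 by simp
      then have "(4 / (?\<delta> * (real N * sqrt N / 160))) * (real N * sqrt N * L powr (-3/8)
          + real N * sqrt N * (6 * sqrt (ln (8 * L powr (3/4)) / K)) + 3 * real N + 3 * real N)
        = (640 / ?\<delta>) * (L powr (-3/8) + 6 * sqrt (ln (8 * L powr (3/4)) / K) + 6 / sqrt N)"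
        using N0 \<delta>(1) by (simp add: field_simps)
      then show ?thesis
        unfolding a \<delta>(2) \<epsilon>(3) by (simp add: err_def K_def P_def L_def)
    qed
    also have "\<dots> \<le> 2 * \<gamma>_seq 1 N" using elim by (simp add: \<gamma>_seq_def)
    finally show ?case .
  qed
qed

section \<open>Transfer from the product measure to an arbitrary probability space\<close>

lemma distr_iid_std_gaussian:
  assumes M: "prob_space M" and g: "iid_std_gaussian M N g" and N: "1 \<le> N"
  shows "(\<lambda>\<omega>. \<lambda>a\<in>sites N. g (fst a) (snd a) \<omega>) \<in> measurable M (gauss (sites N))"
    and "distr M (gauss (sites N)) (\<lambda>\<omega>. \<lambda>a\<in>sites N. g (fst a) (snd a) \<omega>) = gauss (sites N)"
proof -
  interpret prob_space M by fact
  let ?X = "\<lambda>a. g (fst a) (snd a)"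
  let ?Y = "\<lambda>\<omega>. \<lambda>a\<in>sites N. ?X a \<omega>"
  have ind: "indep_vars (\<lambda>_. borel) ?X (sites N)"
    using g by (simp add: iid_std_gaussian_def sites_def case_prod_unfold)
  have dist: "distributed M lborel (?X a) std_normal_density" if "a \<in> sites N" for a
    using g that unfolding iid_std_gaussian_def by (auto simp: mem_sites)
  have rv: "random_variable borel (?X a)" if "a \<in> sites N" for a
    using distributed_measurable[OF dist[OF that]] by simp
  show Ym: "?Y \<in> measurable M (gauss (sites N))"
    by (rule measurable_gaussI) (auto simp: rv)
  have law: "distr M borel (?X a) = stdn" if "a \<in> sites N" for a
  proof -
    have "distr M borel (?X a) = distr M lborel (?X a)" by (rule distr_cong) auto
    also have "\<dots> = stdn" using distributed_distr_eq_density[OF dist[OF that]] by (simp add: stdn_def)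
    finally show ?thesis .
  qed
  have ne: "sites N \<noteq> {}" using N by (auto simp: sites_def)
  have "distr M (gauss (sites N)) ?Y = distr M (PiM (sites N) (\<lambda>_. borel)) ?Y"
    unfolding gauss_def by (intro distr_cong refl sets_PiM_cong) auto
  also have "\<dots> = PiM (sites N) (\<lambda>a. distr M borel (?X a))"
    using iffD1[OF indep_vars_iff_distr_eq_PiM'[OF ne rv] ind] .
  also have "\<dots> = gauss (sites N)"
    unfolding gauss_def by (intro PiM_cong refl law)
  finally show "distr M (gauss (sites N)) ?Y = gauss (sites N)" .
qed

text \<open>The constant is 1. The event depends on the couplings alone and their joint law is
  \<open>gauss (sites N)\<close>, so one threshold for \<open>N\<close>, depending only on
  \<open>\<alpha>\<close>, serves all probability spaces.\<close>

theorem corollary1p2: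
  "\<exists>C::real. \<forall>\<alpha>\<in>{0<..1::real}. \<forall>\<^sub>F N in sequentially.
     \<forall>(M::'a measure) g. prob_space M \<longrightarrow> iid_std_gaussian M N g \<longrightarrow>
       measure M {\<omega> \<in> space M. \<exists>A\<subseteq>hypercube N.
           real (card A) \<ge> r_seq N \<and>
           (\<forall>\<sigma>\<in>A. \<forall>\<tau>\<in>A. \<sigma> \<noteq> \<tau> \<longrightarrow> (overlap N \<sigma> \<tau>)\<^sup>2 \<le> \<epsilon>_seq N) \<and>
           (\<forall>\<sigma>\<in>A. \<bar>energy N g \<omega> \<sigma> - \<alpha> * max_energy N g \<omega>\<bar>
                      \<le> \<delta>_seq N * \<bar>max_energy N g \<omega>\<bar>)}
         \<ge> 1 - 2 * \<gamma>_seq C N"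
proof (intro exI[of _ 1] ballI)
  fix \<alpha> :: real assume "\<alpha> \<in> {0<..1}"
  then have \<alpha>: "0 < \<alpha>" "\<alpha> \<le> 1" by auto
  have "\<forall>\<^sub>F N in sequentially. 1 \<le> (N::nat)" by (rule eventually_ge_at_top)
  with prob_not_good_eventually[OF \<alpha>]
  show "\<forall>\<^sub>F N in sequentially.
     \<forall>(M::'a measure) g. prob_space M \<longrightarrow> iid_std_gaussian M N g \<longrightarrow>
       measure M {\<omega> \<in> space M. \<exists>A\<subseteq>hypercube N.
           real (card A) \<ge> r_seq N \<and>
           (\<forall>\<sigma>\<in>A. \<forall>\<tau>\<in>A. \<sigma> \<noteq> \<tau> \<longrightarrow> (overlap N \<sigma> \<tau>)\<^sup>2 \<le> \<epsilon>_seq N) \<and>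
           (\<forall>\<sigma>\<in>A. \<bar>energy N g \<omega> \<sigma> - \<alpha> * max_energy N g \<omega>\<bar>
                      \<le> \<delta>_seq N * \<bar>max_energy N g \<omega>\<bar>)}
         \<ge> 1 - 2 * \<gamma>_seq 1 N"
  proof eventually_elim
    case (elim N)
    show ?case
    proof (intro allI impI)
      fix M :: "'a measure" and g :: "nat \<Rightarrow> nat \<Rightarrow> 'a \<Rightarrow> real"
      assume M: "prob_space M" and iid: "iid_std_gaussian M N g"
      interpret prob_space M by fact
      interpret G: prob_space "gauss (sites N)" by (rule prob_space_gauss)
      define Y where "Y = (\<lambda>\<omega>. \<lambda>a\<in>sites N. g (fst a) (snd a) \<omega>)"
      note YD = distr_iid_std_gaussian[OF M iid elim(2), folded Y_def]
      have en: "energy N g \<omega> \<sigma> = ener N N (Y \<omega>) \<sigma>" if "\<sigma> \<in> hypercube N" for \<omega> \<sigma>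
      proof -
        have "ener N N (Y \<omega>) \<sigma> = (\<Sum>a\<in>sites N. g (fst a) (snd a) \<omega> * \<sigma> (fst a) * \<sigma> (snd a))"
          unfolding ener_eq_sum[OF that order_refl] by (intro sum.cong refl) (simp add: Y_def mult.assoc)
        also have "\<dots> = energy N g \<omega> \<sigma>" unfolding energy_def by (rule sum_sites)
        finally show ?thesis ..
      qed
      have mx: "max_energy N g \<omega> = top_ener N N (Y \<omega>)" for \<omega>
        unfolding max_energy_def top_ener_def by (intro arg_cong[of _ _ Max] image_cong refl en)
      let ?E = "{\<omega> \<in> space M. \<exists>A\<subseteq>hypercube N. real (card A) \<ge> r_seq N \<and>
           (\<forall>\<sigma>\<in>A. \<forall>\<tau>\<in>A. \<sigma> \<noteq> \<tau> \<longrightarrow> (overlap N \<sigma> \<tau>)\<^sup>2 \<le> \<epsilon>_seq N) \<and>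
           (\<forall>\<sigma>\<in>A. \<bar>energy N g \<omega> \<sigma> - \<alpha> * max_energy N g \<omega>\<bar> \<le> \<delta>_seq N * \<bar>max_energy N g \<omega>\<bar>)}"
      let ?good = "\<lambda>m. {x \<in> space (gauss (sites N)). good N \<alpha> (\<delta>_seq N) (\<epsilon>_seq N) m x}"
      define ok where "ok A \<omega> \<longleftrightarrow> (\<forall>\<sigma>\<in>A. \<forall>\<tau>\<in>A. \<sigma> \<noteq> \<tau> \<longrightarrow> (overlap N \<sigma> \<tau>)\<^sup>2 \<le> \<epsilon>_seq N) \<and>
           (\<forall>\<sigma>\<in>A. \<bar>energy N g \<omega> \<sigma> - \<alpha> * max_energy N g \<omega>\<bar> \<le> \<delta>_seq N * \<bar>max_energy N g \<omega>\<bar>)" for A \<omega>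
      have goodY: "good N \<alpha> (\<delta>_seq N) (\<epsilon>_seq N) m (Y \<omega>) \<longleftrightarrow> (\<exists>A\<subseteq>hypercube N. card A = m \<and> ok A \<omega>)" for m \<omega>
        unfolding good_def ok_def mx using en by (intro ex_cong1 conj_cong refl ball_cong) (auto dest: subsetD)
      have Edef: "?E = {\<omega> \<in> space M. \<exists>A\<subseteq>hypercube N. r_seq N \<le> real (card A) \<and> ok A \<omega>}"
        unfolding ok_def by (rule refl)
      have Ysp: "Y \<omega> \<in> space (gauss (sites N))" if "\<omega> \<in> space M" for \<omega>
        by (rule measurable_space[OF YD(1) that])
      \<comment> \<open>Splitting by cardinality writes the event as a countable union of preimages.
        Measurability is essential for monotonicity of \<open>measure\<close> below.\<close>
      have Eeq: "?E = (\<Union>m\<in>{m. r_seq N \<le> real m}. Y -` ?good m \<inter> space M)"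
        unfolding Edef by (auto simp: goodY Ysp) blast
      have E: "?E \<in> sets M"
        unfolding Eeq
      proof (rule sets.countable_UN'')
        fix m show "Y -` ?good m \<inter> space M \<in> sets M"
          by (rule measurable_sets[OF YD(1) good_measurable])
      qed (rule countable_subset[OF subset_UNIV], simp)
      let ?m = "nat \<lceil>r_seq N\<rceil>"
      have "1 - 2 * \<gamma>_seq 1 N \<le> 1 - measure (gauss (sites N)) {x \<in> space (gauss (sites N)). \<not> good N \<alpha> (\<delta>_seq N) (\<epsilon>_seq N) ?m x}"
        using elim(1) by simp
      also have "\<dots> = measure (gauss (sites N)) (?good ?m)"
      proof -
        have "{x \<in> space (gauss (sites N)). \<not> good N \<alpha> (\<delta>_seq N) (\<epsilon>_seq N) ?m x} = space (gauss (sites N)) - ?good ?m" by auto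
        then show ?thesis using G.prob_compl[OF good_measurable, of \<alpha> "\<delta>_seq N" "\<epsilon>_seq N" ?m] by simp
      qed
      also have "\<dots> = measure (distr M (gauss (sites N)) Y) (?good ?m)" unfolding YD(2) ..
      also have "\<dots> = measure M (Y -` ?good ?m \<inter> space M)"
        by (rule measure_distr[OF YD(1) good_measurable])
      also have "\<dots> \<le> measure M ?E"
      proof (rule finite_measure_mono[OF _ E])
        have "r_seq N \<le> real ?m" by linarith
        then show "Y -` ?good ?m \<inter> space M \<subseteq> ?E" unfolding Eeq by blast
      qed
      finally show "1 - 2 * \<gamma>_seq 1 N \<le> measure M ?E" .
    qed
  qed
qed

end
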